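(* Fix $\Delta_*>0$ (and $T>0$ for Regime 3). In each of the Regimes 1, 2, 3 there exist $\varepsilon_*>0$ and constants $\mathcal{D}_\phi,\mathcal{D}_\lambda>0$, depending on the considered regime, such that for all $\varepsilon\in[0,\varepsilon_*]$ the perturbed Prony polynomial $\bar q(z)$ for noise intensity $\varepsilon$ yields roots $\hat\phi_n^{Pr}$ and corresponding estimates $\hat\lambda_n^{Pr}=-\frac{\ln(\hat\phi_n^{Pr})}{\Delta}$ of $\lambda_n$, $n\in[N_1]$, that satisfy $$\left|\hat\phi_n^{Pr}-\phi_n\right|\le\varepsilon\,\mathcal{D}_\phi\,\frac{\phi_n\prod_{s\ne n}\phi_s^2}{\prod_{s\ne n}|\phi_s-\phi_n|^2},\qquad \left|\hat\lambda_n^{Pr}-\lambda_n\right|\le\varepsilon\,\mathcal{D}_\lambda\,\frac1\Delta\,\frac{\prod_{s\ne n}\phi_s^2}{\prod_{s\ne n}|\phi_s-\phi_n|^2},$$ where the products are over $s\in[N_1]\setminus\{n\}$. In particular, given $\eta\in(0,1)$, the following asymptotic bounds hold. Regime 1: for $N_1$ sufficiently large, $$|\hat\phi_n^{Pr}-\phi_n|\le\varepsilon\mathcal{D}_\phi^{(1)}e^{-\Delta\Gamma^{Pr}(\eta)N_1^3}\ \text{ for }(n,N_1)\in\mathcal{N}_\eta,$$ $$|\hat\phi_n^{Pr}-\phi_n|\le\varepsilon\mathcal{D}_\phi^{(2)}e^{-\Delta\Gamma_1^{Pr}(\eta)N_1^2}\ \text{ for }(n,N_1)\in\mathcal{N}_1\setminus\mathcal{N}_\eta,$$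 $$|\hat\lambda_n^{Pr}-\lambda_n|\le\varepsilon\frac{\mathcal{D}_\lambda^{(1)}}{\Delta}e^{-\Delta\Gamma^{Pr}(\eta)N_1^3}\ \text{ for }(n,N_1)\in\mathcal{N}_\eta,$$ for some $\Gamma^{Pr}(\eta),\Gamma_1^{Pr}(\eta),\mathcal{D}_\phi^{(1)},\mathcal{D}_\phi^{(2)},\mathcal{D}_\lambda^{(1)}>0$. Regime 2: let $\vartheta>0$. There exists $N_1(\vartheta)\in\mathbb{N}$ such that, for $\Delta$ sufficiently large, $$|\hat\phi_n^{Pr}-\phi_n|\le\varepsilon\mathcal{D}_\phi^{(3)}e^{-\vartheta\Delta}\ \text{ for }(n,N_1)\in\mathcal{N}_1,\qquad |\hat\lambda_n^{Pr}-\lambda_n|\le\varepsilon\frac{\mathcal{D}_\lambda^{(1)}}{\Delta}e^{-\vartheta\Delta}\ \text{ for }(n,N_1)\in\mathcal{N}_\eta,$$ uniformly in $N_1\ge N_1(\vartheta)$, for some constants $\mathcal{D}_\phi^{(3)},\mathcal{D}_\lambda^{(1)}>0$. Regime 3: for $T>0$, $\Delta N_1=T$ and $N_1$ sufficiently large, $$|\hat\phi_n^{Pr}-\phi_n|\le\varepsilon\mathcal{D}_\phi^{(4)}e^{-\Gamma_2^{Pr}(T,\eta)N_1^2}\ \text{ for }(n,N_1)\in\mathcal{N}_\eta,$$ $$|\hat\phi_n^{Pr}-\phi_n|\le\varepsilon\mathcal{D}_\phi^{(5)}e^{-\Gamma_3^{Pr}(T,\eta)N_1}\ \text{ for }(n,N_1)\in\mathcal{N}_1\setminus\mathcal{N}_\eta,$$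 $$|\hat\lambda_n^{Pr}-\lambda_n|\le\varepsilon\frac{\mathcal{D}_\lambda^{(2)}}{\Delta}e^{-\Gamma_2^{Pr}(T,\eta)N_1^2}\ \text{ for }(n,N_1)\in\mathcal{N}_\eta,$$ for some $\Gamma_2^{Pr}(T,\eta),\Gamma_3^{Pr}(T,\eta),\mathcal{D}_\phi^{(4)},\mathcal{D}_\phi^{(5)},\mathcal{D}_\lambda^{(2)}>0$. In particular, for $(n,N_1)\in\mathcal{N}_\eta$, Prony's condition numbers $\mathcal{K}_\lambda^{Pr}(n):=|\hat\lambda_n^{Pr}-\lambda_n|/\varepsilon$ ($\varepsilon>0$) obey bounds of order $e^{-c\Delta N_1^3}$ (Regime 1), $\Delta^{-1}e^{-\vartheta\Delta}$ for any prescribed $\vartheta$ and $N_1\geq N_1(\vartheta)$ (Regime 2), and $e^{-cN_1^2}$ (Regime 3), with constants $c>0$.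
   Context: Let $\mathcal{A}$ be a fixed Sturm-Liouville operator $[\mathcal{A}h](x)=-(p(x)h'(x))'-q(x)h(x)$, $x\in(0,1)$, with domain $\{h\in \mathrm{H}^2(0,1): h(0)=h(1)=0\}$, where $p,q$ are smooth real functions on $[0,1]$ (restrictions of smooth functions defined on a neighborhood of $[0,1]$) and $\min_{[0,1]}p>0$. Let $\{\lambda_n\}_{n=1}^\infty$ be the monotonically increasing, unbounded real sequence of its simple eigenvalues. For $\Delta>0$ put $\phi_n:=e^{-\lambda_n\Delta}$. Notation: $[N]=\{1,\dots,N\}$ and, for $\eta\in(0,1]$, $\mathcal{N}_\eta=\{(n,N_1)\in\mathbb{N}^2:1\le n\le\lfloor\eta N_1\rfloor\}$ (so $\mathcal N_1$ is the case $\eta=1$). The real amplitudes $y_1,\dots,y_{N_1+1}$ satisfy, with constants $\ell>1$ and $M_y>0$ not depending on $N_1,\Delta$: $\ell^{-1}\le|y_n|\le\ell$ for $n\in[N_1]$ and $|y_{N_1+1}|/|y_k|\le M_y$ for $k\in[N_1]$. Measurements with noise intensity $\varepsilon\ge0$: $\tilde m_k=\sum_{n=1}^{N_1}y_n\phi_n^k+\varepsilon y_{N_1+1}\phi_{N_1+1}^k$, $k=0,\dots,2N_1-1$. The perturbed (homogeneous) Prony polynomial is $$\bar q(z)=\det\begin{bmatrix}1&z&\cdots&z^{N_1}\\ \tilde m_0&\tilde m_1&\cdots&\tilde m_{N_1}\\ \vdots&\vdots&&\vdots\\ \tilde m_{N_1-1}&\tilde m_{N_1}&\cdots&\tilde m_{2N_1-1}\end{bmatrix}.$$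 Let $\tau\in(0,\frac12)$ be a constant depending only on $\Delta_*$ with $|\phi_j-\phi_n|/\phi_n\ge2\tau$ for all $n\in\mathbb{N}$, $j\in\mathbb{N}\setminus\{n\}$, $\Delta\ge\Delta_*$. For sufficiently small $\varepsilon$ (threshold uniform within each regime), $\bar q$ has for each $n\in[N_1]$ a real root $\hat\phi_n^{Pr}$ with $|\hat\phi_n^{Pr}-\phi_n|\le\tau\phi_n$; these are the roots referred to. Regimes: Regime 1: $\Delta\ge\Delta_*$ fixed and $N_1\to\infty$. Regime 2: $N_1$ large and fixed, $\Delta\ge\Delta_*$, $\Delta\to\infty$. Regime 3: $\Delta=T/N_1$ with $T>0$ fixed, $N_1\to\infty$. All constants named in the claim are independent of $n$, $N_1$, $\Delta$, $\varepsilon$ within the considered regime. *)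

theory Defs
  imports "HOL-Analysis.Analysis" "HOL-Computational_Algebra.Polynomial"
    "Jordan_Normal_Form.Determinant"
begin

definition smooth_near_unit :: "(real \<Rightarrow> real) \<Rightarrow> bool" where
  "smooth_near_unit f \<longleftrightarrow>
     (\<exists>U. open U \<and> {0..1} \<subseteq> U \<and>
        (\<forall>k. \<forall>x\<in>U. ((deriv ^^ k) f) field_differentiable (at x)))"

text \<open>On an interval, \<open>u\<close> has the integrable weak derivative \<open>v\<close> iff (the continuous
  representative of) \<open>u\<close> is a primitive of \<open>v\<close>. The predicate below refers to
  this representative, so that pointwise values such as boundary values make sense.\<close>

definition weak_deriv :: "(real \<Rightarrow> real) \<Rightarrow> (real \<Rightarrow> real) \<Rightarrow> bool" where
  "weak_deriv u v \<longleftrightarrow>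
     v absolutely_integrable_on {0..1} \<and> (\<forall>x\<in>{0..1}. u x = u 0 + integral {0..x} v)"

text \<open>\<open>H\<^sup>2(0,1)\<close>; square integrability of \<open>h\<close> and \<open>h'\<close> is automatic, as both are continuous.\<close>

definition sobolev_H2 :: "(real \<Rightarrow> real) \<Rightarrow> bool" where
  "sobolev_H2 h \<longleftrightarrow>
     (\<exists>h' h''. weak_deriv h h' \<and> weak_deriv h' h'' \<and>
        (\<lambda>x. (h'' x)\<^sup>2) absolutely_integrable_on {0..1})"

definition SL_domain :: "(real \<Rightarrow> real) set" where
  "SL_domain = {h. sobolev_H2 h \<and> h 0 = 0 \<and> h 1 = 0}"

text \<open>\<open>SL_maps p q h f\<close> states \<open>-(p h')' - q h = f\<close> almost everywhere on \<open>(0,1)\<close>, i.e.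
  as elements of \<open>L\<^sup>2(0,1)\<close>.\<close>

definition SL_maps ::
  "(real \<Rightarrow> real) \<Rightarrow> (real \<Rightarrow> real) \<Rightarrow> (real \<Rightarrow> real) \<Rightarrow> (real \<Rightarrow> real) \<Rightarrow> bool" where
  "SL_maps p q h f \<longleftrightarrow>
     (\<exists>h' w. weak_deriv h h' \<and> weak_deriv (\<lambda>x. p x * h' x) w \<and>
        (AE x in lebesgue_on {0..1}. f x = - w x - q x * h x))"

definition SL_eigenvalue :: "(real \<Rightarrow> real) \<Rightarrow> (real \<Rightarrow> real) \<Rightarrow> real \<Rightarrow> bool" where
  "SL_eigenvalue p q \<mu> \<longleftrightarrow>
     (\<exists>h\<in>SL_domain. (\<exists>x\<in>{0..1}. h x \<noteq> 0) \<and> SL_maps p q h (\<lambda>x. \<mu> * h x))"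

text \<open>Sequences are indexed from 1; the value \<open>lam 0\<close> is irrelevant.\<close>

definition SL_eigenvalue_seq ::
  "(real \<Rightarrow> real) \<Rightarrow> (real \<Rightarrow> real) \<Rightarrow> (nat \<Rightarrow> real) \<Rightarrow> bool" where
  "SL_eigenvalue_seq p q lam \<longleftrightarrow>
     strict_mono_on {1..} lam \<and> lam ` {1..} = {\<mu>. SL_eigenvalue p q \<mu>} \<and>
     filterlim lam at_top sequentially"

definition phi :: "(nat \<Rightarrow> real) \<Rightarrow> real \<Rightarrow> nat \<Rightarrow> real" where
  "phi lam \<Delta> n = exp (- lam n * \<Delta>)"

definition index_set :: "real \<Rightarrow> (nat \<times> nat) set" where
  "index_set \<eta> = {(n, N). 1 \<le> n \<and> int n \<le> \<lfloor>\<eta> * real N\<rfloor>}"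

definition amplitudes :: "real \<Rightarrow> real \<Rightarrow> nat \<Rightarrow> (nat \<Rightarrow> real) \<Rightarrow> bool" where
  "amplitudes l My N y \<longleftrightarrow>
     (\<forall>n\<in>{1..N}. 1 / l \<le> \<bar>y n\<bar> \<and> \<bar>y n\<bar> \<le> l) \<and>
     (\<forall>k\<in>{1..N}. \<bar>y (N + 1)\<bar> / \<bar>y k\<bar> \<le> My)"

definition measurement ::
  "(nat \<Rightarrow> real) \<Rightarrow> real \<Rightarrow> nat \<Rightarrow> (nat \<Rightarrow> real) \<Rightarrow> real \<Rightarrow> nat \<Rightarrow> real" where
  "measurement lam \<Delta> N y \<epsilon> k =
     (\<Sum>n\<in>{1..N}. y n * phi lam \<Delta> n ^ k) + \<epsilon> * y (N + 1) * phi lam \<Delta> (N + 1) ^ k"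

definition prony_poly ::
  "(nat \<Rightarrow> real) \<Rightarrow> real \<Rightarrow> nat \<Rightarrow> (nat \<Rightarrow> real) \<Rightarrow> real \<Rightarrow> real poly" where
  "prony_poly lam \<Delta> N y \<epsilon> =
     Determinant.det (Matrix.mat (N + 1) (N + 1) (\<lambda>(i, j).
       if i = 0 then monom 1 j else [:measurement lam \<Delta> N y \<epsilon> (i - 1 + j):]))"

text \<open>A family of perturbed Prony roots, the \<open>n\<close>-th one lying within relative distance \<open>\<tau>\<close> of
  \<open>\<phi>\<^sub>n\<close>. The roots are labelled in the order of the \<open>\<phi>\<^sub>n\<close>, which is strictly decreasing. If
  \<open>\<bar>\<phi>\<^sub>j - \<phi>\<^sub>n\<bar> \<ge> 2\<tau>\<phi>\<^sub>n\<close> for all \<open>j \<noteq> n\<close>, the discs are disjoint and the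
  ordering is automatic. For \<open>\<Delta> = T/N\<close> the discs overlap, and the ordering is what
  tells the roots apart.\<close>

definition prony_roots ::
  "(nat \<Rightarrow> real) \<Rightarrow> real \<Rightarrow> real \<Rightarrow> nat \<Rightarrow> (nat \<Rightarrow> real) \<Rightarrow> real \<Rightarrow> (nat \<Rightarrow> real) \<Rightarrow> bool" where
  "prony_roots lam \<tau> \<Delta> N y \<epsilon> r \<longleftrightarrow>
     (\<forall>n\<in>{1..N}. poly (prony_poly lam \<Delta> N y \<epsilon>) (r n) = 0 \<and>
                   \<bar>r n - phi lam \<Delta> n\<bar> \<le> \<tau> * phi lam \<Delta> n) \<and>
     strict_antimono_on {1..N} r"

definition lam_est :: "real \<Rightarrow> (nat \<Rightarrow> real) \<Rightarrow> nat \<Rightarrow> real" where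
  "lam_est \<Delta> r n = - ln (r n) / \<Delta>"

definition prony_cond ::
  "(nat \<Rightarrow> real) \<Rightarrow> real \<Rightarrow> real \<Rightarrow> (nat \<Rightarrow> real) \<Rightarrow> nat \<Rightarrow> real" where
  "prony_cond lam \<Delta> \<epsilon> r n = \<bar>lam_est \<Delta> r n - lam n\<bar> / \<epsilon>"

definition node_quotient :: "(nat \<Rightarrow> real) \<Rightarrow> real \<Rightarrow> nat \<Rightarrow> nat \<Rightarrow> real" where
  "node_quotient lam \<Delta> N n =
     (\<Prod>s\<in>{1..N} - {n}. (phi lam \<Delta> s)\<^sup>2) /
     (\<Prod>s\<in>{1..N} - {n}. \<bar>phi lam \<Delta> s - phi lam \<Delta> n\<bar>\<^sup>2)"

text \<open>First-order bounds for given \<open>N\<close> and \<open>\<Delta>\<close>, including the existence of the roots.\<close>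

definition prony_error_bounds ::
  "(nat \<Rightarrow> real) \<Rightarrow> real \<Rightarrow> real \<Rightarrow> real \<Rightarrow> real \<Rightarrow> real \<Rightarrow> real \<Rightarrow> nat \<Rightarrow> real \<Rightarrow> bool" where
  "prony_error_bounds lam l My \<tau> \<epsilon>s Dphi Dlam N \<Delta> \<longleftrightarrow>
     (\<forall>y \<epsilon>. amplitudes l My N y \<and> 0 \<le> \<epsilon> \<and> \<epsilon> \<le> \<epsilon>s \<longrightarrow>
        (\<exists>r. prony_roots lam \<tau> \<Delta> N y \<epsilon> r) \<and>
        (\<forall>r. prony_roots lam \<tau> \<Delta> N y \<epsilon> r \<longrightarrow>
          (\<forall>n\<in>{1..N}.
             \<bar>r n - phi lam \<Delta> n\<bar> \<le> \<epsilon> * Dphi * (phi lam \<Delta> n * node_quotient lam \<Delta> N n) \<and>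
             \<bar>lam_est \<Delta> r n - lam n\<bar> \<le> \<epsilon> * Dlam * (1 / \<Delta>) * node_quotient lam \<Delta> N n)))"

definition prony_outcome ::
  "(nat \<Rightarrow> real) \<Rightarrow> real \<Rightarrow> real \<Rightarrow> real \<Rightarrow> real \<Rightarrow> nat \<Rightarrow> real \<Rightarrow> real \<Rightarrow> (nat \<Rightarrow> real) \<Rightarrow> bool" where
  "prony_outcome lam l My \<tau> \<epsilon>s N \<Delta> \<epsilon> r \<longleftrightarrow>
     0 \<le> \<epsilon> \<and> \<epsilon> \<le> \<epsilon>s \<and> (\<exists>y. amplitudes l My N y \<and> prony_roots lam \<tau> \<Delta> N y \<epsilon> r)"

end

theory Submission
  imports Defs "HOL-Real_Asymp.Real_Asymp"
begin

text \<open>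
  The argument has an operator part, an algebraic part, a perturbation part and an estimate of
  products. They meet in the locale \<open>quadratic_gap\<close>: of the operator, only the inequality
  \<open>\<lambda>\<^sub>s - \<lambda>\<^sub>n \<ge> \<kappa> (s\<^sup>2 - n\<^sup>2)\<close> is used afterwards.

  Operator. Quadratic growth of the gaps follows from a statement about pairs of eigenvalues: the
  square roots of two distinct large eigenvalues differ by at least a constant
  (\<open>eigenvalue_separation\<close>). If \<open>\<surd>\<nu> - \<surd>\<mu>\<close> were small, the
  eigenfunctions, rescaled by \<open>\<surd>\<mu>\<close> and \<open>\<surd>\<nu>\<close> and started with the same slope, would stay uniformly
  close to each other (\<open>phase_comparison\<close>, an energy estimate). They are orthogonal, and each of
  them has \<open>L\<^sup>2\<close> norm bounded below (\<open>L2_lower_bound\<close>), so they cannot be close.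

  Algebra. The bordered Hankel determinant is a polynomial of degree at most \<open>N\<close>, and its value at
  each of the \<open>N + 1\<close> nodes \<open>\<phi>\<^sub>1, \<dots>, \<phi>\<^bsub>N+1\<^esub>\<close> is a product of amplitudes and two Vandermonde determinants. Lagrange
  interpolation then gives, up to a nonzero factor (\<open>prony_poly_factored\<close>),
  \<open>\<Prod>\<^sub>i (\<phi>\<^sub>i - z) + \<epsilon> (\<phi>\<^bsub>N+1\<^esub> - z) \<Sum>\<^sub>k b\<^sub>k \<Prod>\<^bsub>i\<noteq>k\<^esub> (\<phi>\<^sub>i - z)\<close>,
  where \<open>\<bar>b\<^sub>k\<bar> \<le> M\<^sub>y Q\<^sub>k\<close> and \<open>Q\<^sub>k\<close> is the node quotient of the claimed error bound.

  Perturbation. At distance \<open>\<delta>\<^sub>n = 6 M\<^sub>y \<epsilon> \<phi>\<^sub>n Q\<^sub>n\<close> from \<open>\<phi>\<^sub>n\<close> the unperturbed product dominates, so it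
  imposes its sign change on the perturbed polynomial and produces a real root in each of \<open>N\<close>
  disjoint intervals (\<open>perturbed_product_roots\<close>). As the degree is at most \<open>N\<close>, these are all the
  roots, and every decreasing family of \<open>N\<close> roots is this one (\<open>ordered_roots_unique\<close>); so the
  bounds hold for every admissible family of roots. The threshold for \<open>\<epsilon>\<close> is uniform as soon as the
  sums \<open>\<Sum>\<^bsub>k\<noteq>n\<^esub> Q\<^sub>k W\<^bsub>nk\<^esub>\<close> are bounded, where \<open>W\<^bsub>nk\<^esub> = 1 / (1 - exp (- \<bar>\<lambda>\<^sub>n - \<lambda>\<^sub>k\<bar> \<Delta>))\<close> measures the relative
  separation of two nodes.

  Products. The node quotient factors as
  \<open>Q\<^sub>n = (\<Prod>\<^bsub>s\<noteq>n\<^esub> W\<^bsub>sn\<^esub>\<^sup>2) exp (-2\<Delta> \<Sum>\<^bsub>s>n\<^esub> (\<lambda>\<^sub>s - \<lambda>\<^sub>n))\<close> (\<open>node_quotient_eq\<close>). The exponent is at least of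
  order \<open>\<Delta> (N - n)\<^sup>3\<close>, and also at least \<open>2\<Delta> (\<lambda>\<^sub>N - \<lambda>\<^sub>n)\<close>. If \<open>\<Delta>\<close> is bounded below, the product of
  the \<open>W\<close> is bounded. If \<open>\<Delta> = T/N\<close>, it is bounded for \<open>n \<ge> N/2\<close>; for smaller \<open>n\<close> neighbouring nodes
  nearly coincide, but the product is at most \<open>(1 + N/(\<kappa>T))^(2N)\<close>, which the exponential factor of order
  \<open>exp (-c N\<^sup>2)\<close> absorbs. This gives the uniform threshold in each regime and all asymptotic bounds.
\<close>

section \<open>Eigenfunctions as classical solutions\<close>

text \<open>First-order form of \<open>-(p u')' - q u = \<mu> u\<close>, where \<open>P\<close> is the quasi-derivative \<open>p u'\<close>. Both
  derivatives are classical and taken relative to the closed interval.\<close>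

definition SL_solution ::
  "(real \<Rightarrow> real) \<Rightarrow> (real \<Rightarrow> real) \<Rightarrow> real \<Rightarrow> (real \<Rightarrow> real) \<Rightarrow> (real \<Rightarrow> real) \<Rightarrow> bool" where
  "SL_solution p q \<mu> u P \<longleftrightarrow>
     (\<forall>x\<in>{0..1}. (u has_real_derivative P x / p x) (at x within {0..1}) \<and>
                 (P has_real_derivative - (q x + \<mu>) * u x) (at x within {0..1}))"

lemma weak_deriv_continuous:
  assumes "weak_deriv u v"
  shows "continuous_on {0..1} u"
proof -
  have i: "v integrable_on {0..1}" using assms
    unfolding weak_deriv_def by (blast dest: set_lebesgue_integral_eq_integral(1))
  have "continuous_on {0..1} (\<lambda>x. u 0 + integral {0..x} v)"
    by (intro continuous_intros indefinite_integral_continuous_1 i)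
  then show ?thesis
    using assms unfolding weak_deriv_def by (metis (no_types, lifting) continuous_on_cong)
qed

text \<open>A primitive does not see changes of its integrand on null sets. So a continuous representative
  of the weak derivative is a classical derivative.\<close>

lemma weak_deriv_imp_deriv:
  assumes w: "weak_deriv u v" and g: "continuous_on {0..1} g"
    and ae: "AE x in lebesgue_on {0..1}. v x = g x" and x: "x \<in> {0..1}"
  shows "(u has_real_derivative g x) (at x within {0..1})"
proof -
  obtain N where N: "N \<in> null_sets (lebesgue_on {0..1::real})"
    "{x \<in> space (lebesgue_on {0..1}). \<not> v x = g x} \<subseteq> N"
    using ae by (auto simp: eventually_ae_filter)
  have "N \<in> null_sets lebesgue" using N(1)
    by (simp add: null_sets_restrict_space)
  then have neg: "negligible N" by (simp add: negligible_iff_null_sets)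
  have eq: "u y = u 0 + integral {0..y} g" if y: "y \<in> {0..1}" for y
  proof -
    have "integral {0..y} v = integral {0..y} g"
      by (rule integral_spike[OF neg]) (use N(2) y in force)
    then show ?thesis using w y unfolding weak_deriv_def by metis
  qed
  have "((\<lambda>y. u 0 + integral {0..y} g) has_real_derivative g x) (at x within {0..1})"
    using integral_has_real_derivative[OF g x] by (auto intro!: derivative_eq_intros)
  then show ?thesis
    by (rule has_field_derivative_transform_within[where d = 1]) (use x in \<open>simp_all add: eq[symmetric]\<close>)
qed

text \<open>Bootstrapping: \<open>u\<close> and \<open>p u'\<close> are continuous, being primitives. The equation then shows that
  both weak derivatives have continuous representatives.\<close>

lemma SL_eigenfunction_classical:
  assumes "SL_eigenvalue p q \<mu>"
    and pc: "continuous_on {0..1} p" and pp: "\<And>x. x \<in> {0..1} \<Longrightarrow> 0 < p x"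
    and qc: "continuous_on {0..1} q"
  obtains u P where "SL_solution p q \<mu> u P" "u 0 = 0" "u 1 = 0" "\<exists>x\<in>{0..1}. u x \<noteq> 0"
proof -
  obtain u where u: "u \<in> SL_domain" "\<exists>x\<in>{0..1}. u x \<noteq> 0" "SL_maps p q u (\<lambda>x. \<mu> * u x)"
    using assms(1) by (auto simp: SL_eigenvalue_def)
  obtain h' w where h: "weak_deriv u h'" "weak_deriv (\<lambda>x. p x * h' x) w"
    "AE x in lebesgue_on {0..1}. \<mu> * u x = - w x - q x * u x"
    using u(3) by (auto simp: SL_maps_def)
  define P where "P = (\<lambda>x. p x * h' x)"
  have uc: "continuous_on {0..1} u" by (rule weak_deriv_continuous[OF h(1)])
  have Pc: "continuous_on {0..1} P" unfolding P_def by (rule weak_deriv_continuous[OF h(2)])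
  have 1: "(P has_real_derivative - (q x + \<mu>) * u x) (at x within {0..1})" if "x \<in> {0..1}" for x
    unfolding P_def
  proof (rule weak_deriv_imp_deriv[OF h(2) _ _ that])
    show "continuous_on {0..1} (\<lambda>x. - (q x + \<mu>) * u x)" by (intro continuous_intros qc uc)
    show "AE x in lebesgue_on {0..1}. w x = - (q x + \<mu>) * u x"
      using h(3) by eventually_elim (simp add: algebra_simps)
  qed
  have 2: "(u has_real_derivative P x / p x) (at x within {0..1})" if "x \<in> {0..1}" for x
  proof (rule weak_deriv_imp_deriv[OF h(1) _ _ that])
    show "continuous_on {0..1} (\<lambda>x. P x / p x)"
      by (intro continuous_intros Pc pc) (use pp in force)
    show "AE x in lebesgue_on {0..1}. h' x = P x / p x"
    proof (rule AE_I2)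
      fix x :: real assume "x \<in> space (lebesgue_on {0..1})"
      then show "h' x = P x / p x" using pp[of x] by (simp add: P_def)
    qed
  qed
  show thesis
    by (rule that[of u P]) (use 1 2 u in \<open>auto simp: SL_solution_def SL_domain_def\<close>)
qed

lemma gronwall_upper:
  fixes E E' :: "real \<Rightarrow> real"
  assumes d: "\<And>x. x \<in> {0..1} \<Longrightarrow> (E has_real_derivative E' x) (at x within {0..1})"
    and b: "\<And>x. x \<in> {0..1} \<Longrightarrow> E' x \<le> K * E x + c"
    and K: "0 \<le> K" and c: "0 \<le> c" and E0: "0 \<le> E 0" and x: "x \<in> {0..1}"
  shows "E x \<le> (E 0 + c) * exp K"
proof -
  \<comment> \<open>The integrating factor makes \<open>F\<close> nonincreasing, as \<open>exp (- K y) \<le> 1\<close> on the unit interval.\<close>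
  define F where "F = (\<lambda>y. E y * exp (- (K * y)) - c * y)"
  have dF: "(F has_real_derivative (E' y - K * E y) * exp (- (K * y)) - c) (at y within {0..1})"
    if "y \<in> {0..1}" for y
    unfolding F_def by (rule derivative_eq_intros d[OF that] refl | simp add: algebra_simps)+
  have "\<exists>y\<in>{0..x}. F x - F 0 = ((E' y - K * E y) * exp (- (K * y)) - c) * (x - 0)"
  proof (rule mvt_very_simple[of 0 x F "\<lambda>y. (*) ((E' y - K * E y) * exp (- (K * y)) - c)"])
    show "0 \<le> x" using x by simp
    fix y assume y: "0 \<le> y" "y \<le> x"
    have "(F has_real_derivative (E' y - K * E y) * exp (- (K * y)) - c) (at y within {0..x})"
      by (rule DERIV_subset[OF dF]) (use y x in auto)
    then show "(F has_derivative (*) ((E' y - K * E y) * exp (- (K * y)) - c)) (at y within {0..x})"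
      by (simp add: has_field_derivative_def)
  qed
  then obtain y where y: "y \<in> {0..x}"
    "F x - F 0 = ((E' y - K * E y) * exp (- (K * y)) - c) * x" by auto
  have "(E' y - K * E y) * exp (- (K * y)) \<le> c * 1"
  proof (rule order_trans[OF mult_right_mono mult_left_mono])
    show "E' y - K * E y \<le> c" using b[of y] y x by auto
    show "exp (- (K * y)) \<le> 1" using K y by simp
  qed (use c in auto)
  then have "F x - F 0 \<le> 0" using y x by (auto simp: mult_nonpos_nonneg)
  then have 1: "E x * exp (- (K * x)) \<le> E 0 + c * x" by (simp add: F_def)
  have "E x = E x * exp (- (K * x)) * exp (K * x)" by (simp add: exp_minus)
  also have "\<dots> \<le> (E 0 + c * x) * exp (K * x)" by (rule mult_right_mono[OF 1]) simp
  also have "\<dots> \<le> (E 0 + c) * exp K"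
    by (rule mult_mono) (use x K c E0 in \<open>auto simp: mult_left_le mult_left_le_one_le\<close>)
  finally show ?thesis .
qed

lemma gronwall_lower:
  fixes E E' :: "real \<Rightarrow> real"
  assumes d: "\<And>x. x \<in> {0..1} \<Longrightarrow> (E has_real_derivative E' x) (at x within {0..1})"
    and b: "\<And>x. x \<in> {0..1} \<Longrightarrow> - (K * E x) \<le> E' x"
    and K: "0 \<le> K" and E0: "0 \<le> E 0" and x: "x \<in> {0..1}"
  shows "E 0 * exp (- K) \<le> E x"
proof -
  define F where "F = (\<lambda>y. E y * exp (K * y))"
  have dF: "(F has_real_derivative (E' y + K * E y) * exp (K * y)) (at y within {0..1})"
    if "y \<in> {0..1}" for y
    unfolding F_def by (rule derivative_eq_intros d[OF that] refl | simp add: algebra_simps)+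
  have "\<exists>y\<in>{0..x}. F x - F 0 = ((E' y + K * E y) * exp (K * y)) * (x - 0)"
  proof (rule mvt_very_simple[of 0 x F "\<lambda>y. (*) ((E' y + K * E y) * exp (K * y))"])
    show "0 \<le> x" using x by simp
    fix y assume y: "0 \<le> y" "y \<le> x"
    have "(F has_real_derivative (E' y + K * E y) * exp (K * y)) (at y within {0..x})"
      by (rule DERIV_subset[OF dF]) (use y x in auto)
    then show "(F has_derivative (*) ((E' y + K * E y) * exp (K * y))) (at y within {0..x})"
      by (simp add: has_field_derivative_def)
  qed
  then obtain y where y: "y \<in> {0..x}" "F x - F 0 = ((E' y + K * E y) * exp (K * y)) * x" by auto
  have "0 \<le> E' y + K * E y" using b[of y] y x by auto
  then have "0 \<le> F x - F 0" using y x by auto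
  then have 1: "E 0 \<le> E x * exp (K * x)" by (simp add: F_def)
  have "E 0 * exp (- K) \<le> E 0 * exp (- (K * x))"
    using K x E0 by (intro mult_left_mono) (auto simp: mult_left_le)
  also have "\<dots> \<le> E x * exp (K * x) * exp (- (K * x))" by (rule mult_right_mono[OF 1]) simp
  also have "\<dots> = E x" by (simp flip: exp_add)
  finally show ?thesis .
qed

section \<open>Separation of the eigenvalues\<close>

text \<open>A single constant \<open>K\<close> controls \<open>p\<close> from both sides as well as \<open>p'\<close> and \<open>q\<close>, so that all constants
  below depend on \<open>K\<close> only and are uniform in the spectral parameter.\<close>

locale SL_bounded =
  fixes p p' q :: "real \<Rightarrow> real" and K :: real
  assumes dp: "\<And>x. x \<in> {0..1} \<Longrightarrow> (p has_real_derivative p' x) (at x within {0..1})"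
    and K1: "1 \<le> K"
    and pl: "\<And>x. x \<in> {0..1} \<Longrightarrow> 1 / K \<le> p x"
    and pu: "\<And>x. x \<in> {0..1} \<Longrightarrow> p x \<le> K"
    and p'b: "\<And>x. x \<in> {0..1} \<Longrightarrow> \<bar>p' x\<bar> \<le> K"
    and qb: "\<And>x. x \<in> {0..1} \<Longrightarrow> \<bar>q x\<bar> \<le> K"
    and qc: "continuous_on {0..1} q"
begin

lemma p_pos: "x \<in> {0..1} \<Longrightarrow> 0 < p x"
  using pl[of x] K1 by (smt (verit) divide_pos_pos)

lemma p_cont: "continuous_on {0..1} p"
  using dp by (meson DERIV_continuous continuous_on_eq_continuous_within)

lemma sq_le_p: "x \<in> {0..1} \<Longrightarrow> a\<^sup>2 \<le> K * (p x * a\<^sup>2)"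
proof -
  assume x: "x \<in> {0..1}"
  have "1 \<le> K * p x" using pl[OF x] K1 by (simp add: field_simps)
  then have "1 * a\<^sup>2 \<le> (K * p x) * a\<^sup>2" by (rule mult_right_mono) simp
  then show ?thesis by (simp add: mult.assoc)
qed

lemma solution_cont:
  assumes "SL_solution p q \<mu> u P"
  shows "continuous_on {0..1} u" "continuous_on {0..1} P"
  using assms unfolding SL_solution_def
  by (meson DERIV_continuous continuous_on_eq_continuous_within)+

text \<open>The terms of order \<open>\<mu>\<close> cancel in the derivative of the energy \<open>P\<^sup>2 + \<mu> p u\<^sup>2\<close>. This is why the
  relative growth rate of the energy is bounded uniformly in \<open>\<mu>\<close>.\<close>

lemma energy_deriv:
  assumes s: "SL_solution p q \<mu> u P" and \<mu>: "0 \<le> \<mu>" and x: "x \<in> {0..1}"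
  shows "((\<lambda>x. (P x)\<^sup>2 + \<mu> * p x * (u x)\<^sup>2) has_real_derivative
     - 2 * q x * u x * P x + \<mu> * p' x * (u x)\<^sup>2) (at x within {0..1})"
proof -
  have d: "(u has_real_derivative P x / p x) (at x within {0..1})"
    "(P has_real_derivative - (q x + \<mu>) * u x) (at x within {0..1})"
    using s x by (auto simp: SL_solution_def)
  show ?thesis
    by (rule derivative_eq_intros d dp[OF x] refl)+
      (use p_pos[OF x] in \<open>simp add: field_simps power2_eq_square\<close>)
qed

lemma energy_deriv_bound:
  assumes \<mu>: "1 \<le> \<mu>" and x: "x \<in> {0..1}"
  shows "\<bar>- 2 * q x * u * P + \<mu> * p' x * u\<^sup>2\<bar> \<le> 2 * K\<^sup>2 * (P\<^sup>2 + \<mu> * p x * u\<^sup>2)"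
proof -
  have m: "u\<^sup>2 \<le> \<mu> * u\<^sup>2" using mult_right_mono[OF \<mu>, of "u\<^sup>2"] by simp
  have uu: "\<mu> * u\<^sup>2 \<le> K * (\<mu> * p x * u\<^sup>2)"
    using mult_left_mono[OF sq_le_p[OF x, of u], of \<mu>] \<mu> by (simp add: mult_ac)
  have KK: "K \<le> K\<^sup>2" using K1 by (simp add: power2_eq_square)
  have "\<bar>2 * u * P\<bar> \<le> u\<^sup>2 + P\<^sup>2"
    using sum_squares_bound[of u P] sum_squares_bound[of u "-P"] by (simp add: abs_le_iff)
  also have "\<dots> \<le> K * (\<mu> * p x * u\<^sup>2) + K * P\<^sup>2"
    using m uu mult_right_mono[OF K1, of "P\<^sup>2"] by simp
  finally have 1: "\<bar>2 * u * P\<bar> \<le> K * (P\<^sup>2 + \<mu> * p x * u\<^sup>2)" by (simp add: algebra_simps)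
  have "\<bar>q x * (2 * u * P)\<bar> \<le> K * (K * (P\<^sup>2 + \<mu> * p x * u\<^sup>2))"
    unfolding abs_mult[of "q x"] by (rule mult_mono) (use qb[OF x] 1 K1 in auto)
  moreover have "\<bar>p' x * (\<mu> * u\<^sup>2)\<bar> \<le> K * (K * (\<mu> * p x * u\<^sup>2))"
    unfolding abs_mult[of "p' x"] by (rule mult_mono) (use p'b[OF x] uu K1 \<mu> in auto)
  moreover have "0 \<le> K * (K * P\<^sup>2)" using K1 by simp
  ultimately show ?thesis by (simp add: algebra_simps power2_eq_square abs_le_iff)
qed

lemma energy_bounds:
  assumes s: "SL_solution p q \<mu> u P" and \<mu>: "1 \<le> \<mu>" and u0: "u 0 = 0" and x: "x \<in> {0..1}"
  shows "(P x)\<^sup>2 + \<mu> * p x * (u x)\<^sup>2 \<le> (P 0)\<^sup>2 * exp (2 * K\<^sup>2)"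
    and "(P 0)\<^sup>2 * exp (- (2 * K\<^sup>2)) \<le> (P x)\<^sup>2 + \<mu> * p x * (u x)\<^sup>2"
proof -
  define E where "E = (\<lambda>x. (P x)\<^sup>2 + \<mu> * p x * (u x)\<^sup>2)"
  define E' where "E' = (\<lambda>x. - 2 * q x * u x * P x + \<mu> * p' x * (u x)\<^sup>2)"
  have E0: "E 0 = (P 0)\<^sup>2" using u0 by (simp add: E_def)
  have d: "(E has_real_derivative E' x) (at x within {0..1})" if "x \<in> {0..1}" for x
    unfolding E_def E'_def using energy_deriv[OF s _ that] \<mu> by simp
  have b: "\<bar>E' x\<bar> \<le> 2 * K\<^sup>2 * E x" if "x \<in> {0..1}" for x
    unfolding E_def E'_def by (rule energy_deriv_bound[OF \<mu> that])
  have "E x \<le> (E 0 + 0) * exp (2 * K\<^sup>2)"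
    by (rule gronwall_upper[OF d]) (use b E0 x in \<open>auto simp: abs_le_iff\<close>)
  then show "(P x)\<^sup>2 + \<mu> * p x * (u x)\<^sup>2 \<le> (P 0)\<^sup>2 * exp (2 * K\<^sup>2)"
    unfolding E0 by (simp add: E_def)
  have "E 0 * exp (- (2 * K\<^sup>2)) \<le> E x"
    by (rule gronwall_lower[OF d]) (use b E0 x in \<open>force simp: abs_le_iff\<close>)+
  then show "(P 0)\<^sup>2 * exp (- (2 * K\<^sup>2)) \<le> (P x)\<^sup>2 + \<mu> * p x * (u x)\<^sup>2"
    unfolding E0 by (simp add: E_def)
qed

text \<open>With \<open>u 0 = 0\<close>, the energy at the left end point is \<open>(P 0)\<^sup>2\<close>. If it vanished, it would vanish
  everywhere, so an eigenfunction can be scaled to have slope \<open>P 0 = 1\<close>.\<close>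

lemma normalised_eigenfunction:
  assumes "SL_eigenvalue p q \<mu>" and \<mu>: "1 \<le> \<mu>"
  obtains u P where "SL_solution p q \<mu> u P" "u 0 = 0" "u 1 = 0" "P 0 = 1"
proof -
  obtain v R where v: "SL_solution p q \<mu> v R" "v 0 = 0" "v 1 = 0" "\<exists>x\<in>{0..1}. v x \<noteq> 0"
    using SL_eigenfunction_classical[OF assms(1) p_cont p_pos qc] by blast
  have R0: "R 0 \<noteq> 0"
  proof
    assume R0: "R 0 = 0"
    obtain x where x: "x \<in> {0..1}" "v x \<noteq> 0" using v(4) by blast
    have "(R x)\<^sup>2 + \<mu> * p x * (v x)\<^sup>2 \<le> 0"
      using energy_bounds(1)[OF v(1) \<mu> v(2) x(1)] R0 by simp
    moreover have "0 < \<mu> * p x * (v x)\<^sup>2" using \<mu> p_pos[OF x(1)] x(2) by simp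
    ultimately show False by (smt (verit) zero_le_power2)
  qed
  have "SL_solution p q \<mu> (\<lambda>x. v x / R 0) (\<lambda>x. R x / R 0)"
    unfolding SL_solution_def
  proof (intro ballI conjI)
    fix x :: real assume x: "x \<in> {0..1}"
    have d: "(v has_real_derivative R x / p x) (at x within {0..1})"
      "(R has_real_derivative - (q x + \<mu>) * v x) (at x within {0..1})"
      using v(1) x by (auto simp: SL_solution_def)
    show "((\<lambda>x. v x / R 0) has_real_derivative R x / R 0 / p x) (at x within {0..1})"
      using DERIV_cdivide[OF d(1), of "R 0"] by (simp add: mult_ac)
    show "((\<lambda>x. R x / R 0) has_real_derivative - (q x + \<mu>) * (v x / R 0)) (at x within {0..1})"
      using DERIV_cdivide[OF d(2), of "R 0"] by simp
  qed
  then show thesis by (rule that) (use v R0 in auto)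
qed

lemma has_integral_of_deriv:
  fixes f :: "real \<Rightarrow> real"
  assumes "\<And>x. x \<in> {0..1} \<Longrightarrow> (f has_real_derivative g x) (at x within {0..1})"
  shows "(g has_integral (f 1 - f 0)) {0..1}"
  by (rule fundamental_theorem_of_calculus)
    (use assms in \<open>auto simp: has_real_derivative_iff_has_vector_derivative\<close>)

text \<open>The Wronskian \<open>P v - R u\<close> vanishes at both end points and has derivative \<open>(\<nu> - \<mu>) u v\<close>.\<close>

lemma eigenfunctions_orthogonal:
  assumes u: "SL_solution p q \<mu> u P" "u 0 = 0" "u 1 = 0"
    and v: "SL_solution p q \<nu> v R" "v 0 = 0" "v 1 = 0" and ne: "\<mu> \<noteq> \<nu>"
  shows "((\<lambda>x. u x * v x) has_integral 0) {0..1}"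
proof -
  have "((\<lambda>x. P x * v x - R x * u x) has_real_derivative (\<nu> - \<mu>) * (u x * v x)) (at x within {0..1})"
    if x: "x \<in> {0..1}" for x
  proof -
    have d: "(u has_real_derivative P x / p x) (at x within {0..1})"
      "(P has_real_derivative - (q x + \<mu>) * u x) (at x within {0..1})"
      "(v has_real_derivative R x / p x) (at x within {0..1})"
      "(R has_real_derivative - (q x + \<nu>) * v x) (at x within {0..1})"
      using u v x by (auto simp: SL_solution_def)
    show ?thesis
      by (rule derivative_eq_intros d refl)+
        (use p_pos[OF x] in \<open>simp add: field_simps\<close>)
  qed
  from has_integral_of_deriv[OF this]
  have "((\<lambda>x. (\<nu> - \<mu>) * (u x * v x)) has_integral 0) {0..1}" using u v by simp
  from has_integral_mult_right[OF this, of "1 / (\<nu> - \<mu>)"] show ?thesis using ne by simp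
qed

text \<open>Multiplication of the equation by \<open>u\<close> and partial integration.\<close>

lemma energy_identity:
  assumes u: "SL_solution p q \<mu> u P" "u 0 = 0" "u 1 = 0"
  shows "((\<lambda>x. (P x)\<^sup>2 / p x - (q x + \<mu>) * (u x)\<^sup>2) has_integral 0) {0..1}"
proof -
  have "((\<lambda>x. P x * u x) has_real_derivative (P x)\<^sup>2 / p x - (q x + \<mu>) * (u x)\<^sup>2) (at x within {0..1})"
    if x: "x \<in> {0..1}" for x
  proof -
    have d: "(u has_real_derivative P x / p x) (at x within {0..1})"
      "(P has_real_derivative - (q x + \<mu>) * u x) (at x within {0..1})"
      using u x by (auto simp: SL_solution_def)
    show ?thesis
      by (rule derivative_eq_intros d refl)+
        (use p_pos[OF x] in \<open>simp add: field_simps power2_eq_square\<close>)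
  qed
  from has_integral_of_deriv[OF this] show ?thesis using u by simp
qed

text \<open>Equipartition: up to the lower-order term \<open>q\<close>, the integrals of \<open>P\<^sup>2/p\<close> and of \<open>\<mu> u\<^sup>2\<close> agree. Their
  sum is the integral of energy over \<open>p\<close>, which is bounded below because the energy starts from 1.\<close>

lemma L2_lower_bound:
  assumes u: "SL_solution p q \<mu> u P" "u 0 = 0" "u 1 = 0" "P 0 = 1" and \<mu>: "K \<le> \<mu>"
  shows "exp (- (2 * K\<^sup>2)) / K \<le> 3 * integral {0..1} (\<lambda>x. \<mu> * (u x)\<^sup>2)"
proof -
  have \<mu>1: "1 \<le> \<mu>" using \<mu> K1 by simp
  note c = solution_cont[OF u(1)]
  have pn: "\<forall>x\<in>{0..1}. p x \<noteq> 0" using p_pos by force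
  have "exp (- (2 * K\<^sup>2)) / K = integral {0..1} (\<lambda>x::real. exp (- (2 * K\<^sup>2)) / K)" by simp
  also have "\<dots> \<le> integral {0..1} (\<lambda>x. ((P x)\<^sup>2 / p x - (q x + \<mu>) * (u x)\<^sup>2) + 3 * (\<mu> * (u x)\<^sup>2))"
  proof (rule integral_le)
    show "(\<lambda>x. ((P x)\<^sup>2 / p x - (q x + \<mu>) * (u x)\<^sup>2) + 3 * (\<mu> * (u x)\<^sup>2)) integrable_on {0..1}"
      by (intro integrable_continuous_real continuous_intros c p_cont qc pn)
    fix x :: real assume x: "x \<in> {0..1}"
    have "exp (- (2 * K\<^sup>2)) / K \<le> exp (- (2 * K\<^sup>2)) / p x"
      using pu[OF x] p_pos[OF x] by (intro divide_left_mono) (use K1 in auto)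
    also have "\<dots> \<le> ((P x)\<^sup>2 + \<mu> * p x * (u x)\<^sup>2) / p x"
      using energy_bounds(2)[OF u(1) \<mu>1 u(2) x] u(4) p_pos[OF x] by (intro divide_right_mono) auto
    also have "\<dots> = (P x)\<^sup>2 / p x + \<mu> * (u x)\<^sup>2" using p_pos[OF x] by (simp add: field_simps)
    also have "\<dots> \<le> ((P x)\<^sup>2 / p x - (q x + \<mu>) * (u x)\<^sup>2) + 3 * (\<mu> * (u x)\<^sup>2)"
    proof -
      have "(q x + \<mu>) * (u x)\<^sup>2 \<le> (2 * \<mu>) * (u x)\<^sup>2"
        by (rule mult_right_mono) (use qb[OF x] \<mu> in auto)
      then show ?thesis by simp
    qed
    finally show "exp (- (2 * K\<^sup>2)) / K \<le> ((P x)\<^sup>2 / p x - (q x + \<mu>) * (u x)\<^sup>2) + 3 * (\<mu> * (u x)\<^sup>2)" .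
  qed (rule integrable_const_ivl)
  also have "\<dots> = 0 + integral {0..1} (\<lambda>x. 3 * (\<mu> * (u x)\<^sup>2))"
  proof -
    have "(\<lambda>x. 3 * (\<mu> * (u x)\<^sup>2)) integrable_on {0..1}"
      by (intro integrable_continuous_real continuous_intros c)
    from has_integral_add[OF energy_identity[OF u(1-3)] integrable_integral[OF this]]
    show ?thesis by (simp add: integral_unique)
  qed
  finally show ?thesis by simp
qed

text \<open>Two solutions that start at 0 with slope 1 stay close if \<open>k - m\<close> is small and \<open>m\<close> is large. The
  estimate is Gronwall's inequality for the squared distance \<open>f = b\<^sup>2 + p a\<^sup>2\<close> of the pairs \<open>(m u, P)\<close>
  and \<open>(k v, R)\<close>. With this weight the coupling terms \<open>\<plusminus> 2 k a b\<close>, which are unbounded in \<open>k\<close>, cancel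
  in \<open>f'\<close>; what remains is of size \<open>f\<close>, \<open>(k - m)\<^sup>2\<close> or \<open>1/m\<^sup>2\<close>.\<close>

lemma phase_comparison:
  assumes u: "SL_solution p q (m\<^sup>2) u P" "u 0 = 0" "P 0 = 1"
    and v: "SL_solution p q (k\<^sup>2) v R" "v 0 = 0" "R 0 = 1"
    and m: "1 \<le> m" "m \<le> k" and x: "x \<in> {0..1}"
  shows "(k * v x - m * u x)\<^sup>2 \<le> 2 * K ^ 4 * exp (2 * K\<^sup>2) * exp (2 * K\<^sup>2 + 3) * ((k - m)\<^sup>2 + 1 / m\<^sup>2)"
proof -
  define U where "U = (\<lambda>x. m * u x)"
  define V where "V = (\<lambda>x. k * v x)"
  define a where "a = (\<lambda>x. V x - U x)"
  define b where "b = (\<lambda>x. R x - P x)"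
  define f where "f = (\<lambda>x. (b x)\<^sup>2 + p x * (a x)\<^sup>2)"
  define f' where "f' = (\<lambda>x. (k - m) * (2 * a x * P x - 2 * b x * U x)
     + 2 * b x * q x * (U x / m - V x / k) + p' x * (a x)\<^sup>2)"
  define Z where "Z = exp (2 * K\<^sup>2)"
  define c where "c = 2 * K ^ 3 * Z * ((k - m)\<^sup>2 + 1 / m\<^sup>2)"
  have k: "1 \<le> k" using m by simp
  have d: "(f has_real_derivative f' x) (at x within {0..1})" if x: "x \<in> {0..1}" for x
  proof -
    have d: "(u has_real_derivative P x / p x) (at x within {0..1})"
      "(P has_real_derivative - (q x + m\<^sup>2) * u x) (at x within {0..1})"
      "(v has_real_derivative R x / p x) (at x within {0..1})"
      "(R has_real_derivative - (q x + k\<^sup>2) * v x) (at x within {0..1})"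
      using u v x by (auto simp: SL_solution_def)
    show ?thesis unfolding f_def f'_def a_def b_def U_def V_def
      by (rule derivative_eq_intros d dp[OF x] refl)+
        (use p_pos[OF x] m k in \<open>simp add: field_simps power2_eq_square\<close>)
  qed
  have bd: "f' x \<le> (2 * K\<^sup>2 + 3) * f x + c" if x: "x \<in> {0..1}" for x
  proof -
    have *: "(P x)\<^sup>2 + p x * (U x)\<^sup>2 \<le> Z" "(R x)\<^sup>2 + p x * (V x)\<^sup>2 \<le> Z"
      using energy_bounds(1)[OF u(1) _ u(2) x] energy_bounds(1)[OF v(1) _ v(2) x] m k u v
      by (auto simp: U_def V_def Z_def power_mult_distrib mult_ac one_le_power)
    have Uq: "(U x)\<^sup>2 \<le> K * Z" "(V x)\<^sup>2 \<le> K * Z" "(P x)\<^sup>2 + (U x)\<^sup>2 \<le> K * Z"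
    proof -
      have i: "(P x)\<^sup>2 \<le> K * (P x)\<^sup>2" "0 \<le> (P x)\<^sup>2" "0 \<le> K * (R x)\<^sup>2"
        using mult_right_mono[OF K1, of "(P x)\<^sup>2"] K1 by auto
      have ii: "K * (P x)\<^sup>2 + K * (p x * (U x)\<^sup>2) \<le> K * Z" "K * (R x)\<^sup>2 + K * (p x * (V x)\<^sup>2) \<le> K * Z"
        using mult_left_mono[OF *(1), of K] mult_left_mono[OF *(2), of K] K1
        by (auto simp: distrib_left)
      note iii = sq_le_p[OF x, of "U x"] sq_le_p[OF x, of "V x"]
      show "(U x)\<^sup>2 \<le> K * Z" "(V x)\<^sup>2 \<le> K * Z" "(P x)\<^sup>2 + (U x)\<^sup>2 \<le> K * Z"
        using i ii iii by linarith+
    qed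
    have t1: "2 * a x * ((k - m) * P x) \<le> (a x)\<^sup>2 + (k - m)\<^sup>2 * (P x)\<^sup>2"
      using sum_squares_bound[of "a x" "(k - m) * P x"] by (simp add: power_mult_distrib)
    have t2: "- (2 * b x * ((k - m) * U x)) \<le> (b x)\<^sup>2 + (k - m)\<^sup>2 * (U x)\<^sup>2"
      using sum_squares_bound[of "b x" "- ((k - m) * U x)"] by (simp add: power_mult_distrib)
    have q2: "(q x)\<^sup>2 \<le> K\<^sup>2" using qb[OF x] K1 by (simp add: abs_le_square_iff[symmetric])
    have t3: "2 * b x * (q x * U x / m) \<le> (b x)\<^sup>2 + K\<^sup>2 * (K * Z) / m\<^sup>2"
    proof -
      have "2 * b x * (q x * U x / m) \<le> (b x)\<^sup>2 + (q x * U x / m)\<^sup>2"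
        using sum_squares_bound[of "b x" "q x * U x / m"] by simp
      also have "(q x * U x / m)\<^sup>2 = (q x)\<^sup>2 * (U x)\<^sup>2 / m\<^sup>2" by (simp add: power_mult_distrib power_divide)
      also have "\<dots> \<le> K\<^sup>2 * (K * Z) / m\<^sup>2"
        by (intro divide_right_mono mult_mono q2 Uq) auto
      finally show ?thesis by simp
    qed
    have t4: "- (2 * b x * (q x * V x / k)) \<le> (b x)\<^sup>2 + K\<^sup>2 * (K * Z) / m\<^sup>2"
    proof -
      have "- (2 * b x * (q x * V x / k)) \<le> (b x)\<^sup>2 + (q x * V x / k)\<^sup>2"
        using sum_squares_bound[of "b x" "- (q x * V x / k)"] by simp
      also have "(q x * V x / k)\<^sup>2 = (q x)\<^sup>2 * (V x)\<^sup>2 / k\<^sup>2" by (simp add: power_mult_distrib power_divide)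
      also have "\<dots> \<le> K\<^sup>2 * (K * Z) / m\<^sup>2"
        by (intro frac_le mult_mono q2 Uq) (use m K1 in \<open>auto simp: Z_def\<close>)
      finally show ?thesis by simp
    qed
    have t5: "p' x * (a x)\<^sup>2 \<le> K * (a x)\<^sup>2"
      using p'b[OF x] by (intro mult_right_mono) auto
    have t6: "(K + 1) * (a x)\<^sup>2 \<le> (2 * K\<^sup>2) * (p x * (a x)\<^sup>2)"
    proof -
      have "(K + 1) * (a x)\<^sup>2 \<le> (2 * K) * (K * (p x * (a x)\<^sup>2))"
        using K1 sq_le_p[OF x, of "a x"] by (intro mult_mono) auto
      then show ?thesis by (simp add: power2_eq_square mult_ac)
    qed
    have t7: "(k - m)\<^sup>2 * (P x)\<^sup>2 + (k - m)\<^sup>2 * (U x)\<^sup>2 \<le> (k - m)\<^sup>2 * (2 * K ^ 3 * Z)"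
    proof -
      have "K * Z \<le> 2 * K ^ 3 * Z"
      proof (rule mult_right_mono)
        have "K * 1 \<le> K * (K * K)" using K1 by (intro mult_left_mono) (auto simp: mult_ge1_I)
        moreover have "0 \<le> K ^ 3" using K1 by simp
        ultimately show "K \<le> 2 * K ^ 3" by (simp add: power3_eq_cube mult.assoc)
      qed (simp add: Z_def)
      then have "(k - m)\<^sup>2 * ((P x)\<^sup>2 + (U x)\<^sup>2) \<le> (k - m)\<^sup>2 * (2 * K ^ 3 * Z)"
        using Uq(3) by (intro mult_left_mono) auto
      then show ?thesis by (simp add: distrib_left)
    qed
    have pa: "0 \<le> p x * (a x)\<^sup>2" using p_pos[OF x] by simp
    have t8: "c = (k - m)\<^sup>2 * (2 * K ^ 3 * Z) + 2 * (K\<^sup>2 * (K * Z) / m\<^sup>2)"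
      by (simp add: c_def field_simps power2_eq_square power3_eq_cube)
    \<comment> \<open>The five parts of the derivative are named, so that the remaining inequality is linear in them.\<close>
    define T1 where "T1 = 2 * a x * ((k - m) * P x)"
    define T2 where "T2 = - (2 * b x * ((k - m) * U x))"
    define T3 where "T3 = 2 * b x * (q x * U x / m)"
    define T4 where "T4 = - (2 * b x * (q x * V x / k))"
    have "f' x = T1 + T2 + T3 + T4 + p' x * (a x)\<^sup>2"
      unfolding f'_def T1_def T2_def T3_def T4_def by (simp add: algebra_simps)
    moreover have "(K + 1) * (a x)\<^sup>2 = K * (a x)\<^sup>2 + (a x)\<^sup>2" by (simp add: distrib_right)
    moreover have "(2 * K\<^sup>2 + 3) * f x
        = 2 * K\<^sup>2 * (b x)\<^sup>2 + 2 * K\<^sup>2 * (p x * (a x)\<^sup>2) + 3 * (b x)\<^sup>2 + 3 * (p x * (a x)\<^sup>2)"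
      by (simp add: f_def algebra_simps)
    moreover have "0 \<le> 2 * K\<^sup>2 * (b x)\<^sup>2" by simp
    moreover define D1 D2 D3 D4 where "D1 = (k - m)\<^sup>2 * (P x)\<^sup>2" and "D2 = (k - m)\<^sup>2 * (U x)\<^sup>2"
      and "D3 = K\<^sup>2 * (K * Z) / m\<^sup>2" and "D4 = (k - m)\<^sup>2 * (2 * K ^ 3 * Z)"
    moreover define G1 G2 G3 where "G1 = 2 * K\<^sup>2 * (p x * (a x)\<^sup>2)" and "G2 = K * (a x)\<^sup>2"
      and "G3 = p x * (a x)\<^sup>2"
    ultimately show ?thesis
      using t1 t2 t3 t4 t5 t6 t7 pa
      unfolding t8 T1_def[symmetric] T2_def[symmetric] T3_def[symmetric] T4_def[symmetric]
        D1_def[symmetric] D2_def[symmetric] D3_def[symmetric] D4_def[symmetric]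
        G1_def[symmetric] G2_def[symmetric] G3_def[symmetric]
      by linarith
  qed
  have f0: "f 0 = 0" using u v by (simp add: f_def a_def b_def U_def V_def)
  have "f x \<le> (f 0 + c) * exp (2 * K\<^sup>2 + 3)"
    by (rule gronwall_upper[OF d bd _ _ _ x]) (use f0 K1 in \<open>simp_all add: c_def Z_def\<close>)
  then have fx: "f x \<le> c * exp (2 * K\<^sup>2 + 3)" using f0 by simp
  have "(a x)\<^sup>2 \<le> K * (p x * (a x)\<^sup>2)" by (rule sq_le_p[OF x])
  also have "\<dots> \<le> K * f x" using K1 by (intro mult_left_mono) (auto simp: f_def)
  also have "\<dots> \<le> K * (c * exp (2 * K\<^sup>2 + 3))" using fx K1 by (intro mult_left_mono) auto
  also have "\<dots> = 2 * K ^ 4 * Z * exp (2 * K\<^sup>2 + 3) * ((k - m)\<^sup>2 + 1 / m\<^sup>2)"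
    using power_Suc[of K 3] by (simp add: c_def)
  finally show ?thesis by (simp add: a_def U_def V_def Z_def)
qed

text \<open>Orthogonality gives \<open>\<integral> (k v - m u)\<^sup>2 = \<integral> (k v)\<^sup>2 + \<integral> (m u)\<^sup>2\<close>, which is bounded below, while the
  integrand on the left is small if \<open>\<surd>\<nu> - \<surd>\<mu>\<close> and \<open>1/\<mu>\<close> are.\<close>

lemma eigenvalue_separation:
  "\<exists>c>0. \<forall>\<mu> \<nu>. SL_eigenvalue p q \<mu> \<and> SL_eigenvalue p q \<nu> \<and> K \<le> \<mu> \<and> \<mu> < \<nu> \<longrightarrow>
     c \<le> (sqrt \<nu> - sqrt \<mu>)\<^sup>2 + 1 / \<mu>"
proof -
  define A where "A = 2 * K ^ 4 * exp (2 * K\<^sup>2) * exp (2 * K\<^sup>2 + 3)"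
  define c where "c = exp (- (2 * K\<^sup>2)) / K"
  have A: "0 < A" "0 < c" using K1 by (auto simp: A_def c_def)
  have "c \<le> 3 * (A * ((sqrt \<nu> - sqrt \<mu>)\<^sup>2 + 1 / \<mu>))"
    if e: "SL_eigenvalue p q \<mu>" "SL_eigenvalue p q \<nu>" and \<mu>: "K \<le> \<mu>" "\<mu> < \<nu>" for \<mu> \<nu>
  proof -
    have \<mu>1: "1 \<le> \<mu>" "1 \<le> \<nu>" using \<mu> K1 by auto
    define m k where "m = sqrt \<mu>" and "k = sqrt \<nu>"
    have mk: "\<mu> = m\<^sup>2" "\<nu> = k\<^sup>2" "1 \<le> m" "m \<le> k" using \<mu> \<mu>1 by (auto simp: m_def k_def)
    obtain u P where u: "SL_solution p q \<mu> u P" "u 0 = 0" "u 1 = 0" "P 0 = 1"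
      using normalised_eigenfunction[OF e(1) \<mu>1(1)] .
    obtain v R where v: "SL_solution p q \<nu> v R" "v 0 = 0" "v 1 = 0" "R 0 = 1"
      using normalised_eigenfunction[OF e(2) \<mu>1(2)] .
    note cc = solution_cont[OF u(1)] solution_cont[OF v(1)]
    have orth: "((\<lambda>x. u x * v x) has_integral 0) {0..1}"
      by (rule eigenfunctions_orthogonal[OF u(1-3) v(1-3)]) (use \<mu> in simp)
    have "c \<le> 3 * integral {0..1} (\<lambda>x. \<mu> * (u x)\<^sup>2)"
      unfolding c_def by (rule L2_lower_bound[OF u \<mu>(1)])
    also have "integral {0..1} (\<lambda>x. \<mu> * (u x)\<^sup>2)
        \<le> integral {0..1} (\<lambda>x. (k * v x - m * u x)\<^sup>2 + 2 * k * m * (u x * v x))"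
    proof (rule integral_le)
      show "(\<lambda>x. \<mu> * (u x)\<^sup>2) integrable_on {0..1}"
        "(\<lambda>x. (k * v x - m * u x)\<^sup>2 + 2 * k * m * (u x * v x)) integrable_on {0..1}"
        by (intro integrable_continuous_real continuous_intros cc)+
      fix x :: real
      have "0 \<le> (k * v x)\<^sup>2" by simp
      then show "\<mu> * (u x)\<^sup>2 \<le> (k * v x - m * u x)\<^sup>2 + 2 * k * m * (u x * v x)"
        by (simp add: mk power2_eq_square algebra_simps)
    qed
    also have "\<dots> = integral {0..1} (\<lambda>x. (k * v x - m * u x)\<^sup>2)"
    proof -
      have "(\<lambda>x. (k * v x - m * u x)\<^sup>2) integrable_on {0..1}"
        by (intro integrable_continuous_real continuous_intros cc)
      from has_integral_add[OF integrable_integral[OF this] has_integral_mult_right[OF orth, of "2 * k * m"]]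
      show ?thesis by (simp add: integral_unique)
    qed
    also have "\<dots> \<le> integral {0..1} (\<lambda>x::real. A * ((k - m)\<^sup>2 + 1 / m\<^sup>2))"
    proof (rule integral_le)
      show "(\<lambda>x. (k * v x - m * u x)\<^sup>2) integrable_on {0..1}"
        by (intro integrable_continuous_real continuous_intros cc)
      fix x :: real assume x: "x \<in> {0..1}"
      show "(k * v x - m * u x)\<^sup>2 \<le> A * ((k - m)\<^sup>2 + 1 / m\<^sup>2)"
        unfolding A_def using phase_comparison[of m u P k v R x] u v mk x by simp
    qed (rule integrable_const_ivl)
    also have "\<dots> = A * ((sqrt \<nu> - sqrt \<mu>)\<^sup>2 + 1 / \<mu>)" using \<mu>1 by (simp add: m_def k_def)
    finally show ?thesis by simp
  qed
  then show ?thesis using A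
    by (intro exI[of _ "c / (3 * A)"]) (auto simp: field_simps)
qed

end

section \<open>Quadratic growth of the eigenvalue gaps\<close>

lemma smooth_near_unit_C1:
  assumes "smooth_near_unit f"
  shows "\<And>x. x \<in> {0..1} \<Longrightarrow> (f has_real_derivative deriv f x) (at x within {0..1})"
    and "continuous_on {0..1} f" and "continuous_on {0..1} (deriv f)"
proof -
  obtain U where U: "{0..1} \<subseteq> U"
    "\<And>k x. x \<in> U \<Longrightarrow> ((deriv ^^ k) f) field_differentiable (at x)"
    using assms unfolding smooth_near_unit_def by blast
  have 1: "f field_differentiable (at x)" and 2: "deriv f field_differentiable (at x)"
    if "x \<in> {0..1}" for x
    using U(2)[of x 0] U(2)[of x 1] U(1) that by auto
  show "(f has_real_derivative deriv f x) (at x within {0..1})" if "x \<in> {0..1}" for x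
    using 1[OF that] by (simp add: field_differentiable_derivI has_field_derivative_at_within)
  show "continuous_on {0..1} f" "continuous_on {0..1} (deriv f)"
    using 1 2 by (auto intro!: continuous_at_imp_continuous_on field_differentiable_imp_continuous_at)
qed

lemma SL_bounded_if_smooth:
  assumes p: "smooth_near_unit p" and q: "smooth_near_unit q" and pos: "\<forall>x\<in>{0..1}. 0 < p x"
  obtains K where "SL_bounded p (deriv p) q K"
proof -
  note sp = smooth_near_unit_C1[OF p] and sq = smooth_near_unit_C1[OF q]
  have bd: "\<exists>B. \<forall>x\<in>{0..1}. \<bar>f x\<bar> \<le> B" if "continuous_on {0..1} f" for f :: "real \<Rightarrow> real"
    using compact_imp_bounded[OF compact_continuous_image[OF that compact_Icc]]
    by (auto simp: bounded_iff)
  obtain A where A: "\<forall>x\<in>{0..1}. \<bar>p x\<bar> \<le> A" using bd[OF sp(2)] by blast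
  obtain B where B: "\<forall>x\<in>{0..1}. \<bar>deriv p x\<bar> \<le> B" using bd[OF sp(3)] by blast
  obtain C where C: "\<forall>x\<in>{0..1}. \<bar>q x\<bar> \<le> C" using bd[OF sq(2)] by blast
  have "continuous_on {0..1} (\<lambda>x. 1 / p x)" by (intro continuous_intros sp) (use pos in force)
  from bd[OF this] obtain D where D: "\<forall>x\<in>{0..1}. \<bar>1 / p x\<bar> \<le> D" by blast
  define K where "K = 1 + \<bar>A\<bar> + \<bar>B\<bar> + \<bar>C\<bar> + \<bar>D\<bar>"
  have "SL_bounded p (deriv p) q K"
  proof
    show "1 \<le> K" by (simp add: K_def)
    fix x :: real assume x: "x \<in> {0..1}"
    show "(p has_real_derivative deriv p x) (at x within {0..1})" by (rule sp(1)[OF x])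
    have px: "0 < p x" using pos x by blast
    have b: "\<bar>p x\<bar> \<le> A" "\<bar>deriv p x\<bar> \<le> B" "\<bar>q x\<bar> \<le> C" "\<bar>1 / p x\<bar> \<le> D"
      using A B C D x by blast+
    have "1 / p x \<le> K" using b(4) unfolding K_def by linarith
    then show "1 / K \<le> p x" using px \<open>1 \<le> K\<close> by (simp add: field_simps)
    show "p x \<le> K" "\<bar>deriv p x\<bar> \<le> K" "\<bar>q x\<bar> \<le> K" using b unfolding K_def by linarith+
  qed (rule sq(2))
  then show thesis by (rule that)
qed

text \<open>Summation of \<open>4 \<kappa> j \<ge> \<kappa> ((j + 1)\<^sup>2 - j\<^sup>2)\<close>, valid for \<open>j \<ge> 1\<close>; the factor 4 leaves room for
  the odd term.\<close>

lemma quadratic_gap_if_linear_steps: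
  fixes a :: "nat \<Rightarrow> real"
  assumes k: "0 < \<kappa>" and s: "\<And>n. 1 \<le> n \<Longrightarrow> 4 * \<kappa> * real n \<le> a (Suc n) - a n"
    and n: "1 \<le> n" "n \<le> m"
  shows "\<kappa> * ((real m)\<^sup>2 - (real n)\<^sup>2) \<le> a m - a n"
  using n(2)
proof (induction rule: dec_induct)
  case (step j)
  have "1 \<le> real j" using step n by simp
  then have "\<kappa> * (2 * real j + 1) \<le> \<kappa> * (4 * real j)" using k by (intro mult_left_mono) auto
  moreover have "4 * \<kappa> * real j \<le> a (Suc j) - a j" using s[of j] step n by simp
  ultimately show ?case using step.IH by (simp add: algebra_simps power2_eq_square)
qed simp

text \<open>If the square roots grow by \<open>d\<close> per step, then \<open>\<surd>a\<^sub>n\<close> grows linearly and \<open>a\<^bsub>n+1\<^esub> - a\<^sub>n\<close> is at least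
  \<open>d\<close> times the sum of two such roots. Only finitely many steps come before this regime, and they
  are covered by the minimum of their ratios.\<close>

lemma linear_steps_if_sqrt_steps:
  fixes a :: "nat \<Rightarrow> real"
  assumes mono: "\<And>n. 1 \<le> n \<Longrightarrow> a n < a (Suc n)"
    and d: "0 < d" and st: "\<And>n. n0 \<le> n \<Longrightarrow> 0 \<le> a n \<and> d \<le> sqrt (a (Suc n)) - sqrt (a n)"
  obtains \<kappa> where "0 < \<kappa>" "\<And>n. 1 \<le> n \<Longrightarrow> 4 * \<kappa> * real n \<le> a (Suc n) - a n"
proof -
  have grow: "d * (real n - real n0) \<le> sqrt (a n)" if "n0 \<le> n" for n
    using that
  proof (induction rule: dec_induct)
    case base then show ?case using st[of n0] by simp
  next
    case (step j) then show ?case using st[of j] by (simp add: algebra_simps)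
  qed
  have large: "d\<^sup>2 / 2 * real n \<le> a (Suc n) - a n" if n: "2 * n0 \<le> n" for n
  proof -
    have nn: "n0 \<le> n" "n0 \<le> Suc n" using n by auto
    define x y where "x = sqrt (a n)" and "y = sqrt (a (Suc n))"
    have a: "a n = x\<^sup>2" "a (Suc n) = y\<^sup>2" "0 \<le> x" using st[OF nn(1)] st[OF nn(2)] by (auto simp: x_def y_def)
    have "real n / 2 \<le> real (Suc n) - real n0" using n by simp
    then have "d * (real n / 2) \<le> d * (real (Suc n) - real n0)" using d by (intro mult_left_mono) auto
    then have y: "d * (real n / 2) \<le> y" using grow[OF nn(2)] by (simp add: y_def)
    have "d * (d * (real n / 2)) \<le> (y - x) * (y + x)"
    proof (rule mult_mono)
      show "d \<le> y - x" using st[OF nn(1)] by (simp add: x_def y_def)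
      then show "0 \<le> y - x" using d by linarith
      show "d * (real n / 2) \<le> y + x" using y a(3) by linarith
    qed (use d in simp)
    then show ?thesis by (simp add: a power2_eq_square algebra_simps)
  qed
  define S where "S = (\<lambda>n. (a (Suc n) - a n) / real n) ` {1..2 * n0 + 1}"
  have S: "finite S" "S \<noteq> {}" by (auto simp: S_def)
  have Sp: "0 < Min S" using S mono by (auto simp: S_def)
  define \<kappa> where "\<kappa> = min (Min S) (d\<^sup>2 / 2) / 4"
  have "4 * \<kappa> * real n \<le> a (Suc n) - a n" if n: "1 \<le> n" for n
  proof (cases "2 * n0 \<le> n")
    case True
    have "4 * \<kappa> * real n \<le> d\<^sup>2 / 2 * real n" by (rule mult_right_mono) (auto simp: \<kappa>_def)
    then show ?thesis using large[OF True] by simp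
  next
    case False
    have "Min S \<le> (a (Suc n) - a n) / real n" using S False n by (intro Min_le) (auto simp: S_def)
    then have "4 * \<kappa> \<le> (a (Suc n) - a n) / real n" by (simp add: \<kappa>_def)
    then show ?thesis using n by (simp add: field_simps)
  qed
  moreover have "0 < \<kappa>" using Sp d by (simp add: \<kappa>_def)
  ultimately show thesis using that by blast
qed

text \<open>All that the analysis of the Prony roots uses about the operator.\<close>

locale quadratic_gap =
  fixes lam :: "nat \<Rightarrow> real" and \<kappa> :: real
  assumes \<kappa>: "0 < \<kappa>"
    and gap: "\<And>n s. 1 \<le> n \<Longrightarrow> n \<le> s \<Longrightarrow> \<kappa> * ((real s)\<^sup>2 - (real n)\<^sup>2) \<le> lam s - lam n"

lemma SL_eigenvalue_gap:
  assumes p: "smooth_near_unit p" and q: "smooth_near_unit q" and pos: "\<forall>x\<in>{0..1}. 0 < p x"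
    and lam: "SL_eigenvalue_seq p q lam"
  obtains \<kappa> where "quadratic_gap lam \<kappa>"
proof -
  obtain K where "SL_bounded p (deriv p) q K" using SL_bounded_if_smooth[OF p q pos] .
  then interpret SL_bounded p "deriv p" q K .
  obtain c where c: "0 < c" and sep: "\<And>\<mu> \<nu>. SL_eigenvalue p q \<mu> \<Longrightarrow> SL_eigenvalue p q \<nu> \<Longrightarrow>
      K \<le> \<mu> \<Longrightarrow> \<mu> < \<nu> \<Longrightarrow> c \<le> (sqrt \<nu> - sqrt \<mu>)\<^sup>2 + 1 / \<mu>"
    using eigenvalue_separation by blast
  have ev: "SL_eigenvalue p q (lam n)" if "1 \<le> n" for n
  proof -
    have "lam n \<in> lam ` {1..}" using that by simp
    then show ?thesis using lam unfolding SL_eigenvalue_seq_def by blast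
  qed
  have mono: "lam n < lam (Suc n)" if "1 \<le> n" for n
    using lam that unfolding SL_eigenvalue_seq_def by (auto simp: strict_mono_on_def)
  have "eventually (\<lambda>n. max K (2 / c) \<le> lam n) sequentially"
    using lam unfolding SL_eigenvalue_seq_def filterlim_at_top by blast
  then obtain n1 where n1: "\<And>n. n1 \<le> n \<Longrightarrow> max K (2 / c) \<le> lam n"
    by (auto simp: eventually_sequentially)
  define n0 where "n0 = max 1 n1"
  \<comment> \<open>Beyond \<open>n0\<close> the term \<open>1 / \<mu>\<close> takes at most half of the separation constant.\<close>
  have "0 \<le> lam n \<and> sqrt (c / 2) \<le> sqrt (lam (Suc n)) - sqrt (lam n)" if n: "n0 \<le> n" for n
  proof -
    have 1: "1 \<le> n" "K \<le> lam n" "2 / c \<le> lam n" using n n1[of n] by (auto simp: n0_def)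
    have l0: "0 < lam n" using 1 K1 by simp
    have "1 / lam n \<le> c / 2" using 1(3) c l0 by (simp add: field_simps)
    moreover have "c \<le> (sqrt (lam (Suc n)) - sqrt (lam n))\<^sup>2 + 1 / lam n"
      by (rule sep) (use ev mono 1 in auto)
    ultimately have "c / 2 \<le> (sqrt (lam (Suc n)) - sqrt (lam n))\<^sup>2" by linarith
    then have "sqrt (c / 2) \<le> \<bar>sqrt (lam (Suc n)) - sqrt (lam n)\<bar>"
      by (metis real_sqrt_le_iff real_sqrt_abs)
    then show ?thesis using l0 mono[OF 1(1)] by simp
  qed
  then obtain \<kappa> where \<kappa>: "0 < \<kappa>" "\<And>n. 1 \<le> n \<Longrightarrow> 4 * \<kappa> * real n \<le> lam (Suc n) - lam n"
    using linear_steps_if_sqrt_steps[of lam "sqrt (c / 2)" n0] mono c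
    by (metis half_gt_zero real_sqrt_gt_0_iff)
  show thesis
    by (rule that, rule quadratic_gap.intro[OF \<kappa>(1)]) (rule quadratic_gap_if_linear_steps[OF \<kappa>])
qed

section \<open>The perturbed Prony polynomial\<close>

lemma det_scale_rows:
  fixes r :: "nat \<Rightarrow> 'a :: comm_ring_1"
  shows "det (mat n n (\<lambda>(i, j). r i * B i j)) = (\<Prod>i<n. r i) * det (mat n n (\<lambda>(i, j). B i j))"
proof -
  have "det (mat n n (\<lambda>(i, j). r i * B i j)) =
    (\<Sum>p\<in>{p. p permutes {0..<n}}. signof p * (\<Prod>i = 0..<n. r i * B i (p i)))"
    unfolding det_def by (auto intro!: sum.cong prod.cong simp: permutes_in_image)
  also have "\<dots> = (\<Sum>p\<in>{p. p permutes {0..<n}}. (\<Prod>i<n. r i) * (signof p * (\<Prod>i = 0..<n. B i (p i))))"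
    by (intro sum.cong refl) (simp add: prod.distrib lessThan_atLeast0 mult_ac)
  also have "\<dots> = (\<Prod>i<n. r i) * det (mat n n (\<lambda>(i, j). B i j))"
    unfolding det_def
    by (auto intro!: sum.cong prod.cong simp: permutes_in_image simp flip: sum_distrib_left)
  finally show ?thesis .
qed

lemma laplace_delta_row:
  assumes A: "(A :: 'a :: comm_ring_1 mat) \<in> carrier_mat n n" and i: "i < n" and k: "k < n"
    and r: "\<And>j. j < n \<Longrightarrow> A $$ (i, j) = (if j = k then 1 else 0)"
  shows "det A = cofactor A i k"
proof -
  have "det A = (\<Sum>j<n. A $$ (i, j) * cofactor A i j)" by (rule laplace_expansion_row[OF A i])
  also have "\<dots> = (\<Sum>j<n. if j = k then cofactor A i j else 0)"
    by (rule sum.cong) (auto simp: r)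
  also have "\<dots> = cofactor A i k" using k by simp
  finally show ?thesis .
qed

definition vandermonde :: "nat \<Rightarrow> (nat \<Rightarrow> real) \<Rightarrow> real mat" where
  "vandermonde n x = mat n n (\<lambda>(a, j). x a ^ j)"

text \<open>With row \<open>k\<close> replaced by the powers of a variable \<open>z\<close>, the determinant becomes a polynomial in \<open>z\<close>
  that vanishes at all other nodes. Its leading coefficient is the cofactor of the last entry of
  the row.\<close>

lemma vandermonde_last_cofactor:
  assumes inj: "inj_on x {..<Suc N}" and k: "k < Suc N"
  shows "det (vandermonde (Suc N) x) =
    cofactor (vandermonde (Suc N) x) k N * (\<Prod>i\<in>{..<Suc N} - {k}. x k - x i)"
proof -
  define n where "n = Suc N"
  define V where "V = vandermonde n x"
  define W where "W = (\<lambda>z. mat n n (\<lambda>(a, j). if a = k then z ^ j else x a ^ j))"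
  define F where "F = (\<Sum>j<n. monom (cofactor V k j) j)"
  define G where "G = Polynomial.smult (cofactor V k N) (\<Prod>i\<in>{..<n} - {k}. [:- x i, 1:])"
  have Wc: "W z \<in> carrier_mat n n" for z by (simp add: W_def)
  have kn: "k < n" using k by (simp add: n_def)
  have del: "mat_delete (W z) k j = mat_delete V k j" for z j
    by (rule eq_matI) (auto simp: mat_delete_def W_def V_def vandermonde_def)
  have Wk: "W z $$ (k, j) = z ^ j" if "j < n" for z j
    using that kn by (simp add: W_def)
  have F: "poly F z = det (W z)" for z
    unfolding laplace_expansion_row[OF Wc kn] F_def poly_sum
    by (rule sum.cong) (simp_all add: poly_monom cofactor_def del Wk)
  have F0: "poly F (x i) = 0" if i: "i < n" "i \<noteq> k" for i
    unfolding F
    by (rule det_identical_rows[OF Wc, of i k]) (use i kn in \<open>auto simp: W_def intro!: eq_vecI\<close>)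
  have Fk: "poly F (x k) = det V"
    unfolding F by (rule arg_cong[where f = det], rule eq_matI) (auto simp: W_def V_def vandermonde_def)
  have c: "card ({..<n} - {k}) = N" using kn by (simp add: n_def)
  have dF: "degree F \<le> N" unfolding F_def
    by (rule degree_sum_le) (auto simp: n_def intro: order_trans[OF degree_monom_le])
  have cF: "poly.coeff F N = cofactor V k N" by (simp add: F_def coeff_sum n_def)
  have dP: "degree (\<Prod>i\<in>{..<n} - {k}. [:- x i, 1:]) = N"
    by (subst degree_prod_eq_sum_degree) (use c in auto)
  have mP: "poly.coeff (\<Prod>i\<in>{..<n} - {k}. [:- x i, 1:]) N = 1"
    using lead_coeff_prod[of "\<lambda>i. [:- x i, 1:]" "{..<n} - {k}"] dP by simp
  have "F = G"
  proof (rule poly_eqI_degree_lead_coeff[where n = N and A = "x ` ({..<n} - {k})"])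
    have "inj_on x ({..<n} - {k})" by (rule inj_on_subset[OF inj]) (auto simp: n_def)
    then show "N \<le> card (x ` ({..<n} - {k}))" by (simp add: card_image c)
    show "poly F z = poly G z" if z: "z \<in> x ` ({..<n} - {k})" for z
    proof -
      obtain i where i: "i < n" "i \<noteq> k" "z = x i" using z by blast
      have "(\<Prod>j\<in>{..<n} - {k}. x i - x j) = 0" using i by (intro prod_zero) auto
      then show ?thesis using F0[OF i(1,2)] i(3) by (simp add: G_def poly_prod)
    qed
  qed (use dF cF dP mP in \<open>auto simp: G_def intro: order_trans[OF degree_smult_le]\<close>)
  then show ?thesis using Fk by (simp add: G_def poly_prod V_def n_def)
qed

lemma vandermonde_nonzero:
  "inj_on x {..<n} \<Longrightarrow> det (vandermonde n x) \<noteq> 0"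
proof (induction n)
  case 0
  then show ?case by (simp add: vandermonde_def det_dim_zero)
next
  case (Suc N)
  have "mat_delete (vandermonde (Suc N) x) N N = vandermonde N x"
    by (rule eq_matI) (auto simp: mat_delete_def vandermonde_def)
  then have "cofactor (vandermonde (Suc N) x) N N = det (vandermonde N x)"
    by (simp add: cofactor_def)
  moreover have "det (vandermonde N x) \<noteq> 0"
    by (rule Suc.IH[OF inj_on_subset[OF Suc.prems]]) auto
  moreover have "(\<Prod>i\<in>{..<Suc N} - {N}. x N - x i) \<noteq> 0"
    using Suc.prems by (auto simp: inj_on_def)
  ultimately show ?case by (simp add: vandermonde_last_cofactor[OF Suc.prems, of N])
qed

text \<open>The matrix of the Prony polynomial at the point \<open>z\<close> for \<open>n\<close> nodes \<open>x\<close> with weights \<open>w\<close>. It has one row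
  less of moments than there are nodes: the last node is the one that carries the noise.\<close>

definition hankel_pencil :: "nat \<Rightarrow> (nat \<Rightarrow> real) \<Rightarrow> (nat \<Rightarrow> real) \<Rightarrow> real \<Rightarrow> real mat" where
  "hankel_pencil n w x z =
     mat n n (\<lambda>(i, j). if i = 0 then z ^ j else \<Sum>a<n. w a * x a ^ (i - 1 + j))"

text \<open>At a node, also the row of powers of \<open>z\<close> is a combination of rows of the Vandermonde matrix \<open>V\<close>,
  so the pencil factors as \<open>A V\<close> with \<open>A\<close> square. Laplace expansion of \<open>A\<close> along its unit row leaves the
  weights of the other nodes times a Vandermonde minor of \<open>V\<close>, and
  \<open>vandermonde_last_cofactor\<close> expresses this minor by \<open>det V\<close>.\<close>

lemma hankel_pencil_at_node:
  assumes inj: "inj_on x {..<Suc N}" and k: "k < Suc N"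
  shows "det (hankel_pencil (Suc N) w x (x k)) * (\<Prod>i\<in>{..<Suc N} - {k}. x i - x k) =
    (\<Prod>i\<in>{..<Suc N} - {k}. w i) * (det (vandermonde (Suc N) x))\<^sup>2"
proof -
  define n where "n = Suc N"
  define V where "V = vandermonde n x"
  define A where "A = mat n n (\<lambda>(i, a). if i = 0 then if a = k then 1 else 0 else w a * x a ^ (i - 1))"
  \<comment> \<open>The increasing enumeration of the indices other than \<open>k\<close>.\<close>
  define sk where "sk = (\<lambda>j. if j < k then j else Suc j)"
  define D where "D = det (mat_delete V k N)"
  have Ac: "A \<in> carrier_mat n n" and Vc: "V \<in> carrier_mat n n" by (auto simp: A_def V_def vandermonde_def)
  have kn: "k < n" using k by (simp add: n_def)
  have "hankel_pencil n w x (x k) = A * V"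
  proof (rule eq_matI)
    fix i j assume "i < dim_row (A * V)" "j < dim_col (A * V)"
    then have ij: "i < n" "j < n" using Ac Vc by auto
    have "(A * V) $$ (i, j) = (\<Sum>a<n. A $$ (i, a) * V $$ (a, j))"
      using ij Ac Vc by (simp add: times_mat_def scalar_prod_def lessThan_atLeast0)
    also have "\<dots> = (\<Sum>a<n. if i = 0 then if a = k then x a ^ j else 0 else w a * x a ^ (i - 1 + j))"
    proof (rule sum.cong)
      fix a assume "a \<in> {..<n}"
      then show "A $$ (i, a) * V $$ (a, j) =
          (if i = 0 then if a = k then x a ^ j else 0 else w a * x a ^ (i - 1 + j))"
        using ij unfolding A_def V_def vandermonde_def by (simp add: power_add del: add_diff_assoc2)
    qed simp
    also have "\<dots> = hankel_pencil n w x (x k) $$ (i, j)"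
      using ij kn by (auto simp: hankel_pencil_def)
    finally show "hankel_pencil n w x (x k) $$ (i, j) = (A * V) $$ (i, j)" by simp
  qed (auto simp: hankel_pencil_def A_def V_def vandermonde_def)
  then have 1: "det (hankel_pencil n w x (x k)) = det A * det V" using det_mult[OF Ac Vc] by simp
  have "det A = cofactor A 0 k"
    by (rule laplace_delta_row[OF Ac]) (auto simp: n_def kn A_def k)
  also have "\<dots> = (-1) ^ k * det (mat_delete A 0 k)" by (simp add: cofactor_def)
  also have "mat_delete A 0 k = transpose_mat (mat N N (\<lambda>(i, j). w (sk i) * x (sk i) ^ j))"
    by (rule eq_matI) (auto simp: mat_delete_def A_def n_def sk_def)
  also have "det \<dots> = (\<Prod>i<N. w (sk i)) * det (mat N N (\<lambda>(i, j). x (sk i) ^ j))"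
    by (subst det_transpose[of _ N]) (auto simp: det_scale_rows)
  also have "mat N N (\<lambda>(i, j). x (sk i) ^ j) = mat_delete V k N"
    by (rule eq_matI) (auto simp: mat_delete_def V_def vandermonde_def n_def sk_def)
  also have "(\<Prod>i<N. w (sk i)) = (\<Prod>i\<in>{..<n} - {k}. w i)"
  proof (rule prod.reindex_bij_betw)
    have "bij_betw sk {..<N} (sk ` {..<N})"
      by (rule inj_on_imp_bij_betw) (auto simp: inj_on_def sk_def split: if_splits)
    moreover have "sk ` {..<N} = {..<n} - {k}"
    proof (intro equalityI subsetI)
      fix j assume j: "j \<in> {..<n} - {k}"
      show "j \<in> sk ` {..<N}"
      proof (cases "j < k")
        case True then show ?thesis using kn by (intro image_eqI[of _ _ j]) (auto simp: sk_def n_def)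
      next
        case False then show ?thesis using j by (intro image_eqI[of _ _ "j - 1"]) (auto simp: sk_def n_def)
      qed
    qed (auto simp: sk_def n_def split: if_splits)
    ultimately show "bij_betw sk {..<N} ({..<n} - {k})" by simp
  qed
  finally have 2: "det A = (-1) ^ k * ((\<Prod>i\<in>{..<n} - {k}. w i) * D)" by (simp add: D_def)
  have "(\<Prod>i\<in>{..<n} - {k}. x k - x i) = (\<Prod>i\<in>{..<n} - {k}. (-1) * (x i - x k))"
    by (rule prod.cong) auto
  also have "\<dots> = (-1) ^ N * (\<Prod>i\<in>{..<n} - {k}. x i - x k)"
    unfolding prod.distrib using kn by (simp add: n_def)
  finally have "det V = (-1) ^ (k + N) * D * ((-1) ^ N * (\<Prod>i\<in>{..<n} - {k}. x i - x k))"
    using vandermonde_last_cofactor[OF inj k] by (simp add: V_def n_def cofactor_def D_def)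
  then have 3: "det V = (-1) ^ k * D * (\<Prod>i\<in>{..<n} - {k}. x i - x k)"
    by (simp add: power_add flip: power_mult_distrib)
  have "det A * det V * (\<Prod>i\<in>{..<n} - {k}. x i - x k)
    = (\<Prod>i\<in>{..<n} - {k}. w i) * det V * ((-1) ^ k * D * (\<Prod>i\<in>{..<n} - {k}. x i - x k))"
    by (simp add: 2 mult_ac)
  then show ?thesis unfolding 3[symmetric] 1[symmetric, unfolded n_def] 
    by (simp add: 1[unfolded n_def] n_def V_def power2_eq_square mult_ac)
qed


lemma degree_det_le:
  fixes A :: "'a :: idom poly mat"
  assumes A: "A \<in> carrier_mat (Suc N) (Suc N)"
    and r: "\<And>j. j < Suc N \<Longrightarrow> degree (A $$ (0, j)) \<le> N"
    and c: "\<And>i j. 0 < i \<Longrightarrow> i < Suc N \<Longrightarrow> j < Suc N \<Longrightarrow> degree (A $$ (i, j)) = 0"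
  shows "degree (det A) \<le> N"
  unfolding det_def'[OF A]
proof (rule degree_sum_le)
  show "finite {p. p permutes {0..<Suc N}}" by (rule finite_permutations) simp
  fix p assume p: "p \<in> {p. p permutes {0..<Suc N}}"
  have pl: "p i < Suc N" if "i < Suc N" for i
    using p that permutes_in_image[of p "{0..<Suc N}" i] by simp
  have "degree (\<Prod>i = 0..<Suc N. A $$ (i, p i)) \<le> (\<Sum>i = 0..<Suc N. degree (A $$ (i, p i)))"
    using degree_prod_sum_le[of "{0..<Suc N}" "\<lambda>i. A $$ (i, p i)"] by (simp add: o_def)
  also have "\<dots> = degree (A $$ (0, p 0)) + (\<Sum>i = 1..<Suc N. degree (A $$ (i, p i)))"
    by (subst sum.atLeast_Suc_lessThan) auto
  also have "\<dots> \<le> N" using r[OF pl[of 0]] c pl by simp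
  finally have "degree (\<Prod>i = 0..<Suc N. A $$ (i, p i)) \<le> N" .
  moreover have "degree (signof p :: 'a poly) = 0" by (simp add: sign_def)
  ultimately show "degree (signof p * (\<Prod>i = 0..<Suc N. A $$ (i, p i))) \<le> N"
    using degree_mult_le[of "signof p" "\<Prod>i = 0..<Suc N. A $$ (i, p i)"] by linarith
qed

lemma degree_prony_poly: "degree (prony_poly lam \<Delta> N y \<epsilon>) \<le> N"
  unfolding prony_poly_def
  by (rule degree_det_le) (auto intro: order_trans[OF degree_monom_le])

lemma poly_prony_poly:
  "poly (prony_poly lam \<Delta> N y \<epsilon>) z =
     det (hankel_pencil (Suc N) (\<lambda>j. if j < N then y (Suc j) else \<epsilon> * y (Suc N))
       (\<lambda>j. phi lam \<Delta> (Suc j)) z)"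
proof -
  interpret h: comm_ring_hom "\<lambda>p. poly p z" by unfold_locales auto
  have m: "measurement lam \<Delta> N y \<epsilon> k =
    (\<Sum>a<Suc N. (if a < N then y (Suc a) else \<epsilon> * y (Suc N)) * phi lam \<Delta> (Suc a) ^ k)" for k
  proof -
    have im: "{1..N} = Suc ` {..<N}" by (simp add: image_Suc_lessThan)
    show ?thesis unfolding measurement_def im by (simp add: sum.reindex)
  qed
  show ?thesis unfolding prony_poly_def h.hom_det[symmetric]
    by (rule arg_cong[where f = det], rule eq_matI)
      (auto simp: hankel_pencil_def poly_monom m)
qed

text \<open>Both sides are polynomials of degree at most \<open>N\<close> that agree at the \<open>N + 1\<close> nodes.\<close>

lemma prony_poly_lagrange:
  fixes lam y \<Delta> \<epsilon> N
  defines "x \<equiv> \<lambda>j. phi lam \<Delta> (Suc j)"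
    and "w \<equiv> \<lambda>j. if j < N then y (Suc j) else \<epsilon> * y (Suc N)"
  assumes inj: "inj_on x {..<Suc N}"
  shows "poly (prony_poly lam \<Delta> N y \<epsilon>) z =
    (\<Sum>k<Suc N. (\<Prod>i\<in>{..<Suc N} - {k}. w i) * (det (vandermonde (Suc N) x))\<^sup>2 /
       (\<Prod>i\<in>{..<Suc N} - {k}. x i - x k)\<^sup>2 * (\<Prod>i\<in>{..<Suc N} - {k}. x i - z))"
proof -
  define c where "c = (\<lambda>k. (\<Prod>i\<in>{..<Suc N} - {k}. w i) * (det (vandermonde (Suc N) x))\<^sup>2 /
       (\<Prod>i\<in>{..<Suc N} - {k}. x i - x k)\<^sup>2)"
  define R where "R = (\<Sum>k<Suc N. Polynomial.smult (c k) (\<Prod>i\<in>{..<Suc N} - {k}. [:x i, - 1:]))"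
  have pR: "poly R z = (\<Sum>k<Suc N. c k * (\<Prod>i\<in>{..<Suc N} - {k}. x i - z))" for z
    by (simp add: R_def poly_sum poly_prod)
  have "prony_poly lam \<Delta> N y \<epsilon> = R"
  proof (rule poly_eqI_degree[where A = "x ` {..<Suc N}"])
    have c: "card (x ` {..<Suc N}) = Suc N" by (simp add: card_image[OF inj])
    show "degree (prony_poly lam \<Delta> N y \<epsilon>) < card (x ` {..<Suc N})"
      using degree_prony_poly[of lam \<Delta> N y \<epsilon>] unfolding c by simp
    have "degree R \<le> N" unfolding R_def
    proof (rule degree_sum_le)
      fix k assume k: "k \<in> {..<Suc N}"
      have "degree (\<Prod>i\<in>{..<Suc N} - {k}. [:x i, - 1:]) \<le> (\<Sum>i\<in>{..<Suc N} - {k}. 1)"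
        using degree_prod_sum_le[of "{..<Suc N} - {k}" "\<lambda>i. [:x i, - 1:]"] by (simp add: o_def)
      then show "degree (Polynomial.smult (c k) (\<Prod>i\<in>{..<Suc N} - {k}. [:x i, - 1:])) \<le> N"
        using k degree_smult_le order_trans by fastforce
    qed simp
    then show "degree R < card (x ` {..<Suc N})" unfolding c by simp
    fix z assume "z \<in> x ` {..<Suc N}"
    then obtain k where k: "k < Suc N" "z = x k" by auto
    let ?D = "\<Prod>i\<in>{..<Suc N} - {k}. x i - x k"
    have D: "?D \<noteq> 0" using inj k by (auto simp: inj_on_def)
    have "poly (prony_poly lam \<Delta> N y \<epsilon>) z * ?D = c k * ?D * ?D"
      using hankel_pencil_at_node[OF inj k(1), of w] D
      by (simp add: poly_prony_poly k(2) x_def w_def c_def power2_eq_square)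
    then have "poly (prony_poly lam \<Delta> N y \<epsilon>) z = c k * ?D" using D by simp
    also have "\<dots> = (\<Sum>j<Suc N. if j = k then c k * ?D else 0)" using k by simp
    also have "\<dots> = poly R z" unfolding pR
    proof (rule sum.cong)
      fix j assume j: "j \<in> {..<Suc N}"
      have "(\<Prod>i\<in>{..<Suc N} - {j}. x i - z) = 0" if "j \<noteq> k"
        using k that by (intro prod_zero) auto
      then show "(if j = k then c k * ?D else 0) = c j * (\<Prod>i\<in>{..<Suc N} - {j}. x i - z)"
        using k by auto
    qed simp
    finally show "poly (prony_poly lam \<Delta> N y \<epsilon>) z = poly R z" .
  qed
  then show ?thesis by (simp add: pR c_def)
qed

text \<open>The term of the interpolation formula that omits the noise node is proportional to the noise-free
  Prony polynomial; every other term carries one factor \<open>\<epsilon>\<close>. Dividing by the coefficient of the former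
  gives the perturbation in relative form.\<close>

lemma prony_poly_factored:
  fixes lam y \<Delta> \<epsilon> N b
  defines "\<phi> \<equiv> phi lam \<Delta>"
  assumes inj: "inj_on \<phi> {1..Suc N}" and y: "\<And>k. k \<in> {1..N} \<Longrightarrow> y k \<noteq> 0"
    and b: "\<And>k. k \<in> {1..N} \<Longrightarrow>
      b k = y (Suc N) / y k * (\<Prod>i\<in>{1..N} - {k}. ((\<phi> i - \<phi> (Suc N)) / (\<phi> i - \<phi> k))\<^sup>2)"
  obtains C where "C \<noteq> 0" "\<forall>z. poly (prony_poly lam \<Delta> N y \<epsilon>) z =
    C * ((\<Prod>i\<in>{1..N}. \<phi> i - z) + \<epsilon> * (\<phi> (Suc N) - z) * (\<Sum>k\<in>{1..N}. b k * (\<Prod>i\<in>{1..N} - {k}. \<phi> i - z)))"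
proof -
  define x where "x = (\<lambda>j. \<phi> (Suc j))"
  define w where "w = (\<lambda>j. if j < N then y (Suc j) else \<epsilon> * y (Suc N))"
  define V where "V = det (vandermonde (Suc N) x)"
  define C where "C = (\<Prod>i<N. y (Suc i)) * V\<^sup>2 / (\<Prod>i<N. x i - x N)\<^sup>2"
  have injx: "inj_on x {..<Suc N}" unfolding x_def
    by (intro inj_onI) (use inj_onD[OF inj] in fastforce)
  have V: "V \<noteq> 0" unfolding V_def by (rule vandermonde_nonzero[OF injx])
  have ne: "x i \<noteq> x j" if "i < Suc N" "j < Suc N" "i \<noteq> j" for i j
    using injx that by (auto simp: inj_on_def)
  have C0: "C \<noteq> 0" using V y ne by (auto simp: C_def)
  have im: "{1..N} = Suc ` {..<N}" by (simp add: image_Suc_lessThan)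
  have im': "Suc ` {..<N} - {Suc k} = Suc ` ({..<N} - {k})" for k by auto
  have bk: "b (Suc k) = y (Suc N) / y (Suc k) * (\<Prod>i\<in>{..<N} - {k}. ((x i - x N) / (x i - x k))\<^sup>2)"
    if "k < N" for k
  proof -
    have "b (Suc k) = y (Suc N) / y (Suc k) *
        (\<Prod>i\<in>{1..N} - {Suc k}. ((\<phi> i - \<phi> (Suc N)) / (\<phi> i - \<phi> (Suc k)))\<^sup>2)"
      by (rule b) (use that in simp)
    then show ?thesis unfolding im im' by (simp add: prod.reindex x_def)
  qed
  have split: "{..<Suc N} - {k} = insert N ({..<N} - {k})" if "k < N" for k using that by auto
  have ck: "(\<Prod>i\<in>{..<Suc N} - {k}. w i) * V\<^sup>2 / (\<Prod>i\<in>{..<Suc N} - {k}. x i - x k)\<^sup>2 = C * (\<epsilon> * b (Suc k))"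
    if k: "k < N" for k
  proof -
    define W where "W = (\<Prod>i\<in>{..<N} - {k}. w i)"
    define P where "P = (\<Prod>i\<in>{..<N} - {k}. x i - x N)"
    define Q where "Q = (\<Prod>i\<in>{..<N} - {k}. x i - x k)"
    have yk: "y (Suc k) \<noteq> 0" using y k by simp
    have nz: "P \<noteq> 0" "Q \<noteq> 0" "x k - x N \<noteq> 0" using ne k by (auto simp: P_def Q_def)
    have 1: "(\<Prod>i\<in>{..<Suc N} - {k}. w i) = \<epsilon> * y (Suc N) * W"
      unfolding split[OF k] by (simp add: W_def) (simp add: w_def)
    have 2: "(\<Prod>i\<in>{..<Suc N} - {k}. x i - x k) = (x N - x k) * Q"
      unfolding split[OF k] by (simp add: Q_def)
    have 3: "(\<Prod>i<N. y (Suc i)) = y (Suc k) * W"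
      using k by (subst prod.remove[of _ k]) (auto simp: W_def w_def)
    have 4: "(\<Prod>i<N. x i - x N) = (x k - x N) * P"
      using k by (subst prod.remove[of _ k]) (auto simp: P_def)
    have 5: "(\<Prod>i\<in>{..<N} - {k}. ((x i - x N) / (x i - x k))\<^sup>2) = P\<^sup>2 / Q\<^sup>2"
      by (simp add: P_def Q_def prod_power_distrib prod_dividef power_divide)
    have 6: "(x N - x k)\<^sup>2 = (x k - x N)\<^sup>2" by (rule power2_commute)
    show ?thesis unfolding 1 2 C_def 3 4 bk[OF k] 5 power_mult_distrib 6
      using nz yk by (simp add: field_simps)
  qed
  have "poly (prony_poly lam \<Delta> N y \<epsilon>) z =
    C * ((\<Prod>i\<in>{1..N}. \<phi> i - z) + \<epsilon> * (\<phi> (Suc N) - z) * (\<Sum>k\<in>{1..N}. b k * (\<Prod>i\<in>{1..N} - {k}. \<phi> i - z)))" for z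
  proof -
    have "poly (prony_poly lam \<Delta> N y \<epsilon>) z =
      (\<Sum>k<Suc N. (\<Prod>i\<in>{..<Suc N} - {k}. w i) * V\<^sup>2 / (\<Prod>i\<in>{..<Suc N} - {k}. x i - x k)\<^sup>2
         * (\<Prod>i\<in>{..<Suc N} - {k}. x i - z))"
      unfolding V_def w_def x_def \<phi>_def
      by (rule prony_poly_lagrange) (use injx in \<open>simp add: x_def \<phi>_def\<close>)
    also have "\<dots> = C * (\<Prod>i<N. x i - z)
       + (\<Sum>k<N. C * (\<epsilon> * b (Suc k)) * ((x N - z) * (\<Prod>i\<in>{..<N} - {k}. x i - z)))"
    proof -
      have sp2: "(\<Prod>i\<in>{..<Suc N} - {k}. x i - z) = (x N - z) * (\<Prod>i\<in>{..<N} - {k}. x i - z)"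
        if "k < N" for k unfolding split[OF that] by simp
      have "{..<Suc N} - {N} = {..<N}" by auto
      moreover have "(\<Prod>i<N. w i) = (\<Prod>i<N. y (Suc i))" by (simp add: w_def)
      ultimately show ?thesis
        unfolding sum.lessThan_Suc C_def[symmetric]
        by (simp add: ck sp2 C_def[symmetric])
    qed
    also have "\<dots> = C * ((\<Prod>i\<in>{1..N}. \<phi> i - z) + \<epsilon> * (\<phi> (Suc N) - z) * (\<Sum>k\<in>{1..N}. b k * (\<Prod>i\<in>{1..N} - {k}. \<phi> i - z)))"
      unfolding im by (simp add: prod.reindex sum.reindex im' x_def sum_distrib_left distrib_left mult_ac)
    finally show ?thesis .
  qed
  then show thesis by (intro that[OF C0] allI)
qed

section \<open>Roots of a perturbed product of linear factors\<close>

lemma root_between_sign_change: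
  fixes f :: "real \<Rightarrow> real"
  assumes c: "continuous_on {a..b} f" and ab: "a \<le> b" and s: "f a * f b < 0"
  shows "\<exists>r\<in>{a..b}. f r = 0"
proof (cases "f a < 0")
  case True
  then have "0 \<le> f b" using s by (simp add: mult_less_0_iff)
  then show ?thesis using IVT'[of f a 0 b] True ab c by auto
next
  case False
  then have "0 \<le> f a" "f b \<le> 0" using s by (auto simp: mult_less_0_iff)
  then show ?thesis using IVT2'[of f b 0 a] ab c by auto
qed

text \<open>At distance \<open>\<delta>\<^sub>n\<close> from \<open>\<phi>\<^sub>n\<close> the perturbation is at most \<open>1/3 + 1/9\<close> of the product: \<open>1/3\<close> comes from
  the summand \<open>k = n\<close> by the choice of \<open>\<delta>\<^sub>n\<close>, and the rest from the other summands by the bound on \<open>\<epsilon>\<close>.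
  The same bound keeps the intervals of radius \<open>\<delta>\<^sub>n\<close> disjoint, which also orders the roots.\<close>

lemma perturbed_product_roots:
  fixes \<phi> Q b :: "nat \<Rightarrow> real" and N :: nat and \<epsilon> M B :: real
  defines "F \<equiv> \<lambda>z. (\<Prod>i\<in>{1..N}. \<phi> i - z) + \<epsilon> * (\<phi> (Suc N) - z) * (\<Sum>k\<in>{1..N}. b k * (\<Prod>i\<in>{1..N} - {k}. \<phi> i - z))"
  assumes anti: "\<And>i j. 1 \<le> i \<Longrightarrow> i < j \<Longrightarrow> j \<le> Suc N \<Longrightarrow> \<phi> j < \<phi> i"
    and pos: "0 < \<phi> (Suc N)"
    and b: "\<And>k. k \<in> {1..N} \<Longrightarrow> \<bar>b k\<bar> \<le> M * Q k" and Q: "\<And>k. k \<in> {1..N} \<Longrightarrow> 0 < Q k" and M: "0 < M"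
    and B1: "\<And>n. n \<in> {1..N} \<Longrightarrow> Q n \<le> B"
    and B2: "\<And>n. n \<in> {1..N} \<Longrightarrow>
      (\<Sum>k\<in>{1..N} - {n}. Q k * (max (\<phi> n) (\<phi> k) / \<bar>\<phi> n - \<phi> k\<bar>)) \<le> B"
    and e: "0 \<le> \<epsilon>" "\<epsilon> * (6 * M * B) \<le> 1 / 6"
  shows "\<exists>r. (\<forall>n\<in>{1..N}. F (r n) = 0 \<and> \<bar>r n - \<phi> n\<bar> \<le> \<epsilon> * (6 * M) * (\<phi> n * Q n)) \<and>
    strict_antimono_on {1..N} r"
proof (cases "\<epsilon> = 0")
  case True
  have "F (\<phi> n) = 0" if "n \<in> {1..N}" for n
    using that True by (auto simp: F_def)
  then show ?thesis using True anti
    by (intro exI[of _ \<phi>]) (auto simp: monotone_on_def)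
next
  case False
  with e have e0: "0 < \<epsilon>" by simp
  define \<delta> where "\<delta> = (\<lambda>n. \<epsilon> * (6 * M) * (\<phi> n * Q n))"
  have \<phi>0: "0 < \<phi> n" if "n \<in> {1..N}" for n using anti[of n "Suc N"] pos that by auto
  have ne: "\<phi> i \<noteq> \<phi> j" if "i \<in> {1..N}" "j \<in> {1..N}" "i \<noteq> j" for i j
    using anti[of i j] anti[of j i] that by (cases "i < j") auto
  have \<delta>0: "0 < \<delta> n" if "n \<in> {1..N}" for n using that e0 M Q \<phi>0 by (simp add: \<delta>_def)
  have \<delta>\<phi>: "\<delta> n \<le> \<phi> n / 6" if n: "n \<in> {1..N}" for n
  proof -
    have "\<delta> n = \<epsilon> * (6 * M) * Q n * \<phi> n" by (simp add: \<delta>_def)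
    also have "\<dots> \<le> \<epsilon> * (6 * M) * B * \<phi> n"
      using B1[OF n] e M \<phi>0[OF n] by (intro mult_right_mono mult_left_mono) auto
    also have "\<dots> \<le> 1 / 6 * \<phi> n" using e \<phi>0[OF n] by (intro mult_right_mono) (auto simp: mult_ac)
    finally show ?thesis by simp
  qed
  have \<delta>sep: "\<delta> n \<le> \<bar>\<phi> n - \<phi> k\<bar> / 6" if n: "n \<in> {1..N}" and k: "k \<in> {1..N}" and nk: "n \<noteq> k" for n k
  proof -
    have g: "0 < \<bar>\<phi> n - \<phi> k\<bar>" using ne[OF n k nk] by simp
    have "Q n * (max (\<phi> k) (\<phi> n) / \<bar>\<phi> k - \<phi> n\<bar>) \<le> B"
    proof (rule order_trans[OF _ B2[OF k]], rule member_le_sum)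
      show "n \<in> {1..N} - {k}" using n nk by simp
      show "0 \<le> Q j * (max (\<phi> k) (\<phi> j) / \<bar>\<phi> k - \<phi> j\<bar>)" if "j \<in> {1..N} - {k} - {n}" for j
        using that Q[of j] \<phi>0[of j] \<phi>0[OF k] by (auto simp: less_imp_le le_max_iff_disj)
    qed simp
    then have "Q n * max (\<phi> k) (\<phi> n) \<le> B * \<bar>\<phi> n - \<phi> k\<bar>"
      using g by (simp add: field_simps abs_minus_commute)
    moreover have "Q n * \<phi> n \<le> Q n * max (\<phi> k) (\<phi> n)"
      using Q[OF n] by (intro mult_left_mono) auto
    ultimately have "\<phi> n * Q n \<le> B * \<bar>\<phi> n - \<phi> k\<bar>" by (simp add: mult.commute)
    then have "\<delta> n \<le> \<epsilon> * (6 * M) * (B * \<bar>\<phi> n - \<phi> k\<bar>)"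
      unfolding \<delta>_def using e M by (intro mult_left_mono) auto
    also have "\<dots> = \<epsilon> * (6 * M * B) * \<bar>\<phi> n - \<phi> k\<bar>" by simp
    also have "\<dots> \<le> 1 / 6 * \<bar>\<phi> n - \<phi> k\<bar>" by (rule mult_right_mono[OF e(2)]) simp
    finally show ?thesis by simp
  qed
  \<comment> \<open>On the boundary of the intervals, the perturbed polynomial has the sign of the product.\<close>
  have main: "\<exists>g>0. F z = (\<Prod>i\<in>{1..N}. \<phi> i - z) * g"
    if n: "n \<in> {1..N}" and z: "\<bar>z - \<phi> n\<bar> = \<delta> n" for n z
  proof -
    have far: "\<bar>\<phi> n - \<phi> k\<bar> / 2 \<le> \<bar>\<phi> k - z\<bar>" if "k \<in> {1..N} - {n}" for k
      using \<delta>sep[OF n, of k] that z by (auto simp: abs_if split: if_splits)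
    have nz: "\<phi> k - z \<noteq> 0" if k: "k \<in> {1..N}" for k
    proof (cases "k = n")
      case True then show ?thesis using z \<delta>0[OF n] by auto
    next
      case False then show ?thesis using far[of k] k ne[OF n k] by auto
    qed
    define g where "g = 1 + \<epsilon> * (\<phi> (Suc N) - z) * (\<Sum>k\<in>{1..N}. b k / (\<phi> k - z))"
    have prod: "(\<Prod>i\<in>{1..N} - {k}. \<phi> i - z) = (\<Prod>i\<in>{1..N}. \<phi> i - z) / (\<phi> k - z)" if k: "k \<in> {1..N}" for k
      using nz[OF k] prod.remove[OF finite_atLeastAtMost k, of "\<lambda>i. \<phi> i - z"] by simp
    have "(\<Sum>k\<in>{1..N}. b k * (\<Prod>i\<in>{1..N} - {k}. \<phi> i - z))
       = (\<Prod>i\<in>{1..N}. \<phi> i - z) * (\<Sum>k\<in>{1..N}. b k / (\<phi> k - z))"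
      unfolding sum_distrib_left by (rule sum.cong) (simp_all add: prod[unfolded One_nat_def])
    then have Fz: "F z = (\<Prod>i\<in>{1..N}. \<phi> i - z) * g"
      by (simp add: F_def g_def algebra_simps)
    have zb: "\<bar>\<phi> (Suc N) - z\<bar> \<le> 2 * \<phi> n"
      using z \<delta>\<phi>[OF n] \<phi>0[OF n] pos anti[of n "Suc N"] n by (auto simp: abs_if split: if_splits)
    have "\<bar>\<Sum>k\<in>{1..N}. b k / (\<phi> k - z)\<bar> \<le> (\<Sum>k\<in>{1..N}. \<bar>b k / (\<phi> k - z)\<bar>)" by (rule sum_abs)
    also have "\<dots> = \<bar>b n / (\<phi> n - z)\<bar> + (\<Sum>k\<in>{1..N} - {n}. \<bar>b k / (\<phi> k - z)\<bar>)"
      by (rule sum.remove) (use n in auto)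
    also have "\<bar>b n / (\<phi> n - z)\<bar> \<le> M * Q n / \<delta> n"
      using b[OF n] \<delta>0[OF n] z by (simp add: abs_divide abs_minus_commute divide_right_mono)
    also have "(\<Sum>k\<in>{1..N} - {n}. \<bar>b k / (\<phi> k - z)\<bar>)
       \<le> (\<Sum>k\<in>{1..N} - {n}. 2 * M / \<phi> n * (Q k * (max (\<phi> n) (\<phi> k) / \<bar>\<phi> n - \<phi> k\<bar>)))"
    proof (rule sum_mono)
      fix k assume k: "k \<in> {1..N} - {n}"
      then have k': "k \<in> {1..N}" by simp
      have g: "0 < \<bar>\<phi> n - \<phi> k\<bar>" using ne[OF n k'] k by auto
      have "\<bar>b k / (\<phi> k - z)\<bar> = \<bar>b k\<bar> / \<bar>\<phi> k - z\<bar>" by (rule abs_divide)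
      also have "\<dots> \<le> M * Q k / (\<bar>\<phi> n - \<phi> k\<bar> / 2)"
        by (rule frac_le) (use b[OF k'] Q[OF k'] M far[OF k] g in auto)
      also have "\<dots> = 2 * M / \<phi> n * (Q k * (\<phi> n / \<bar>\<phi> n - \<phi> k\<bar>))" using \<phi>0[OF n] by simp
      also have "\<dots> \<le> 2 * M / \<phi> n * (Q k * (max (\<phi> n) (\<phi> k) / \<bar>\<phi> n - \<phi> k\<bar>))"
        using M \<phi>0[OF n] Q[OF k'] by (intro mult_left_mono divide_right_mono) auto
      finally show "\<bar>b k / (\<phi> k - z)\<bar> \<le> 2 * M / \<phi> n * (Q k * (max (\<phi> n) (\<phi> k) / \<bar>\<phi> n - \<phi> k\<bar>))" .
    qed
    also have "\<dots> = 2 * M / \<phi> n * (\<Sum>k\<in>{1..N} - {n}. Q k * (max (\<phi> n) (\<phi> k) / \<bar>\<phi> n - \<phi> k\<bar>))"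
      by (rule sum_distrib_left[symmetric])
    also have "\<dots> \<le> 2 * M / \<phi> n * B"
      by (rule mult_left_mono[OF B2[OF n]]) (use M \<phi>0[OF n] in simp)
    finally have S: "\<bar>\<Sum>k\<in>{1..N}. b k / (\<phi> k - z)\<bar> \<le> M * Q n / \<delta> n + 2 * M / \<phi> n * B" by simp
    have "\<bar>\<epsilon> * (\<phi> (Suc N) - z) * (\<Sum>k\<in>{1..N}. b k / (\<phi> k - z))\<bar>
       \<le> \<epsilon> * (2 * \<phi> n) * (M * Q n / \<delta> n + 2 * M / \<phi> n * B)"
      unfolding abs_mult using e zb S by (intro mult_mono) auto
    also have "\<dots> = 1 / 3 + (2 / 3) * (\<epsilon> * (6 * M * B))"
      using \<phi>0[OF n] Q[OF n] M e0 by (simp add: \<delta>_def field_simps)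
    also have "\<dots> < 1" using e(2) by linarith
    finally have "0 < g" by (simp add: g_def)
    then show ?thesis using Fz by blast
  qed
  have "\<exists>r\<in>{\<phi> n - \<delta> n..\<phi> n + \<delta> n}. F r = 0" if n: "n \<in> {1..N}" for n
  proof (rule root_between_sign_change)
    show "continuous_on {\<phi> n - \<delta> n..\<phi> n + \<delta> n} F"
      unfolding F_def by (intro continuous_intros)
    show "\<phi> n - \<delta> n \<le> \<phi> n + \<delta> n" using \<delta>0[OF n] by simp
    obtain g where g: "0 < g" "F (\<phi> n - \<delta> n) = (\<Prod>i\<in>{1..N}. \<phi> i - (\<phi> n - \<delta> n)) * g"
      using main[OF n, of "\<phi> n - \<delta> n"] \<delta>0[OF n] by auto
    obtain h where h: "0 < h" "F (\<phi> n + \<delta> n) = (\<Prod>i\<in>{1..N}. \<phi> i - (\<phi> n + \<delta> n)) * h"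
      using main[OF n, of "\<phi> n + \<delta> n"] \<delta>0[OF n] by auto
    have "(\<Prod>i\<in>{1..N}. \<phi> i - (\<phi> n - \<delta> n)) * (\<Prod>i\<in>{1..N}. \<phi> i - (\<phi> n + \<delta> n))
      = (\<Prod>i\<in>{1..N}. (\<phi> i - \<phi> n)\<^sup>2 - (\<delta> n)\<^sup>2)"
      unfolding prod.distrib[symmetric] by (rule prod.cong) (auto simp: power2_eq_square algebra_simps)
    also have "\<dots> = - (\<delta> n)\<^sup>2 * (\<Prod>i\<in>{1..N} - {n}. (\<phi> i - \<phi> n)\<^sup>2 - (\<delta> n)\<^sup>2)"
      using prod.remove[OF finite_atLeastAtMost n, of "\<lambda>i. (\<phi> i - \<phi> n)\<^sup>2 - (\<delta> n)\<^sup>2"] by simp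
    also have "\<dots> < 0"
    proof -
      have "0 < (\<Prod>i\<in>{1..N} - {n}. (\<phi> i - \<phi> n)\<^sup>2 - (\<delta> n)\<^sup>2)"
      proof (rule prod_pos)
        fix i assume i: "i \<in> {1..N} - {n}"
        have "\<bar>\<delta> n\<bar> < \<bar>\<phi> i - \<phi> n\<bar>" using \<delta>sep[OF n, of i] i ne[OF n, of i] \<delta>0[OF n] by auto
        then show "0 < (\<phi> i - \<phi> n)\<^sup>2 - (\<delta> n)\<^sup>2" using power_strict_mono[of "\<bar>\<delta> n\<bar>" "\<bar>\<phi> i - \<phi> n\<bar>" 2] by simp
      qed
      then show ?thesis using \<delta>0[OF n] by (intro mult_neg_pos) auto
    qed
    finally have neg: "(\<Prod>i\<in>{1..N}. \<phi> i - (\<phi> n - \<delta> n)) * (\<Prod>i\<in>{1..N}. \<phi> i - (\<phi> n + \<delta> n)) < 0" .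
    have "F (\<phi> n - \<delta> n) * F (\<phi> n + \<delta> n) =
      ((\<Prod>i\<in>{1..N}. \<phi> i - (\<phi> n - \<delta> n)) * (\<Prod>i\<in>{1..N}. \<phi> i - (\<phi> n + \<delta> n))) * (g * h)"
      unfolding g(2) h(2) by (simp add: mult_ac)
    then show "F (\<phi> n - \<delta> n) * F (\<phi> n + \<delta> n) < 0" using mult_neg_pos[OF neg mult_pos_pos[OF g(1) h(1)]] by simp
  qed
  then obtain r where r: "\<And>n. n \<in> {1..N} \<Longrightarrow> r n \<in> {\<phi> n - \<delta> n..\<phi> n + \<delta> n} \<and> F (r n) = 0" by metis
  have "r m < r n" if nm: "n \<in> {1..N}" "m \<in> {1..N}" "n < m" for n m
    using r[OF nm(1)] r[OF nm(2)] \<delta>sep[OF nm(1,2)] \<delta>sep[OF nm(2,1)] anti[of n m] nm by auto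
  then have "strict_antimono_on {1..N} r" by (auto simp: monotone_on_def)
  moreover have "\<bar>r n - \<phi> n\<bar> \<le> \<epsilon> * (6 * M) * (\<phi> n * Q n)" if "n \<in> {1..N}" for n
    using r[OF that] by (simp add: \<delta>_def abs_le_iff)
  ultimately show ?thesis using r by blast
qed

text \<open>A strictly decreasing family of \<open>N\<close> roots exhausts the roots of a polynomial of degree at most \<open>N\<close>,
  and the \<open>n\<close>-th member is the one that exceeds all but \<open>n - 1\<close> others.\<close>

lemma ordered_roots_unique:
  fixes P :: "real poly" and r r' :: "nat \<Rightarrow> real"
  assumes P: "P \<noteq> 0" "degree P \<le> N"
    and r: "\<And>n. n \<in> {1..N} \<Longrightarrow> poly P (r n) = 0" "strict_antimono_on {1..N} r"
    and r': "\<And>n. n \<in> {1..N} \<Longrightarrow> poly P (r' n) = 0" "strict_antimono_on {1..N} r'"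
    and n: "n \<in> {1..N}"
  shows "r n = r' n"
proof -
  have lt: "r j < r i \<longleftrightarrow> i < j" if "i \<in> {1..N}" "j \<in> {1..N}" "strict_antimono_on {1..N} r" for i j and r :: "nat \<Rightarrow> real"
    using that unfolding monotone_on_def by (metis less_asym linorder_neqE_nat order_less_irrefl)
  have all: "r ` {1..N} = {z. poly P z = 0}"
    if "\<And>n. n \<in> {1..N} \<Longrightarrow> poly P (r n) = 0" "strict_antimono_on {1..N} r" for r
  proof (rule card_seteq)
    show "finite {z. poly P z = 0}" by (rule poly_roots_finite[OF P(1)])
    show "r ` {1..N} \<subseteq> {z. poly P z = 0}" using that by auto
    have "inj_on r {1..N}"
      by (intro inj_onI) (use lt[OF _ _ that(2)] in \<open>metis linorder_neqE_nat order_less_irrefl\<close>)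
    then have "card (r ` {1..N}) = N" by (simp add: card_image)
    then show "card {z. poly P z = 0} \<le> card (r ` {1..N})"
      using card_poly_roots_bound[OF P(1)] P(2) by simp
  qed
  have count: "card {z. poly P z = 0 \<and> r i < z} = i - 1"
    if rt: "\<And>n. n \<in> {1..N} \<Longrightarrow> poly P (r n) = 0" and an: "strict_antimono_on {1..N} r" and i: "i \<in> {1..N}" for r i
  proof -
    have "{z. poly P z = 0 \<and> r i < z} = r ` {1..<i}"
    proof (intro equalityI subsetI)
      fix z assume z: "z \<in> {z. poly P z = 0 \<and> r i < z}"
      then obtain j where j: "j \<in> {1..N}" "z = r j" using all[OF rt an] by blast
      then have "j < i" using z lt[OF j(1) i an] by simp
      then show "z \<in> r ` {1..<i}" using j by auto
    next
      fix z assume "z \<in> r ` {1..<i}"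
      then obtain j where j: "j \<in> {1..<i}" "z = r j" by auto
      then show "z \<in> {z. poly P z = 0 \<and> r i < z}" using rt[of j] lt[OF _ i an, of j] i by auto
    qed
    moreover have "inj_on r {1..<i}"
    proof (rule inj_onI)
      fix a c assume ac: "a \<in> {1..<i}" "c \<in> {1..<i}" "r a = r c"
      then have "a \<in> {1..N}" "c \<in> {1..N}" using i by auto
      with lt[OF this an] lt[OF this(2,1) an] ac(3) show "a = c" by simp
    qed
    ultimately show ?thesis by (simp add: card_image)
  qed
  obtain m where m: "m \<in> {1..N}" "r n = r' m"
    using all[OF r] all[OF r'] n by (metis (no_types, lifting) imageE imageI)
  have "n - 1 = m - 1" using count[OF r n] count[OF r' m(1)] m(2) by simp
  then have "n = m" using m(1) n by auto
  then show ?thesis using m(2) by simp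
qed

section \<open>Node quotients\<close>

text \<open>The larger of two nodes divided by their distance; see \<open>node_sep_eq\<close>. In this form it depends on the
  gap of the eigenvalues only.\<close>

definition node_sep :: "(nat \<Rightarrow> real) \<Rightarrow> real \<Rightarrow> nat \<Rightarrow> nat \<Rightarrow> real" where
  "node_sep lam \<Delta> n k = 1 / (1 - exp (- (\<bar>lam n - lam k\<bar> * \<Delta>)))"

lemma node_sep_eq:
  assumes "0 < \<Delta>" "lam n \<noteq> lam k"
  shows "max (phi lam \<Delta> n) (phi lam \<Delta> k) / \<bar>phi lam \<Delta> n - phi lam \<Delta> k\<bar> = node_sep lam \<Delta> n k"
proof -
  have *: "max (phi lam \<Delta> n) (phi lam \<Delta> k) / \<bar>phi lam \<Delta> n - phi lam \<Delta> k\<bar> = node_sep lam \<Delta> n k"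
    if "lam n < lam k" for n k
  proof -
    have le: "phi lam \<Delta> k < phi lam \<Delta> n" using that assms by (simp add: phi_def)
    have "exp (- ((lam k - lam n) * \<Delta>)) = phi lam \<Delta> k / phi lam \<Delta> n"
      by (simp add: phi_def algebra_simps flip: exp_diff)
    then have "node_sep lam \<Delta> n k = 1 / (1 - phi lam \<Delta> k / phi lam \<Delta> n)"
      using that by (simp add: node_sep_def)
    moreover have "0 < phi lam \<Delta> n" by (simp add: phi_def)
    ultimately show ?thesis using le by (simp add: field_simps)
  qed
  show ?thesis
  proof (cases "lam n < lam k")
    case False
    then have "lam k < lam n" using assms by simp
    from *[OF this] show ?thesis by (simp add: max.commute abs_minus_commute node_sep_def)
  qed (rule *)
qed

lemma phi_ratio_eq:
  assumes "0 < \<Delta>" "lam s \<noteq> lam n"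
  shows "phi lam \<Delta> s / \<bar>phi lam \<Delta> s - phi lam \<Delta> n\<bar> =
    node_sep lam \<Delta> s n * exp (- (max 0 (lam s - lam n) * \<Delta>))"
proof -
  have "phi lam \<Delta> s = max (phi lam \<Delta> s) (phi lam \<Delta> n) * exp (- (max 0 (lam s - lam n) * \<Delta>))"
  proof (cases "lam s \<le> lam n")
    case True
    then have "phi lam \<Delta> n \<le> phi lam \<Delta> s" using assms by (simp add: phi_def)
    then show ?thesis using True by simp
  next
    case False
    then have "phi lam \<Delta> s \<le> phi lam \<Delta> n" using assms by (simp add: phi_def)
    then show ?thesis using False by (simp add: phi_def algebra_simps flip: exp_add)
  qed
  then show ?thesis using node_sep_eq[OF assms] by (metis times_divide_eq_left)
qed

lemma node_sep_antimono:
  assumes "0 < x" "x \<le> \<bar>lam n - lam k\<bar> * \<Delta>"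
  shows "node_sep lam \<Delta> n k \<le> 1 / (1 - exp (- x))" "1 \<le> node_sep lam \<Delta> n k"
proof -
  show "node_sep lam \<Delta> n k \<le> 1 / (1 - exp (- x))"
    unfolding node_sep_def using assms by (intro divide_left_mono mult_pos_pos) auto
  show "1 \<le> node_sep lam \<Delta> n k"
    unfolding node_sep_def using assms by (auto simp: field_simps)
qed

lemma one_minus_exp_inverse_le:
  assumes "0 < (x :: real)" shows "1 / (1 - exp (- x)) \<le> 1 + 1 / x"
proof -
  have "1 + x \<le> exp x" by (rule exp_ge_add_one_self)
  then have "1 * (1 + x) \<le> exp x * 1" by simp
  then show ?thesis using assms by (simp add: exp_minus field_simps)
qed

lemma inverse_one_minus_le_exp:
  assumes "0 \<le> (u :: real)" "u \<le> \<beta>" "\<beta> < 1" shows "1 / (1 - u) \<le> exp (u / (1 - \<beta>))"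
proof -
  have "1 / (1 - u) = 1 + u / (1 - u)" using assms by (simp add: field_simps)
  also have "\<dots> \<le> 1 + u / (1 - \<beta>)" using assms by (intro add_left_mono divide_left_mono) auto
  also have "\<dots> \<le> exp (u / (1 - \<beta>))" by (rule exp_ge_add_one_self)
  finally show ?thesis .
qed

lemma geometric_sum_le:
  assumes "0 \<le> (\<beta> :: real)" "\<beta> < 1" "finite A" shows "(\<Sum>j\<in>A. \<beta> ^ j) \<le> 1 / (1 - \<beta>)"
proof -
  have "(\<Sum>j\<in>A. \<beta> ^ j) \<le> (\<Sum>j. \<beta> ^ j)"
    using assms by (intro sum_le_suminf summable_geometric) auto
  then show ?thesis using assms by (simp add: suminf_geometric)
qed

lemma geometric_distance_sum_le:
  assumes \<beta>: "0 \<le> (\<beta> :: real)" "\<beta> < 1"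
  shows "(\<Sum>s\<in>{1..N} - {n}. \<beta> ^ (if s < n then n - s else s - n)) \<le> 2 / (1 - \<beta>)"
proof -
  have "(\<Sum>s\<in>{1..N} - {n}. \<beta> ^ (if s < n then n - s else s - n))
    \<le> (\<Sum>s\<in>{..<n} \<union> {n<..N}. \<beta> ^ (if s < n then n - s else s - n))"
    using \<beta> by (intro sum_mono2) auto
  also have "\<dots> = (\<Sum>s\<in>{..<n}. \<beta> ^ (n - s)) + (\<Sum>s\<in>{n<..N}. \<beta> ^ (s - n))"
    by (subst sum.union_disjoint) auto
  also have "(\<Sum>s\<in>{..<n}. \<beta> ^ (n - s)) = (\<Sum>j\<in>(\<lambda>s. n - s) ` {..<n}. \<beta> ^ j)"
    by (subst sum.reindex) (auto simp: inj_on_def)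
  also have "(\<Sum>s\<in>{n<..N}. \<beta> ^ (s - n)) = (\<Sum>j\<in>(\<lambda>s. s - n) ` {n<..N}. \<beta> ^ j)"
    by (subst sum.reindex) (auto simp: inj_on_def)
  also have "(\<Sum>j\<in>(\<lambda>s. n - s) ` {..<n}. \<beta> ^ j) + (\<Sum>j\<in>(\<lambda>s. s - n) ` {n<..N}. \<beta> ^ j)
    \<le> 1 / (1 - \<beta>) + 1 / (1 - \<beta>)"
    using \<beta> by (intro add_mono geometric_sum_le) auto
  finally show ?thesis by simp
qed

lemma sum_squares_ge_cube: "(real m) ^ 3 / 3 \<le> (\<Sum>j=1..m. (real j)\<^sup>2)"
proof (induction m)
  case (Suc m)
  then show ?case by (simp add: power2_eq_square power3_eq_cube field_simps)
qed simp

text \<open>The logarithm of the left-hand side is of order \<open>N log N\<close>, that of \<open>exp (b N\<^sup>2)\<close> is of order \<open>N\<^sup>2\<close>.\<close>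

lemma poly_power_le_exp_square:
  fixes a b :: real
  assumes "0 < a" "0 < b"
  obtains C where "0 < C" "\<And>N. (1 + a * real N) ^ (2 * N) \<le> C * exp (b * (real N)\<^sup>2)"
proof -
  define f where "f = (\<lambda>N. (1 + a * real N) ^ (2 * N) / exp (b * (real N)\<^sup>2))"
  have "((\<lambda>N::nat. 2 * ln (1 + a * real N) / real N) \<longlongrightarrow> 0) sequentially"
    using assms by real_asymp
  then have "eventually (\<lambda>N::nat. 2 * ln (1 + a * real N) / real N < b) sequentially"
    using assms(2) by (rule order_tendstoD)
  then obtain N0 where N0: "\<And>N. N0 \<le> N \<Longrightarrow> 2 * ln (1 + a * real N) / real N < b"
    by (auto simp: eventually_sequentially)
  define C where "C = 1 + (\<Sum>N\<le>N0. f N)"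
  have f0: "0 \<le> f N" for N using assms by (simp add: f_def)
  have "f N \<le> C" for N
  proof (cases "N \<le> N0")
    case True
    then have "f N \<le> (\<Sum>N\<le>N0. f N)" using f0 by (intro member_le_sum) auto
    then show ?thesis by (simp add: C_def)
  next
    case False
    then have N: "0 < real N" "2 * ln (1 + a * real N) \<le> b * real N"
      using N0[of N] by (auto simp: field_simps)
    have p: "0 < 1 + a * real N" using assms by (simp add: add_pos_nonneg)
    have "(1 + a * real N) ^ (2 * N) = exp (ln (1 + a * real N)) ^ (2 * N)" using p by simp
    also have "\<dots> = exp (real (2 * N) * ln (1 + a * real N))" by (rule exp_of_nat_mult[symmetric])
    also have "\<dots> = exp (real N * (2 * ln (1 + a * real N)))" by (simp add: mult_ac)
    also have "\<dots> \<le> exp (real N * (b * real N))" using N by simp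
    finally have "f N \<le> 1" by (simp add: f_def power2_eq_square mult_ac)
    then show ?thesis using sum_nonneg[of "{..N0}" f] f0 by (simp add: C_def)
  qed
  then have "(1 + a * real N) ^ (2 * N) \<le> C * exp (b * (real N)\<^sup>2)" for N
    by (simp add: f_def field_simps)
  moreover have "0 < C" using sum_nonneg[of "{..N0}" f] f0 by (simp add: C_def add_pos_nonneg)
  ultimately show thesis using that by blast
qed

context quadratic_gap
begin

lemma lam_mono: "1 \<le> n \<Longrightarrow> n \<le> s \<Longrightarrow> lam n \<le> lam s"
proof -
  assume "1 \<le> n" "n \<le> s"
  moreover from this have "0 \<le> \<kappa> * ((real s)\<^sup>2 - (real n)\<^sup>2)" using \<kappa> by simp
  ultimately show ?thesis using gap[of n s] by simp
qed

lemma abs_gap: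
  assumes "1 \<le> n" "1 \<le> s"
  shows "\<kappa> * (\<bar>real s - real n\<bar> * (real s + real n)) \<le> \<bar>lam s - lam n\<bar>"
proof -
  have *: "\<kappa> * (\<bar>real s - real n\<bar> * (real s + real n)) \<le> \<bar>lam s - lam n\<bar>"
    if "1 \<le> n" "n \<le> s" for n s
    using gap[OF that] lam_mono[OF that] that by (simp add: power2_eq_square algebra_simps)
  show ?thesis
  proof (cases "n \<le> s")
    case False
    then have "s \<le> n" by simp
    from *[OF assms(2) this] show ?thesis by (simp add: abs_minus_commute add.commute)
  qed (rule *[OF assms(1)])
qed

lemma lam_inj:
  assumes "1 \<le> n" "1 \<le> s" "n \<noteq> s"
  shows "lam s \<noteq> lam n"
proof
  assume "lam s = lam n"
  moreover have "0 < \<kappa> * (\<bar>real s - real n\<bar> * (real s + real n))" using \<kappa> assms by simp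
  ultimately show False using abs_gap[OF assms(1,2)] by simp
qed

lemma abs_gap_one:
  assumes "1 \<le> n" "1 \<le> s" "n \<noteq> s"
  shows "\<kappa> \<le> \<bar>lam s - lam n\<bar>"
proof -
  have "1 \<le> \<bar>real s - real n\<bar>" using assms by linarith
  then have "1 * 1 \<le> \<bar>real s - real n\<bar> * (real s + real n)" using assms by (intro mult_mono) auto
  then have "\<kappa> * 1 \<le> \<kappa> * (\<bar>real s - real n\<bar> * (real s + real n))" using \<kappa> by (intro mult_left_mono) auto
  then show ?thesis using abs_gap[OF assms(1,2)] by simp
qed

lemma lam_ge: "1 \<le> n \<Longrightarrow> lam 1 + \<kappa> * ((real n)\<^sup>2 - 1) \<le> lam n"
  using gap[of 1 n] by simp

definition gap_sum :: "nat \<Rightarrow> nat \<Rightarrow> real" where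
  "gap_sum N n = (\<Sum>s\<in>{n<..N}. lam s - lam n)"

lemma gap_sum_ge_last:
  assumes "n \<in> {1..N}" shows "lam N - lam n \<le> gap_sum N n"
proof (cases "n = N")
  case False
  show ?thesis unfolding gap_sum_def
    by (rule member_le_sum) (use assms False lam_mono in auto)
qed (simp add: gap_sum_def)

text \<open>Since \<open>s\<^sup>2 - n\<^sup>2 \<ge> (s - n)\<^sup>2\<close>, the gaps above \<open>\<lambda>\<^sub>n\<close> dominate a sum of consecutive squares.\<close>

lemma gap_sum_ge_cube:
  assumes "n \<in> {1..N}" shows "\<kappa> * (real N - real n) ^ 3 / 3 \<le> gap_sum N n"
proof -
  have im: "{n<..N} = (\<lambda>j. n + j) ` {1..N - n}"
  proof (intro equalityI subsetI)
    fix s assume "s \<in> {n<..N}"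
    then show "s \<in> (\<lambda>j. n + j) ` {1..N - n}" by (intro image_eqI[of _ _ "s - n"]) auto
  qed (use assms in auto)
  have "\<kappa> * (real N - real n) ^ 3 / 3 = \<kappa> * (real (N - n) ^ 3 / 3)" using assms by simp
  also have "\<dots> \<le> \<kappa> * (\<Sum>j=1..N - n. (real j)\<^sup>2)"
    using \<kappa> sum_squares_ge_cube by (intro mult_left_mono) auto
  also have "\<dots> = (\<Sum>j=1..N - n. \<kappa> * (real j)\<^sup>2)" by (rule sum_distrib_left)
  also have "\<dots> \<le> (\<Sum>j=1..N - n. lam (n + j) - lam n)"
  proof (rule sum_mono)
    fix j assume "j \<in> {1..N - n}"
    have "\<kappa> * (real j)\<^sup>2 \<le> \<kappa> * ((real (n + j))\<^sup>2 - (real n)\<^sup>2)"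
      using \<kappa> by (intro mult_left_mono) (auto simp: power2_eq_square algebra_simps)
    also have "\<dots> \<le> lam (n + j) - lam n" using assms by (intro gap) auto
    finally show "\<kappa> * (real j)\<^sup>2 \<le> lam (n + j) - lam n" .
  qed
  also have "\<dots> = gap_sum N n" unfolding gap_sum_def im by (subst sum.reindex) auto
  finally show ?thesis .
qed

text \<open>A node \<open>\<phi>\<^sub>s\<close> with \<open>s > n\<close> is smaller than \<open>\<phi>\<^sub>n\<close> by the factor \<open>exp (- (\<lambda>\<^sub>s - \<lambda>\<^sub>n) \<Delta>)\<close>, while for \<open>s < n\<close> it is
  itself the larger node of the pair. So the factors \<open>\<phi>\<^sub>s / \<bar>\<phi>\<^sub>s - \<phi>\<^sub>n\<bar>\<close> differ from \<open>node_sep\<close> for \<open>s > n\<close>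
  only, and there the difference is exponentially small.\<close>

lemma node_quotient_eq:
  assumes \<Delta>: "0 < \<Delta>" and n: "n \<in> {1..N}"
  shows "node_quotient lam \<Delta> N n =
    (\<Prod>s\<in>{1..N} - {n}. (node_sep lam \<Delta> s n)\<^sup>2) * exp (- (2 * \<Delta> * gap_sum N n))"
proof -
  have "node_quotient lam \<Delta> N n =
    (\<Prod>s\<in>{1..N} - {n}. (phi lam \<Delta> s / \<bar>phi lam \<Delta> s - phi lam \<Delta> n\<bar>)\<^sup>2)"
    by (simp add: node_quotient_def prod_dividef power_divide)
  also have "\<dots> = (\<Prod>s\<in>{1..N} - {n}. (node_sep lam \<Delta> s n)\<^sup>2 * exp (- (2 * \<Delta> * max 0 (lam s - lam n))))"
  proof (rule prod.cong)
    fix s assume s: "s \<in> {1..N} - {n}"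
    have "lam s \<noteq> lam n" by (rule lam_inj) (use s n in auto)
    from phi_ratio_eq[of \<Delta>, OF \<Delta> this]
    show "(phi lam \<Delta> s / \<bar>phi lam \<Delta> s - phi lam \<Delta> n\<bar>)\<^sup>2 =
        (node_sep lam \<Delta> s n)\<^sup>2 * exp (- (2 * \<Delta> * max 0 (lam s - lam n)))"
      by (simp add: power_mult_distrib mult_ac flip: exp_of_nat_mult exp_double)
  qed simp
  also have "\<dots> = (\<Prod>s\<in>{1..N} - {n}. (node_sep lam \<Delta> s n)\<^sup>2)
      * exp (\<Sum>s\<in>{1..N} - {n}. - (2 * \<Delta> * max 0 (lam s - lam n)))"
    by (simp add: prod.distrib exp_sum)
  also have "(\<Sum>s\<in>{1..N} - {n}. - (2 * \<Delta> * max 0 (lam s - lam n))) = - (2 * \<Delta> * gap_sum N n)"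
  proof -
    have "(\<Sum>s\<in>{1..N} - {n}. max 0 (lam s - lam n)) = gap_sum N n"
      unfolding gap_sum_def
    proof (rule sum.mono_neutral_cong_right)
      show "{n<..N} \<subseteq> {1..N} - {n}" by auto
      show "\<forall>s\<in>{1..N} - {n} - {n<..N}. max 0 (lam s - lam n) = 0"
      proof
        fix s assume "s \<in> {1..N} - {n} - {n<..N}"
        then have "1 \<le> s" "s \<le> n" by auto
        then show "max 0 (lam s - lam n) = 0" using lam_mono[of s n] by simp
      qed
      show "max 0 (lam s - lam n) = lam s - lam n" if "s \<in> {n<..N}" for s
        using lam_mono[of n s] that n by simp
    qed simp
    then show ?thesis by (simp add: sum_negf flip: sum_distrib_left)
  qed
  finally show ?thesis .
qed

lemma node_quotient_pos:
  assumes \<Delta>: "0 < \<Delta>" and n: "n \<in> {1..N}" shows "0 < node_quotient lam \<Delta> N n"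
proof -
  have "node_sep lam \<Delta> s n \<noteq> 0" if "s \<in> {1..N} - {n}" for s
    using node_sep_antimono(2)[of "\<kappa> * \<Delta>" lam s n \<Delta>] \<Delta> \<kappa> abs_gap_one[of n s] that n by auto
  then have "0 < (\<Prod>s\<in>{1..N} - {n}. (node_sep lam \<Delta> s n)\<^sup>2)" by (intro prod_pos) auto
  then show ?thesis unfolding node_quotient_eq[OF \<Delta> n] by simp
qed

text \<open>If the exponents of the nodes are separated linearly, then with \<open>\<beta> = exp (- g)\<close> the product of the
  separations is at most \<open>\<Prod> 1 / (1 - \<beta>\<^sup>d)\<close> over the distances \<open>d = \<bar>s - n\<bar>\<close>. Every distance occurs at most twice, so
  the product is bounded uniformly in the number of nodes.\<close>

lemma node_quotient_le_separated:
  assumes \<Delta>: "0 < \<Delta>" and n: "n \<in> {1..N}" and g: "0 < g"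
    and sep: "\<And>s. s \<in> {1..N} - {n} \<Longrightarrow> g * \<bar>real s - real n\<bar> \<le> \<bar>lam s - lam n\<bar> * \<Delta>"
  shows "node_quotient lam \<Delta> N n \<le> exp (4 / (1 - exp (- g))\<^sup>2) * exp (- (2 * \<Delta> * gap_sum N n))"
proof -
  define \<beta> where "\<beta> = exp (- g)"
  have \<beta>: "0 \<le> \<beta>" "\<beta> < 1" using g by (auto simp: \<beta>_def)
  define d where "d = (\<lambda>s. if s < n then n - s else s - n)"
  have "(\<Prod>s\<in>{1..N} - {n}. (node_sep lam \<Delta> s n)\<^sup>2) \<le> (\<Prod>s\<in>{1..N} - {n}. exp (2 * (\<beta> ^ d s / (1 - \<beta>))))"
  proof (rule prod_mono)
    fix s assume s: "s \<in> {1..N} - {n}"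
    have d: "1 \<le> d s" "real (d s) = \<bar>real s - real n\<bar>" using s by (auto simp: d_def)
    have *: "0 < g * real (d s)" "g * real (d s) \<le> \<bar>lam s - lam n\<bar> * \<Delta>" using g d sep[OF s] by auto
    have e: "exp (- (g * real (d s))) = \<beta> ^ d s" by (simp add: \<beta>_def mult.commute flip: exp_of_nat_mult)
    have "node_sep lam \<Delta> s n \<le> 1 / (1 - \<beta> ^ d s)"
      using node_sep_antimono(1)[OF *] by (simp add: e)
    also have "\<dots> \<le> exp (\<beta> ^ d s / (1 - \<beta>))"
    proof (rule inverse_one_minus_le_exp)
      show "\<beta> ^ d s \<le> \<beta>" using power_decreasing[OF d(1), of \<beta>] \<beta> by simp
    qed (use \<beta> in auto)
    finally have "(node_sep lam \<Delta> s n)\<^sup>2 \<le> (exp (\<beta> ^ d s / (1 - \<beta>)))\<^sup>2"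
      using node_sep_antimono(2)[OF *] by (intro power_mono) auto
    then show "0 \<le> (node_sep lam \<Delta> s n)\<^sup>2 \<and> (node_sep lam \<Delta> s n)\<^sup>2 \<le> exp (2 * (\<beta> ^ d s / (1 - \<beta>)))"
      unfolding exp_double by simp
  qed
  also have "\<dots> = exp (2 / (1 - \<beta>) * (\<Sum>s\<in>{1..N} - {n}. \<beta> ^ d s))"
    by (simp add: exp_sum sum_distrib_left)
  also have "\<dots> \<le> exp (2 / (1 - \<beta>) * (2 / (1 - \<beta>)))"
    unfolding d_def exp_le_cancel_iff
    by (intro mult_left_mono geometric_distance_sum_le \<beta>) (use \<beta> in auto)
  also have "2 / (1 - \<beta>) * (2 / (1 - \<beta>)) = 4 / (1 - \<beta>)\<^sup>2" by (simp add: power2_eq_square)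
  finally show ?thesis
    unfolding node_quotient_eq[OF \<Delta> n] \<beta>_def by (intro mult_right_mono) auto
qed

lemma node_sep_le_crude:
  assumes \<Delta>: "0 < \<Delta>" and "1 \<le> n" "1 \<le> s" "n \<noteq> s"
  shows "node_sep lam \<Delta> s n \<le> 1 + 1 / (\<kappa> * \<Delta>)" "1 \<le> node_sep lam \<Delta> s n"
proof -
  have *: "0 < \<kappa> * \<Delta>" "\<kappa> * \<Delta> \<le> \<bar>lam s - lam n\<bar> * \<Delta>"
    using \<kappa> \<Delta> abs_gap_one[OF assms(2-4)] by auto
  show "node_sep lam \<Delta> s n \<le> 1 + 1 / (\<kappa> * \<Delta>)"
    using node_sep_antimono(1)[OF *] one_minus_exp_inverse_le[OF *(1)] by simp
  show "1 \<le> node_sep lam \<Delta> s n" by (rule node_sep_antimono(2)[OF *])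
qed

text \<open>For nodes that may nearly coincide: the bound on each separation uses only that every gap is at least \<open>\<kappa>\<close>.\<close>

lemma node_quotient_le_crude:
  assumes \<Delta>: "0 < \<Delta>" and n: "n \<in> {1..N}"
  shows "node_quotient lam \<Delta> N n \<le> (1 + 1 / (\<kappa> * \<Delta>)) ^ (2 * N - 2) * exp (- (2 * \<Delta> * gap_sum N n))"
proof -
  have "(\<Prod>s\<in>{1..N} - {n}. (node_sep lam \<Delta> s n)\<^sup>2) \<le> (\<Prod>s\<in>{1..N} - {n}. (1 + 1 / (\<kappa> * \<Delta>))\<^sup>2)"
    using node_sep_le_crude[OF \<Delta>, of n] n by (intro prod_mono conjI power_mono) force+
  also have "\<dots> = (1 + 1 / (\<kappa> * \<Delta>)) ^ (2 * N - 2)"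
    using n by (simp add: power_mult[symmetric] right_diff_distrib')
  finally show ?thesis unfolding node_quotient_eq[OF \<Delta> n] by (intro mult_right_mono) auto
qed

end

section \<open>Error bounds for the Prony roots\<close>

lemma abs_ln_le_twice:
  assumes "\<bar>t - 1\<bar> \<le> (1 / 2 :: real)" shows "\<bar>ln t\<bar> \<le> 2 * \<bar>t - 1\<bar>"
proof -
  have t: "1 / 2 \<le> t" using assms by linarith
  define a where "a = \<bar>t - 1\<bar>"
  have a: "t - 1 \<le> a" "1 - t \<le> a" "0 \<le> a" by (simp_all add: a_def abs_if)
  have 1: "ln t \<le> t - 1" using t by (intro ln_le_minus_one) auto
  have "- ln t = ln (1 / t)" using t by (simp add: ln_div)
  also have "\<dots> \<le> 1 / t - 1" using t by (intro ln_le_minus_one) auto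
  also have "1 / t - 1 = (1 - t) / t" using t by (simp add: field_simps)
  also have "\<dots> \<le> a / (1 / 2)" using t a by (intro frac_le) auto
  finally have "- ln t \<le> 2 * a" by simp
  moreover have "ln t \<le> 2 * a" using 1 a by linarith
  ultimately show ?thesis unfolding a_def by (intro abs_leI)
qed

lemma lam_est_error:
  assumes \<Delta>: "0 < \<Delta>" and r: "\<bar>r n - phi lam \<Delta> n\<bar> \<le> e * phi lam \<Delta> n" and e: "e \<le> 1 / 2"
  shows "\<bar>lam_est \<Delta> r n - lam n\<bar> \<le> 2 * e / \<Delta>"
proof -
  let ?\<phi> = "phi lam \<Delta> n"
  have \<phi>: "0 < ?\<phi>" "ln ?\<phi> = - lam n * \<Delta>" by (simp_all add: phi_def)
  have "r n / ?\<phi> - 1 = (r n - ?\<phi>) / ?\<phi>" using \<phi>(1) by (simp add: diff_divide_distrib)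
  then have "\<bar>r n / ?\<phi> - 1\<bar> = \<bar>r n - ?\<phi>\<bar> / ?\<phi>" using \<phi>(1) by (simp add: abs_divide)
  also have "\<dots> \<le> e" using r \<phi>(1) by (simp add: field_simps)
  finally have t: "\<bar>r n / ?\<phi> - 1\<bar> \<le> e" .
  have "0 < r n / ?\<phi>" using t e by linarith
  then have r0: "0 < r n" using \<phi>(1) by (simp add: zero_less_divide_iff)
  have "lam_est \<Delta> r n - lam n = - (ln (r n) - ln ?\<phi>) / \<Delta>"
    using \<Delta> by (simp add: lam_est_def \<phi>(2) field_simps)
  also have "ln (r n) - ln ?\<phi> = ln (r n / ?\<phi>)" using r0 \<phi>(1) by (simp add: ln_div)
  finally have "\<bar>lam_est \<Delta> r n - lam n\<bar> = \<bar>ln (r n / ?\<phi>)\<bar> / \<Delta>" using \<Delta> by simp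
  also have "\<dots> \<le> (2 * e) / \<Delta>"
    using abs_ln_le_twice[of "r n / ?\<phi>"] t e \<Delta> by (intro divide_right_mono) auto
  finally show ?thesis .
qed

context quadratic_gap
begin

lemma phi_decreasing:
  assumes "0 < \<Delta>" "1 \<le> i" "i < j" shows "phi lam \<Delta> j < phi lam \<Delta> i"
  using lam_mono[of i j] lam_inj[of i j] assms by (simp add: phi_def)

text \<open>The link between the perturbation result and the Prony polynomial. Its coefficients satisfy
  \<open>\<bar>b\<^sub>k\<bar> \<le> M\<^sub>y Q\<^sub>k\<close> because \<open>0 < \<phi>\<^bsub>N+1\<^esub> < \<phi>\<^sub>i\<close>. The threshold for \<open>\<epsilon>\<close> makes the relative errors at most \<open>\<tau> < 1/2\<close>,
  so that taking logarithms at most doubles them.\<close>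

lemma prony_error_bounds_if_summable:
  assumes N: "1 \<le> N" and \<Delta>: "0 < \<Delta>" and l: "1 < l" and My: "0 < My" and \<tau>: "0 < \<tau>" "\<tau> < 1 / 2"
    and B: "0 < B"
    and B1: "\<And>n. n \<in> {1..N} \<Longrightarrow> node_quotient lam \<Delta> N n \<le> B"
    and B2: "\<And>n. n \<in> {1..N} \<Longrightarrow>
      (\<Sum>k\<in>{1..N} - {n}. node_quotient lam \<Delta> N k * node_sep lam \<Delta> n k) \<le> B"
  shows "prony_error_bounds lam l My \<tau> (min \<tau> (1 / 6) / (6 * My * B)) (6 * My) (12 * My) N \<Delta>"
proof -
  let ?\<phi> = "phi lam \<Delta>" and ?Q = "node_quotient lam \<Delta> N"
  have \<phi>0: "0 < ?\<phi> n" for n by (simp add: phi_def)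
  have Q0: "0 < ?Q k" if "k \<in> {1..N}" for k by (rule node_quotient_pos[OF \<Delta> that])
  have anti: "?\<phi> j < ?\<phi> i" if "1 \<le> i" "i < j" for i j by (rule phi_decreasing[OF \<Delta> that])
  have inj: "inj_on ?\<phi> {1..Suc N}"
  proof (rule inj_onI)
    fix i j assume "i \<in> {1..Suc N}" "j \<in> {1..Suc N}" "?\<phi> i = ?\<phi> j"
    then show "i = j" using anti[of i j] anti[of j i] by (cases i j rule: linorder_cases) auto
  qed
  have B2': "(\<Sum>k\<in>{1..N} - {n}. ?Q k * (max (?\<phi> n) (?\<phi> k) / \<bar>?\<phi> n - ?\<phi> k\<bar>)) \<le> B"
    if n: "n \<in> {1..N}" for n
  proof -
    have "(\<Sum>k\<in>{1..N} - {n}. ?Q k * (max (?\<phi> n) (?\<phi> k) / \<bar>?\<phi> n - ?\<phi> k\<bar>))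
      = (\<Sum>k\<in>{1..N} - {n}. ?Q k * node_sep lam \<Delta> n k)"
    proof (rule sum.cong)
      fix k assume k: "k \<in> {1..N} - {n}"
      have "lam n \<noteq> lam k" by (rule lam_inj) (use k n in auto)
      then show "?Q k * (max (?\<phi> n) (?\<phi> k) / \<bar>?\<phi> n - ?\<phi> k\<bar>) = ?Q k * node_sep lam \<Delta> n k"
        using node_sep_eq[of \<Delta> lam n k] \<Delta> by simp
    qed simp
    then show ?thesis using B2[OF n] by simp
  qed
  show ?thesis unfolding prony_error_bounds_def
  proof (intro allI impI, elim conjE)
    fix y \<epsilon> assume y: "amplitudes l My N y" and e: "0 \<le> \<epsilon>" "\<epsilon> \<le> min \<tau> (1 / 6) / (6 * My * B)"
    have eB: "\<epsilon> * (6 * My * B) \<le> \<tau>" "\<epsilon> * (6 * My * B) \<le> 1 / 6"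
      using e(2) My B by (auto simp: field_simps)
    have y0: "y k \<noteq> 0" if "k \<in> {1..N}" for k
    proof
      assume "y k = 0"
      then have "1 / l \<le> 0" using y that by (force simp: amplitudes_def)
      then show False using l by (simp add: divide_le_0_iff)
    qed
    define b where "b k = y (Suc N) / y k *
      (\<Prod>i\<in>{1..N} - {k}. ((?\<phi> i - ?\<phi> (Suc N)) / (?\<phi> i - ?\<phi> k))\<^sup>2)" for k
    obtain C where C: "C \<noteq> 0" "\<forall>z. poly (prony_poly lam \<Delta> N y \<epsilon>) z =
      C * ((\<Prod>i\<in>{1..N}. ?\<phi> i - z) + \<epsilon> * (?\<phi> (Suc N) - z) * (\<Sum>k\<in>{1..N}. b k * (\<Prod>i\<in>{1..N} - {k}. ?\<phi> i - z)))"
      using prony_poly_factored[where b = b and \<epsilon> = \<epsilon>, OF inj y0 b_def] .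
    have b: "\<bar>b k\<bar> \<le> My * ?Q k" if k: "k \<in> {1..N}" for k
    proof -
      have "(\<Prod>i\<in>{1..N} - {k}. ((?\<phi> i - ?\<phi> (Suc N)) / (?\<phi> i - ?\<phi> k))\<^sup>2) \<le>
        (\<Prod>i\<in>{1..N} - {k}. (?\<phi> i)\<^sup>2 / \<bar>?\<phi> i - ?\<phi> k\<bar>\<^sup>2)"
      proof (rule prod_mono, intro conjI)
        fix i assume i: "i \<in> {1..N} - {k}"
        have "(?\<phi> i - ?\<phi> (Suc N))\<^sup>2 \<le> (?\<phi> i)\<^sup>2"
          using anti[of i "Suc N"] i \<phi>0[of "Suc N"] by (intro power_mono) auto
        then show "((?\<phi> i - ?\<phi> (Suc N)) / (?\<phi> i - ?\<phi> k))\<^sup>2 \<le> (?\<phi> i)\<^sup>2 / \<bar>?\<phi> i - ?\<phi> k\<bar>\<^sup>2"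
          by (simp add: power_divide divide_right_mono)
      qed simp
      moreover have "\<bar>y (Suc N) / y k\<bar> \<le> My" using y k by (auto simp: amplitudes_def abs_divide)
      moreover have "0 \<le> (\<Prod>i\<in>{1..N} - {k}. ((?\<phi> i - ?\<phi> (Suc N)) / (?\<phi> i - ?\<phi> k))\<^sup>2)"
        by (rule prod_nonneg) simp
      ultimately show ?thesis unfolding b_def abs_mult node_quotient_def
        by (intro mult_mono) (use My in \<open>auto simp: prod_dividef\<close>)
    qed
    have "\<exists>r. (\<forall>n\<in>{1..N}. (\<Prod>i\<in>{1..N}. ?\<phi> i - r n) + \<epsilon> * (?\<phi> (Suc N) - r n) *
         (\<Sum>k\<in>{1..N}. b k * (\<Prod>i\<in>{1..N} - {k}. ?\<phi> i - r n)) = 0 \<and>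
        \<bar>r n - ?\<phi> n\<bar> \<le> \<epsilon> * (6 * My) * (?\<phi> n * ?Q n)) \<and> strict_antimono_on {1..N} r"
      by (rule perturbed_product_roots[where B = B]) (use anti \<phi>0 b Q0 My B1 B2' e eB in auto)
    then obtain r where r': "\<forall>n\<in>{1..N}. (\<Prod>i\<in>{1..N}. ?\<phi> i - r n) + \<epsilon> * (?\<phi> (Suc N) - r n) *
         (\<Sum>k\<in>{1..N}. b k * (\<Prod>i\<in>{1..N} - {k}. ?\<phi> i - r n)) = 0 \<and>
        \<bar>r n - ?\<phi> n\<bar> \<le> \<epsilon> * (6 * My) * (?\<phi> n * ?Q n)" "strict_antimono_on {1..N} r" by blast
    have r: "\<And>n. n \<in> {1..N} \<Longrightarrow> poly (prony_poly lam \<Delta> N y \<epsilon>) (r n) = 0"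
      "\<And>n. n \<in> {1..N} \<Longrightarrow> \<bar>r n - ?\<phi> n\<bar> \<le> \<epsilon> * (6 * My) * (?\<phi> n * ?Q n)"
      "strict_antimono_on {1..N} r"
      unfolding C(2)[rule_format] using r' by simp_all
    have small: "\<epsilon> * (6 * My) * ?Q n \<le> \<tau>" if n: "n \<in> {1..N}" for n
    proof -
      have "\<epsilon> * (6 * My) * ?Q n \<le> \<epsilon> * (6 * My) * B"
        using B1[OF n] e My by (intro mult_left_mono) auto
      also have "\<dots> = \<epsilon> * (6 * My * B)" by simp
      also have "\<dots> \<le> \<tau>" by (rule eB(1))
      finally show ?thesis .
    qed
    have "prony_roots lam \<tau> \<Delta> N y \<epsilon> r"
      unfolding prony_roots_def
    proof (intro conjI ballI)
      fix n assume n: "n \<in> {1..N}"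
      have "\<epsilon> * (6 * My) * ?Q n * ?\<phi> n \<le> \<tau> * ?\<phi> n"
        using small[OF n] \<phi>0[of n] by (intro mult_right_mono) auto
      then show "\<bar>r n - ?\<phi> n\<bar> \<le> \<tau> * ?\<phi> n" using r(2)[OF n] by (simp add: mult_ac)
    qed (use r in auto)
    moreover have "\<bar>s n - ?\<phi> n\<bar> \<le> \<epsilon> * (6 * My) * (?\<phi> n * ?Q n)"
      "\<bar>lam_est \<Delta> s n - lam n\<bar> \<le> \<epsilon> * (12 * My) * (1 / \<Delta>) * ?Q n"
      if s: "prony_roots lam \<tau> \<Delta> N y \<epsilon> s" and n: "n \<in> {1..N}" for s n
    proof -
      \<comment> \<open>At the noise node the perturbation vanishes, so the polynomial is not zero there.\<close>
      have "(\<Prod>i\<in>{1..N}. ?\<phi> i - ?\<phi> (Suc N)) \<noteq> 0" using anti[of _ "Suc N"] by fastforce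
      then have "poly (prony_poly lam \<Delta> N y \<epsilon>) (?\<phi> (Suc N)) \<noteq> 0" using C(1) unfolding C(2)[rule_format] by simp
      then have nz: "prony_poly lam \<Delta> N y \<epsilon> \<noteq> 0" by auto
      have "s n = r n"
        by (rule ordered_roots_unique[OF nz degree_prony_poly])
          (use s r n in \<open>auto simp: prony_roots_def\<close>)
      then show 1: "\<bar>s n - ?\<phi> n\<bar> \<le> \<epsilon> * (6 * My) * (?\<phi> n * ?Q n)" using r(2)[OF n] by simp
      have "\<bar>lam_est \<Delta> s n - lam n\<bar> \<le> 2 * (\<epsilon> * (6 * My) * ?Q n) / \<Delta>"
        by (rule lam_est_error[OF \<Delta>]) (use 1 small[OF n] \<tau> in \<open>auto simp: mult_ac\<close>)
      then show "\<bar>lam_est \<Delta> s n - lam n\<bar> \<le> \<epsilon> * (12 * My) * (1 / \<Delta>) * ?Q n" by (simp add: mult_ac)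
    qed
    ultimately show "(\<exists>r. prony_roots lam \<tau> \<Delta> N y \<epsilon> r) \<and>
        (\<forall>r. prony_roots lam \<tau> \<Delta> N y \<epsilon> r \<longrightarrow> (\<forall>n\<in>{1..N}.
             \<bar>r n - ?\<phi> n\<bar> \<le> \<epsilon> * (6 * My) * (?\<phi> n * ?Q n) \<and>
             \<bar>lam_est \<Delta> r n - lam n\<bar> \<le> \<epsilon> * (12 * My) * (1 / \<Delta>) * ?Q n))" by blast
  qed
qed

text \<open>Geometric decay in \<open>N - k\<close> makes the sums over \<open>k\<close> bounded. It also bounds the single node quotients,
  as separations are at least 1; for \<open>N = 1\<close> the quotient is an empty product.\<close>

lemma prony_error_bounds_if_decay:
  assumes N: "1 \<le> N" and \<Delta>: "0 < \<Delta>" and l: "1 < l" and My: "0 < My" and \<tau>: "0 < \<tau>" "\<tau> < 1 / 2"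
    and C: "0 < C" and \<rho>: "0 \<le> \<rho>" "\<rho> < 1"
    and decay: "\<And>k n. k \<in> {1..N} \<Longrightarrow> n \<in> {1..N} - {k} \<Longrightarrow>
      node_quotient lam \<Delta> N k * node_sep lam \<Delta> n k \<le> C * \<rho> ^ (N - k)"
  shows "prony_error_bounds lam l My \<tau> (min \<tau> (1 / 6) / (6 * My * (1 + C / (1 - \<rho>)))) (6 * My) (12 * My) N \<Delta>"
proof (rule prony_error_bounds_if_summable[OF N \<Delta> l My \<tau>])
  let ?B = "1 + C / (1 - \<rho>)"
  have C': "0 < C / (1 - \<rho>)" "C \<le> C / (1 - \<rho>)" using C \<rho> by (auto simp: field_simps)
  then show "0 < ?B" by simp
  fix n assume n: "n \<in> {1..N}"
  show "node_quotient lam \<Delta> N n \<le> ?B"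
  proof (cases "N = 1")
    case True
    then have "{1..N} - {n} = {}" using n by auto
    then show ?thesis using C' unfolding node_quotient_def by (simp only:) simp
  next
    case False
    then have "\<exists>k. k \<in> {1..N} - {n}" using n N by (intro exI[of _ "if n = 1 then 2 else 1"]) auto
    then obtain k where k: "k \<in> {1..N} - {n}" by blast
    have "node_quotient lam \<Delta> N n * 1 \<le> node_quotient lam \<Delta> N n * node_sep lam \<Delta> k n"
      using node_sep_le_crude(2)[OF \<Delta>, of n k] k n node_quotient_pos[OF \<Delta> n]
      by (intro mult_left_mono) auto
    also have "\<dots> \<le> C * \<rho> ^ (N - n)" by (rule decay[OF n k])
    also have "\<dots> \<le> C * 1" using C \<rho> by (intro mult_left_mono power_le_one) auto
    finally show ?thesis using C' by simp
  qed
  have "(\<Sum>k\<in>{1..N} - {n}. node_quotient lam \<Delta> N k * node_sep lam \<Delta> n k)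
    \<le> (\<Sum>k\<in>{1..N} - {n}. C * \<rho> ^ (N - k))"
    by (rule sum_mono) (use decay n in auto)
  also have "\<dots> = C * (\<Sum>j\<in>(\<lambda>k. N - k) ` ({1..N} - {n}). \<rho> ^ j)"
    by (subst sum.reindex) (auto simp: inj_on_def sum_distrib_left)
  also have "\<dots> \<le> C * (1 / (1 - \<rho>))"
    using C \<rho> by (intro mult_left_mono geometric_sum_le) auto
  finally show "(\<Sum>k\<in>{1..N} - {n}. node_quotient lam \<Delta> N k * node_sep lam \<Delta> n k) \<le> ?B" by simp
qed

lemma outcome_error:
  assumes eb: "prony_error_bounds lam l My \<tau> \<epsilon>s Dphi Dlam N \<Delta>"
    and r: "prony_outcome lam l My \<tau> \<epsilon>s N \<Delta> \<epsilon> r" and n: "n \<in> {1..N}" and D: "0 < Dphi" "0 < Dlam" "0 < \<Delta>"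
  shows "phi lam \<Delta> n * node_quotient lam \<Delta> N n \<le> A * E \<Longrightarrow> \<bar>r n - phi lam \<Delta> n\<bar> \<le> \<epsilon> * (Dphi * A) * E"
    and "node_quotient lam \<Delta> N n \<le> A * E \<Longrightarrow> \<bar>lam_est \<Delta> r n - lam n\<bar> \<le> \<epsilon> * (Dlam * A / \<Delta>) * E"
    and "node_quotient lam \<Delta> N n \<le> A * E \<Longrightarrow> 0 < \<epsilon> \<Longrightarrow> prony_cond lam \<Delta> \<epsilon> r n \<le> Dlam * A * (1 / \<Delta>) * E"
proof -
  have e: "0 \<le> \<epsilon>" using r by (auto simp: prony_outcome_def)
  have b: "\<bar>r n - phi lam \<Delta> n\<bar> \<le> \<epsilon> * Dphi * (phi lam \<Delta> n * node_quotient lam \<Delta> N n)"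
    "\<bar>lam_est \<Delta> r n - lam n\<bar> \<le> \<epsilon> * Dlam * (1 / \<Delta>) * node_quotient lam \<Delta> N n"
    using eb r n unfolding prony_error_bounds_def prony_outcome_def by blast+
  show "\<bar>r n - phi lam \<Delta> n\<bar> \<le> \<epsilon> * (Dphi * A) * E"
    if "phi lam \<Delta> n * node_quotient lam \<Delta> N n \<le> A * E"
  proof -
    have "\<epsilon> * Dphi * (phi lam \<Delta> n * node_quotient lam \<Delta> N n) \<le> \<epsilon> * Dphi * (A * E)"
      by (rule mult_left_mono[OF that]) (use e D in simp)
    then show ?thesis using b(1) by (simp add: mult.assoc)
  qed
  show 2: "\<bar>lam_est \<Delta> r n - lam n\<bar> \<le> \<epsilon> * (Dlam * A / \<Delta>) * E"
    if "node_quotient lam \<Delta> N n \<le> A * E"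
  proof -
    have "\<epsilon> * Dlam * (1 / \<Delta>) * node_quotient lam \<Delta> N n \<le> \<epsilon> * Dlam * (1 / \<Delta>) * (A * E)"
      by (rule mult_left_mono[OF that]) (use e D in simp)
    then show ?thesis using b(2) by simp
  qed
  show "prony_cond lam \<Delta> \<epsilon> r n \<le> Dlam * A * (1 / \<Delta>) * E"
    if "node_quotient lam \<Delta> N n \<le> A * E" "0 < \<epsilon>"
    unfolding prony_cond_def using 2[OF that(1)] that(2) by (simp add: field_simps)
qed

section \<open>Step sizes bounded from below\<close>

lemma node_quotient_le_fixed_step:
  assumes \<Delta>s: "0 < \<Delta>s" "\<Delta>s \<le> \<Delta>" and n: "n \<in> {1..N}"
  shows "node_quotient lam \<Delta> N n \<le> exp (4 / (1 - exp (- (\<kappa> * \<Delta>s)))\<^sup>2) * exp (- (2 * \<Delta> * gap_sum N n))"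
proof (rule node_quotient_le_separated[OF _ n])
  fix s assume s: "s \<in> {1..N} - {n}"
  have "\<kappa> * \<bar>real s - real n\<bar> \<le> \<kappa> * (\<bar>real s - real n\<bar> * (real s + real n))"
    using \<kappa> n by (intro mult_left_mono) (auto simp: mult_le_cancel_left1)
  also have "\<dots> \<le> \<bar>lam s - lam n\<bar>" using s n by (intro abs_gap) auto
  finally have "\<kappa> * \<bar>real s - real n\<bar> * \<Delta>s \<le> \<bar>lam s - lam n\<bar> * \<Delta>"
    using \<Delta>s \<kappa> by (intro mult_mono) auto
  then show "\<kappa> * \<Delta>s * \<bar>real s - real n\<bar> \<le> \<bar>lam s - lam n\<bar> * \<Delta>" by (simp add: mult_ac)
qed (use \<Delta>s \<kappa> in auto)

lemma gap_last_ge: 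
  assumes "k \<in> {1..N}"
  shows "\<kappa> * (real (N - k) * real N) \<le> lam N - lam k"
proof -
  have "\<kappa> * (real (N - k) * real N) \<le> \<kappa> * ((real N)\<^sup>2 - (real k)\<^sup>2)"
    using \<kappa> assms by (intro mult_left_mono) (auto simp: power2_eq_square of_nat_diff algebra_simps mult_right_mono)
  also have "\<dots> \<le> lam N - lam k" using assms by (intro gap) auto
  finally show ?thesis .
qed

text \<open>The last summand \<open>\<lambda>\<^sub>N - \<lambda>\<^sub>k \<ge> \<kappa> (N - k)\<close> of the gap sum is enough for the geometric decay.\<close>

lemma error_bounds_fixed_step:
  assumes \<Delta>s: "0 < \<Delta>s" and l: "1 < l" and My: "0 < My" and \<tau>: "0 < \<tau>" "\<tau> < 1 / 2"
  obtains \<epsilon>s where "0 < \<epsilon>s"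
    "\<forall>N\<ge>1. \<forall>\<Delta>\<ge>\<Delta>s. prony_error_bounds lam l My \<tau> \<epsilon>s (6 * My) (12 * My) N \<Delta>"
proof -
  define g where "g = \<kappa> * \<Delta>s"
  have g: "0 < g" using \<Delta>s \<kappa> by (simp add: g_def)
  define C where "C = exp (4 / (1 - exp (- g))\<^sup>2) * (1 / (1 - exp (- g)))"
  define \<rho> where "\<rho> = exp (- (2 * g))"
  have C: "0 < C" using g by (simp add: C_def)
  have \<rho>: "0 \<le> \<rho>" "\<rho> < 1" using g by (auto simp: \<rho>_def)
  have "prony_error_bounds lam l My \<tau> (min \<tau> (1 / 6) / (6 * My * (1 + C / (1 - \<rho>)))) (6 * My) (12 * My) N \<Delta>"
    if N: "1 \<le> N" and \<Delta>: "\<Delta>s \<le> \<Delta>" for N \<Delta>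
  proof (rule prony_error_bounds_if_decay[OF N _ l My \<tau> C \<rho>])
    show \<Delta>0: "0 < \<Delta>" using \<Delta>s \<Delta> by simp
    fix k n assume k: "k \<in> {1..N}" and n: "n \<in> {1..N} - {k}"
    have "\<kappa> \<le> \<bar>lam n - lam k\<bar>" by (rule abs_gap_one) (use k n in auto)
    then have "g \<le> \<bar>lam n - lam k\<bar> * \<Delta>" unfolding g_def using \<Delta> \<Delta>s \<kappa> by (intro mult_mono) auto
    note sep = node_sep_antimono[OF g this]
    have "node_quotient lam \<Delta> N k \<le> exp (4 / (1 - exp (- g))\<^sup>2) * exp (- (2 * \<Delta> * gap_sum N k))"
      unfolding g_def by (rule node_quotient_le_fixed_step[OF \<Delta>s \<Delta> k])
    also have "\<dots> \<le> exp (4 / (1 - exp (- g))\<^sup>2) * \<rho> ^ (N - k)"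
    proof -
      have "\<kappa> * real (N - k) \<le> \<kappa> * (real (N - k) * real N)"
        using \<kappa> N by (intro mult_left_mono) (auto simp: mult_le_cancel_left1)
      also have "\<dots> \<le> gap_sum N k" using gap_last_ge[OF k] gap_sum_ge_last[OF k] by simp
      finally have "\<Delta>s * (\<kappa> * real (N - k)) \<le> \<Delta> * gap_sum N k"
        using \<Delta> \<Delta>s \<kappa> by (intro mult_mono) auto
      then have "exp (- (2 * \<Delta> * gap_sum N k)) \<le> exp (real (N - k) * (- (2 * g)))"
        by (simp add: g_def mult_ac)
      also have "\<dots> = \<rho> ^ (N - k)" unfolding \<rho>_def by (rule exp_of_nat_mult)
      finally show ?thesis by (intro mult_left_mono) auto
    qed
    finally have "node_quotient lam \<Delta> N k * node_sep lam \<Delta> n k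
      \<le> (exp (4 / (1 - exp (- g))\<^sup>2) * \<rho> ^ (N - k)) * (1 / (1 - exp (- g)))"
      using sep \<rho> by (intro mult_mono) auto
    then show "node_quotient lam \<Delta> N k * node_sep lam \<Delta> n k \<le> C * \<rho> ^ (N - k)"
      by (simp add: C_def mult_ac)
  qed
  moreover have "0 < min \<tau> (1 / 6) / (6 * My * (1 + C / (1 - \<rho>)))"
    using \<tau> My C \<rho> by (intro divide_pos_pos mult_pos_pos add_pos_nonneg) auto
  ultimately show thesis using that by blast
qed

end

context quadratic_gap
begin

section \<open>Step sizes inversely proportional to the number of nodes\<close>

text \<open>For \<open>k \<ge> N/2\<close> the sum \<open>s + k\<close> in \<open>\<bar>s\<^sup>2 - k\<^sup>2\<bar>\<close> compensates the step size \<open>T/N\<close>.\<close>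

lemma linear_gap_upper_half:
  assumes T: "0 < T" and N: "1 \<le> N" and k: "k \<in> {1..N}" "N \<le> 2 * k" and s: "s \<in> {1..N}"
  shows "\<kappa> * T / 2 * \<bar>real s - real k\<bar> \<le> \<bar>lam s - lam k\<bar> * (T / real N)"
proof -
  have "real N \<le> 2 * (real s + real k)"
    using of_nat_mono[OF k(2), where 'a = real] by simp
  then have "\<bar>real s - real k\<bar> * real N \<le> \<bar>real s - real k\<bar> * (2 * (real s + real k))"
    by (intro mult_left_mono) auto
  then have "\<kappa> * (\<bar>real s - real k\<bar> * real N) \<le> \<kappa> * (\<bar>real s - real k\<bar> * (2 * (real s + real k)))"
    by (rule mult_left_mono) (use \<kappa> in simp)
  also have "\<dots> = 2 * (\<kappa> * (\<bar>real s - real k\<bar> * (real s + real k)))" by simp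
  also have "\<dots> \<le> 2 * \<bar>lam s - lam k\<bar>" using abs_gap[of k s] k s by simp
  finally have "T * (\<kappa> * (\<bar>real s - real k\<bar> * real N)) \<le> T * (2 * \<bar>lam s - lam k\<bar>)"
    by (rule mult_left_mono) (use T in simp)
  then show ?thesis using N by (simp add: field_simps)
qed

lemma node_quotient_le_upper_half:
  assumes T: "0 < T" and N: "1 \<le> N" and k: "k \<in> {1..N}" "N \<le> 2 * k"
  shows "node_quotient lam (T / real N) N k \<le>
    exp (4 / (1 - exp (- (\<kappa> * T / 2)))\<^sup>2) * exp (- (2 * (T / real N) * gap_sum N k))"
  by (rule node_quotient_le_separated[OF _ k(1)])
    (use T N \<kappa> linear_gap_upper_half[OF T N k] in auto)

lemma gap_last_scaled:
  assumes T: "0 < T" and N: "1 \<le> N" and k: "k \<in> {1..N}"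
  shows "2 * \<kappa> * T * real (N - k) \<le> 2 * (T / real N) * gap_sum N k"
proof -
  have "\<kappa> * (real (N - k) * real N) \<le> gap_sum N k"
    using gap_last_ge[OF k] gap_sum_ge_last[OF k] by simp
  then have "2 * (T / real N) * (\<kappa> * (real (N - k) * real N)) \<le> 2 * (T / real N) * gap_sum N k"
    using T by (intro mult_left_mono) auto
  then show ?thesis using N by (simp add: field_simps)
qed

text \<open>If \<open>N - k\<close> is a fixed fraction of \<open>N\<close>, the gap sum is of order \<open>N\<^sup>3\<close>, which gives decay of order
  \<open>exp (-2 b N\<^sup>2)\<close>. One half of the exponent absorbs the crude bound for the product of separations.\<close>

lemma node_quotient_le_away:
  assumes T: "0 < T" and \<gamma>: "0 < \<gamma>"
  obtains C b where "0 < C" "0 < b"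
    "\<forall>N. \<forall>k\<in>{1..N}. \<gamma> * real N \<le> real N - real k \<longrightarrow>
       node_quotient lam (T / real N) N k \<le> C * exp (- (b * (real N)\<^sup>2)) \<and>
       (\<forall>n\<in>{1..N} - {k}. node_quotient lam (T / real N) N k * node_sep lam (T / real N) n k
          \<le> C * exp (- (b * (real N)\<^sup>2)))"
proof -
  define b where "b = \<kappa> * T * \<gamma> ^ 3 / 3"
  have b: "0 < b" using \<kappa> T \<gamma> by (simp add: b_def)
  define a where "a = 1 / (\<kappa> * T)"
  have a: "0 < a" using \<kappa> T by (simp add: a_def)
  obtain C where C: "0 < C" "\<And>N. (1 + a * real N) ^ (2 * N) \<le> C * exp (b * (real N)\<^sup>2)"
    using poly_power_le_exp_square[OF a b] by blast
  have main: "(1 + a * real N) ^ m * exp (- (2 * (T / real N) * gap_sum N k)) \<le> C * exp (- (b * (real N)\<^sup>2))"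
    if k: "k \<in> {1..N}" "\<gamma> * real N \<le> real N - real k" and m: "m \<le> 2 * N" for N k m
  proof -
    have N: "1 \<le> N" using k by simp
    have "(\<gamma> * real N) ^ 3 \<le> (real N - real k) ^ 3"
      using \<gamma> k(2) by (intro power_mono) auto
    then have "\<kappa> * (\<gamma> * real N) ^ 3 \<le> \<kappa> * (real N - real k) ^ 3"
      using \<kappa> by (intro mult_left_mono) auto
    then have "\<kappa> * (\<gamma> * real N) ^ 3 / 3 \<le> gap_sum N k"
      using gap_sum_ge_cube[OF k(1)] by simp
    then have "2 * (T / real N) * (\<kappa> * (\<gamma> * real N) ^ 3 / 3) \<le> 2 * (T / real N) * gap_sum N k"
      using T by (intro mult_left_mono) auto
    moreover have "2 * (T / real N) * (\<kappa> * (\<gamma> * real N) ^ 3 / 3) = 2 * b * (real N)\<^sup>2"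
      using N by (simp add: b_def field_simps power2_eq_square power3_eq_cube)
    ultimately have 1: "exp (- (2 * (T / real N) * gap_sum N k)) \<le> exp (- (2 * b * (real N)\<^sup>2))" by simp
    have "(1 + a * real N) ^ m \<le> (1 + a * real N) ^ (2 * N)"
      using a m by (intro power_increasing) auto
    then have "(1 + a * real N) ^ m \<le> C * exp (b * (real N)\<^sup>2)" using C(2)[of N] by simp
    then have "(1 + a * real N) ^ m * exp (- (2 * (T / real N) * gap_sum N k))
      \<le> (C * exp (b * (real N)\<^sup>2)) * exp (- (2 * b * (real N)\<^sup>2))"
      using 1 C(1) by (intro mult_mono) auto
    also have "\<dots> = C * exp (- (b * (real N)\<^sup>2))" by (simp add: mult.assoc flip: exp_add)
    finally show ?thesis .
  qed
  have a_eq: "1 + 1 / (\<kappa> * (T / real N)) = 1 + a * real N" for N by (simp add: a_def)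
  have Q: "node_quotient lam (T / real N) N k
      \<le> (1 + a * real N) ^ (2 * N - 2) * exp (- (2 * (T / real N) * gap_sum N k))"
    if k: "k \<in> {1..N}" for N k
    by (rule node_quotient_le_crude[of "T / real N" k N, unfolded a_eq]) (use k T in auto)
  show thesis
  proof (rule that[OF C(1) b], intro allI ballI impI conjI)
    fix N k assume k: "k \<in> {1..N}" "\<gamma> * real N \<le> real N - real k"
    show "node_quotient lam (T / real N) N k \<le> C * exp (- (b * (real N)\<^sup>2))"
      using Q[OF k(1)] main[OF k, of "2 * N - 2"] by simp
    fix n assume n: "n \<in> {1..N} - {k}"
    have \<Delta>: "0 < T / real N" using T k by simp
    have "node_quotient lam (T / real N) N k * node_sep lam (T / real N) n k
      \<le> ((1 + a * real N) ^ (2 * N - 2) * exp (- (2 * (T / real N) * gap_sum N k))) * (1 + a * real N)"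
      using Q[OF k(1)] node_sep_le_crude[OF \<Delta>, of k n] k n a unfolding a_eq
      by (intro mult_mono) auto
    also have "\<dots> = (1 + a * real N) ^ Suc (2 * N - 2) * exp (- (2 * (T / real N) * gap_sum N k))"
      by simp
    also have "\<dots> \<le> C * exp (- (b * (real N)\<^sup>2))"
    proof (rule main[OF k])
      have "1 \<le> N" using k by simp
      then show "Suc (2 * N - 2) \<le> 2 * N" by arith
    qed
    finally show "node_quotient lam (T / real N) N k * node_sep lam (T / real N) n k
      \<le> C * exp (- (b * (real N)\<^sup>2))" .
  qed
qed

text \<open>Nodes in the upper half are separated as in the case of a fixed step. In the lower half, the discs
  of relative radius \<open>\<tau>\<close> may overlap, but the decay of order \<open>exp (- b N\<^sup>2)\<close> is far stronger than required.\<close>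

lemma error_bounds_shrinking_step:
  assumes T: "0 < T" and l: "1 < l" and My: "0 < My" and \<tau>: "0 < \<tau>" "\<tau> < 1 / 2"
  obtains \<epsilon>s where "0 < \<epsilon>s"
    "\<forall>N\<ge>1. prony_error_bounds lam l My \<tau> \<epsilon>s (6 * My) (12 * My) N (T / real N)"
proof -
  have half: "0 < (1 / 2 :: real)" by simp
  obtain C0 b where Cb: "0 < C0" "0 < b" and away:
    "\<forall>N. \<forall>k\<in>{1..N}. 1 / 2 * real N \<le> real N - real k \<longrightarrow>
       node_quotient lam (T / real N) N k \<le> C0 * exp (- (b * (real N)\<^sup>2)) \<and>
       (\<forall>n\<in>{1..N} - {k}. node_quotient lam (T / real N) N k * node_sep lam (T / real N) n k
          \<le> C0 * exp (- (b * (real N)\<^sup>2)))"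
    using node_quotient_le_away[OF T half] .
  define g where "g = \<kappa> * T / 2"
  have g: "0 < g" using T \<kappa> by (simp add: g_def)
  define C1 where "C1 = exp (4 / (1 - exp (- g))\<^sup>2) * (1 / (1 - exp (- g)))"
  define C where "C = C0 + C1"
  define \<rho> where "\<rho> = exp (- min (2 * \<kappa> * T) b)"
  have C1: "0 < C1" using g by (simp add: C1_def)
  have C: "0 < C" using C1 Cb by (simp add: C_def)
  have \<rho>: "0 \<le> \<rho>" "\<rho> < 1" using T \<kappa> Cb by (auto simp: \<rho>_def)
  have \<rho>p: "exp (- (c * real m)) \<le> \<rho> ^ m" if "min (2 * \<kappa> * T) b \<le> c" for c m
  proof -
    have "exp (- (c * real m)) \<le> exp (real m * (- min (2 * \<kappa> * T) b))"
      using mult_left_mono[OF that, of "real m"] by (simp add: mult_ac)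
    also have "\<dots> = \<rho> ^ m" unfolding \<rho>_def by (rule exp_of_nat_mult)
    finally show ?thesis .
  qed
  have "prony_error_bounds lam l My \<tau> (min \<tau> (1 / 6) / (6 * My * (1 + C / (1 - \<rho>)))) (6 * My) (12 * My) N (T / real N)"
    if N: "1 \<le> N" for N
  proof (rule prony_error_bounds_if_decay[OF N _ l My \<tau> C \<rho>])
    show "0 < T / real N" using T N by simp
    fix k n assume k: "k \<in> {1..N}" and n: "n \<in> {1..N} - {k}"
    show "node_quotient lam (T / real N) N k * node_sep lam (T / real N) n k \<le> C * \<rho> ^ (N - k)"
    proof (cases "N \<le> 2 * k")
      case True
      have "1 \<le> \<bar>real n - real k\<bar>" using n by auto
      then have "g * 1 \<le> g * \<bar>real n - real k\<bar>" using g by (intro mult_left_mono) auto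
      also have "\<dots> \<le> \<bar>lam n - lam k\<bar> * (T / real N)"
        unfolding g_def by (rule linear_gap_upper_half[OF T N k True]) (use n in simp)
      finally have "g \<le> \<bar>lam n - lam k\<bar> * (T / real N)" by simp
      note sep = node_sep_antimono[OF g this]
      have "exp (- (2 * (T / real N) * gap_sum N k)) \<le> exp (- (2 * \<kappa> * T * real (N - k)))"
        using gap_last_scaled[OF T N k] by simp
      also have "\<dots> \<le> \<rho> ^ (N - k)" by (rule \<rho>p) simp
      finally have "exp (4 / (1 - exp (- g))\<^sup>2) * exp (- (2 * (T / real N) * gap_sum N k))
          \<le> exp (4 / (1 - exp (- g))\<^sup>2) * \<rho> ^ (N - k)" by (intro mult_left_mono) auto
      then have "node_quotient lam (T / real N) N k \<le> exp (4 / (1 - exp (- g))\<^sup>2) * \<rho> ^ (N - k)"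
        by (rule order_trans[OF node_quotient_le_upper_half[OF T N k True, folded g_def]])
      then have "node_quotient lam (T / real N) N k * node_sep lam (T / real N) n k
        \<le> (exp (4 / (1 - exp (- g))\<^sup>2) * \<rho> ^ (N - k)) * (1 / (1 - exp (- g)))"
        using sep \<rho> by (intro mult_mono) auto
      also have "\<dots> = C1 * \<rho> ^ (N - k)" by (simp add: C1_def mult_ac)
      also have "\<dots> \<le> C * \<rho> ^ (N - k)" using Cb \<rho> by (intro mult_right_mono) (auto simp: C_def)
      finally show ?thesis .
    next
      case False
      then have "1 / 2 * real N \<le> real N - real k" by linarith
      then have "node_quotient lam (T / real N) N k * node_sep lam (T / real N) n k
        \<le> C0 * exp (- (b * (real N)\<^sup>2))" using away k n by blast
      also have "\<dots> \<le> C0 * exp (- (b * real (N - k)))"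
      proof -
        have "real (N - k) \<le> real N" by simp
        also have "\<dots> \<le> (real N)\<^sup>2" using N by (simp add: power2_eq_square mult_le_cancel_left1)
        finally have "b * real (N - k) \<le> b * (real N)\<^sup>2" using Cb by (intro mult_left_mono) auto
        then show ?thesis using Cb by simp
      qed
      also have "\<dots> \<le> C0 * \<rho> ^ (N - k)" using Cb by (intro mult_left_mono \<rho>p) auto
      also have "\<dots> \<le> C * \<rho> ^ (N - k)" using C1 \<rho> by (intro mult_right_mono) (auto simp: C_def)
      finally show ?thesis .
    qed
  qed
  moreover have "0 < min \<tau> (1 / 6) / (6 * My * (1 + C / (1 - \<rho>)))"
    using \<tau> My C \<rho> by (intro divide_pos_pos mult_pos_pos add_pos_nonneg) auto
  ultimately show thesis using that by blast
qed

section \<open>The asymptotic bounds of the three regimes\<close>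

text \<open>The factor \<open>\<phi>\<^sub>n = exp (- \<lambda>\<^sub>n \<Delta>)\<close> together with \<open>exp (-2 (\<lambda>\<^sub>N - \<lambda>\<^sub>n) \<Delta>)\<close> is at most \<open>exp (- \<lambda>\<^sub>N \<Delta>)\<close>, whatever the
  value of \<open>n\<close>. So the bounds on the nodes near the end of the spectrum hold for all \<open>n \<le> N\<close>.\<close>

lemma phi_node_quotient_le:
  assumes \<Delta>: "0 < \<Delta>" and A: "0 \<le> A" and n: "n \<in> {1..N}"
    and Q: "node_quotient lam \<Delta> N n \<le> A * exp (- (2 * \<Delta> * gap_sum N n))"
  shows "phi lam \<Delta> n * node_quotient lam \<Delta> N n \<le> A * exp (- (\<Delta> * lam N))"
proof -
  have "phi lam \<Delta> n * node_quotient lam \<Delta> N n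
    \<le> exp (- (\<Delta> * lam n)) * (A * exp (- (2 * \<Delta> * gap_sum N n)))"
    using Q by (simp add: phi_def mult.commute)
  also have "\<dots> = A * exp (- (\<Delta> * (lam n + 2 * gap_sum N n)))"
    by (simp add: algebra_simps flip: exp_add)
  also have "\<dots> \<le> A * exp (- (\<Delta> * lam N))"
  proof -
    have "lam N \<le> lam n + 2 * gap_sum N n"
      using gap_sum_ge_last[OF n] lam_mono[of n N] n by auto
    then have "\<Delta> * lam N \<le> \<Delta> * (lam n + 2 * gap_sum N n)" using \<Delta> by (intro mult_left_mono) auto
    then show ?thesis using A by (intro mult_left_mono) auto
  qed
  finally show ?thesis .
qed

lemma index_set_bounds:
  assumes "(n, N) \<in> index_set \<eta>" "\<eta> \<le> 1"
  shows "n \<in> {1..N}" "real n \<le> \<eta> * real N"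
proof -
  have 1: "1 \<le> n" "real n \<le> \<eta> * real N"
    using assms(1) by (auto simp: index_set_def le_floor_iff)
  have "\<eta> * real N \<le> 1 * real N" using assms(2) by (intro mult_right_mono) auto
  then show "n \<in> {1..N}" "real n \<le> \<eta> * real N" using 1 by auto
qed

lemma eventually_large:
  fixes a b :: real assumes "0 < a"
  obtains N0 where "1 \<le> N0" "\<And>N::nat. N0 \<le> N \<Longrightarrow> b \<le> a * real N"
    "\<And>N::nat. N0 \<le> N \<Longrightarrow> b \<le> a * (real N)\<^sup>2" "\<And>N::nat. N0 \<le> N \<Longrightarrow> b \<le> a * real N ^ 3"
proof -
  define N0 where "N0 = max 1 (nat \<lceil>b / a\<rceil>)"
  have 1: "b \<le> a * real N" "1 \<le> real N" if "N0 \<le> N" for N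
  proof -
    have "b / a \<le> real N" using that by (auto simp: N0_def ceiling_le_iff nat_le_iff)
    then show "b \<le> a * real N" using assms by (simp add: field_simps)
    show "1 \<le> real N" using that by (simp add: N0_def)
  qed
  have p: "b \<le> a * real N ^ Suc m" if "N0 \<le> N" for N m
  proof -
    have "real N ^ 1 \<le> real N ^ Suc m" using 1(2)[OF that] by (intro power_increasing) auto
    then have "a * real N \<le> a * real N ^ Suc m" using assms by (intro mult_left_mono) auto
    then show ?thesis using 1(1)[OF that] by simp
  qed
  show thesis
    by (rule that[of N0]) (use 1 p[of _ 1] p[of _ 2] in \<open>auto simp: N0_def numeral_2_eq_2 numeral_3_eq_3\<close>)
qed

text \<open>The lower bound \<open>\<kappa> (1 - \<eta>)\<^sup>3 N\<^sup>3 / 3\<close> for the gap sum enters the exponent twice. The second copy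
  absorbs \<open>\<phi>\<^sub>n\<close>, which may exceed 1 if the first eigenvalues are negative.\<close>

lemma regime_fixed_step:
  assumes \<Delta>s: "0 < \<Delta>s" and My: "0 < My"
    and eb: "\<forall>N\<ge>1. \<forall>\<Delta>\<ge>\<Delta>s. prony_error_bounds lam l My \<tau> \<epsilon>s (6 * My) (12 * My) N \<Delta>"
    and \<eta>: "0 < \<eta>" "\<eta> < 1"
  shows "\<exists>\<Gamma>>0. \<exists>\<Gamma>1>0. \<exists>Dphi1>0. \<exists>Dphi2>0. \<exists>Dlam1>0. \<exists>c>0. \<exists>C>0. \<exists>N0.
            \<forall>N\<ge>N0. \<forall>\<Delta>\<ge>\<Delta>s. \<forall>\<epsilon> r. prony_outcome lam l My \<tau> \<epsilon>s N \<Delta> \<epsilon> r \<longrightarrow>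
              (\<forall>n. (n, N) \<in> index_set \<eta> \<longrightarrow>
                \<bar>r n - phi lam \<Delta> n\<bar> \<le> \<epsilon> * Dphi1 * exp (- \<Delta> * \<Gamma> * real N ^ 3)) \<and>
              (\<forall>n. (n, N) \<in> index_set 1 - index_set \<eta> \<longrightarrow>
                \<bar>r n - phi lam \<Delta> n\<bar> \<le> \<epsilon> * Dphi2 * exp (- \<Delta> * \<Gamma>1 * real N ^ 2)) \<and>
              (\<forall>n. (n, N) \<in> index_set \<eta> \<longrightarrow>
                \<bar>lam_est \<Delta> r n - lam n\<bar> \<le> \<epsilon> * (Dlam1 / \<Delta>) * exp (- \<Delta> * \<Gamma> * real N ^ 3)) \<and>
              (\<forall>n. (n, N) \<in> index_set \<eta> \<and> 0 < \<epsilon> \<longrightarrow>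
                prony_cond lam \<Delta> \<epsilon> r n \<le> C * exp (- c * \<Delta> * real N ^ 3))"
proof -
  define A where "A = exp (4 / (1 - exp (- (\<kappa> * \<Delta>s)))\<^sup>2)"
  define \<Gamma> where "\<Gamma> = \<kappa> * (1 - \<eta>) ^ 3 / 3"
  have A: "0 < A" by (simp add: A_def)
  have \<Gamma>: "0 < \<Gamma>" using \<kappa> \<eta> by (simp add: \<Gamma>_def)
  obtain N1 where N1: "1 \<le> N1" "\<And>N::nat. N1 \<le> N \<Longrightarrow> - lam 1 \<le> \<Gamma> * real N ^ 3"
    using eventually_large[OF \<Gamma>] by metis
  have k2: "0 < \<kappa> / 2" using \<kappa> by simp
  obtain N2 where N2: "\<And>N::nat. N2 \<le> N \<Longrightarrow> \<kappa> - lam 1 \<le> \<kappa> / 2 * (real N)\<^sup>2"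
    using eventually_large[OF k2] by metis
  have main: "\<bar>r n - phi lam \<Delta> n\<bar> \<le> \<epsilon> * (6 * My * A) * exp (- \<Delta> * \<Gamma> * real N ^ 3) \<and>
      \<bar>lam_est \<Delta> r n - lam n\<bar> \<le> \<epsilon> * (12 * My * A / \<Delta>) * exp (- \<Delta> * \<Gamma> * real N ^ 3) \<and>
      (0 < \<epsilon> \<longrightarrow> prony_cond lam \<Delta> \<epsilon> r n \<le> 12 * My * A / \<Delta>s * exp (- \<Gamma> * \<Delta> * real N ^ 3))"
    if N: "max N1 N2 \<le> N" and \<Delta>: "\<Delta>s \<le> \<Delta>" and r: "prony_outcome lam l My \<tau> \<epsilon>s N \<Delta> \<epsilon> r"
      and ni: "(n, N) \<in> index_set \<eta>" for N \<Delta> \<epsilon> r n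
  proof -
    have n: "n \<in> {1..N}" "real n \<le> \<eta> * real N" using index_set_bounds[OF ni] \<eta> by auto
    have \<Delta>0: "0 < \<Delta>" and N': "1 \<le> N" using \<Delta> \<Delta>s n by auto
    note oe = outcome_error[OF eb[rule_format, OF N' \<Delta>] r n(1) _ _ \<Delta>0]
    have "((1 - \<eta>) * real N) ^ 3 \<le> (real N - real n) ^ 3"
    proof (rule power_mono)
      show "(1 - \<eta>) * real N \<le> real N - real n" using n(2) by (simp add: algebra_simps)
      show "0 \<le> (1 - \<eta>) * real N" using \<eta> by simp
    qed
    then have "\<kappa> * ((1 - \<eta>) * real N) ^ 3 \<le> \<kappa> * (real N - real n) ^ 3"
      using \<kappa> by (intro mult_left_mono) auto
    then have "\<kappa> * ((1 - \<eta>) * real N) ^ 3 / 3 \<le> gap_sum N n"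
      using gap_sum_ge_cube[OF n(1)] by simp
    then have S: "\<Gamma> * real N ^ 3 \<le> gap_sum N n" by (simp add: \<Gamma>_def power_mult_distrib mult_ac)
    have Q: "node_quotient lam \<Delta> N n \<le> A * exp (- (2 * \<Delta> * gap_sum N n))"
      unfolding A_def by (rule node_quotient_le_fixed_step[OF \<Delta>s \<Delta> n(1)])
    have "\<Delta> * (\<Gamma> * real N ^ 3) \<le> \<Delta> * gap_sum N n" "0 \<le> \<Delta> * (\<Gamma> * real N ^ 3)"
      using S \<Delta>0 \<Gamma> by (auto intro!: mult_left_mono)
    then have e: "exp (- (2 * \<Delta> * gap_sum N n)) \<le> exp (- \<Delta> * \<Gamma> * real N ^ 3)" by simp
    have Q1: "node_quotient lam \<Delta> N n \<le> A * exp (- \<Delta> * \<Gamma> * real N ^ 3)"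
      by (rule order_trans[OF Q mult_left_mono[OF e less_imp_le[OF A]]])
    have "phi lam \<Delta> n * node_quotient lam \<Delta> N n
      \<le> exp (- lam n * \<Delta>) * (A * exp (- (2 * \<Delta> * gap_sum N n)))"
      using Q by (simp add: phi_def)
    also have "\<dots> = A * exp (- (\<Delta> * (lam n + 2 * gap_sum N n)))"
      by (simp add: algebra_simps flip: exp_add)
    also have "\<dots> \<le> A * exp (- (\<Delta> * (\<Gamma> * real N ^ 3)))"
    proof -
      have "\<Gamma> * real N ^ 3 \<le> lam n + 2 * gap_sum N n"
        using S N1(2)[of N] N lam_mono[of 1 n] n by auto
      then have "\<Delta> * (\<Gamma> * real N ^ 3) \<le> \<Delta> * (lam n + 2 * gap_sum N n)"
        using \<Delta>0 by (intro mult_left_mono) auto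
      then show ?thesis using A by (intro mult_left_mono) auto
    qed
    finally have P1: "phi lam \<Delta> n * node_quotient lam \<Delta> N n \<le> A * exp (- \<Delta> * \<Gamma> * real N ^ 3)"
      by (simp add: mult_ac)
    have "prony_cond lam \<Delta> \<epsilon> r n \<le> 12 * My * A / \<Delta>s * exp (- \<Gamma> * \<Delta> * real N ^ 3)" if e: "0 < \<epsilon>"
    proof -
      have "prony_cond lam \<Delta> \<epsilon> r n \<le> 12 * My * A * (1 / \<Delta>) * exp (- \<Delta> * \<Gamma> * real N ^ 3)"
        by (rule oe(3)[OF _ _ Q1 e]) (use My in auto)
      also have "\<dots> \<le> 12 * My * A * (1 / \<Delta>s) * exp (- \<Delta> * \<Gamma> * real N ^ 3)"
        using My A \<Delta> \<Delta>s by (intro mult_right_mono mult_left_mono divide_left_mono) auto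
      finally show ?thesis by (simp add: mult_ac)
    qed
    then show ?thesis using oe(1)[OF _ _ P1] oe(2)[OF _ _ Q1] My by auto
  qed
  have main2: "\<bar>r n - phi lam \<Delta> n\<bar> \<le> \<epsilon> * (6 * My * A) * exp (- \<Delta> * (\<kappa> / 2) * real N ^ 2)"
    if N: "max N1 N2 \<le> N" and \<Delta>: "\<Delta>s \<le> \<Delta>" and r: "prony_outcome lam l My \<tau> \<epsilon>s N \<Delta> \<epsilon> r"
      and ni: "(n, N) \<in> index_set 1" for N \<Delta> \<epsilon> r n
  proof -
    have n: "n \<in> {1..N}" using index_set_bounds[OF ni] by auto
    have \<Delta>0: "0 < \<Delta>" and N': "1 \<le> N" using \<Delta> \<Delta>s n by auto
    have "phi lam \<Delta> n * node_quotient lam \<Delta> N n \<le> A * exp (- (\<Delta> * lam N))"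
      by (rule phi_node_quotient_le[OF \<Delta>0 _ n])
        (use A node_quotient_le_fixed_step[OF \<Delta>s \<Delta> n] in \<open>auto simp: A_def\<close>)
    also have "\<dots> \<le> A * exp (- \<Delta> * (\<kappa> / 2) * real N ^ 2)"
    proof -
      have "\<kappa> / 2 * (real N)\<^sup>2 \<le> lam N" using lam_ge[OF N'] N2[of N] N by (simp add: algebra_simps)
      then have "\<Delta> * (\<kappa> / 2 * (real N)\<^sup>2) \<le> \<Delta> * lam N" using \<Delta>0 by (intro mult_left_mono) auto
      then show ?thesis using A by (intro mult_left_mono) (auto simp: mult_ac)
    qed
    finally show ?thesis using outcome_error(1)[OF eb[rule_format, OF N' \<Delta>] r n _ _ \<Delta>0] My by simp
  qed
  show ?thesis
    by (rule exI[of _ \<Gamma>], rule conjI[OF \<Gamma>], rule exI[of _ "\<kappa> / 2"], rule conjI[OF k2],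
      rule exI[of _ "6 * My * A"], rule conjI, use My A in simp,
      rule exI[of _ "6 * My * A"], rule conjI, use My A in simp,
      rule exI[of _ "12 * My * A"], rule conjI, use My A in simp,
      rule exI[of _ \<Gamma>], rule conjI[OF \<Gamma>],
      rule exI[of _ "12 * My * A / \<Delta>s"], rule conjI, use My A \<Delta>s in simp,
      rule exI[of _ "max N1 N2"]) (use main main2 in blast)
qed

text \<open>For \<open>\<eta> < 1\<close> the index set excludes \<open>n = N\<close>, so the gap sum is at least \<open>\<lambda>\<^sub>N - \<lambda>\<^sub>n \<ge> \<kappa> N\<close>. This
  is why the number of nodes can be chosen before \<open>\<eta>\<close>.\<close>

lemma regime_large_step:
  assumes \<Delta>s: "0 < \<Delta>s" and My: "0 < My" and \<theta>: "0 < \<theta>"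
    and eb: "\<forall>N\<ge>1. \<forall>\<Delta>\<ge>\<Delta>s. prony_error_bounds lam l My \<tau> \<epsilon>s (6 * My) (12 * My) N \<Delta>"
  shows "\<exists>N\<theta>. \<forall>\<eta>. 0 < \<eta> \<and> \<eta> < 1 \<longrightarrow>
          (\<exists>Dphi3>0. \<exists>Dlam1>0. \<exists>C>0. \<exists>\<Delta>0.
            \<forall>\<Delta>. \<Delta>s \<le> \<Delta> \<and> \<Delta>0 \<le> \<Delta> \<longrightarrow>
              (\<forall>N\<ge>N\<theta>. \<forall>\<epsilon> r. prony_outcome lam l My \<tau> \<epsilon>s N \<Delta> \<epsilon> r \<longrightarrow>
                (\<forall>n. (n, N) \<in> index_set 1 \<longrightarrow>
                  \<bar>r n - phi lam \<Delta> n\<bar> \<le> \<epsilon> * Dphi3 * exp (- \<theta> * \<Delta>)) \<and>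
                (\<forall>n. (n, N) \<in> index_set \<eta> \<longrightarrow>
                  \<bar>lam_est \<Delta> r n - lam n\<bar> \<le> \<epsilon> * (Dlam1 / \<Delta>) * exp (- \<theta> * \<Delta>)) \<and>
                (\<forall>n. (n, N) \<in> index_set \<eta> \<and> 0 < \<epsilon> \<longrightarrow>
                  prony_cond lam \<Delta> \<epsilon> r n \<le> C * (1 / \<Delta>) * exp (- \<theta> * \<Delta>))))"
proof -
  define A where "A = exp (4 / (1 - exp (- (\<kappa> * \<Delta>s)))\<^sup>2)"
  have A: "0 < A" by (simp add: A_def)
  obtain N1 where N1: "\<And>N::nat. N1 \<le> N \<Longrightarrow> \<theta> + \<kappa> - lam 1 \<le> \<kappa> * (real N)\<^sup>2"
    using eventually_large[OF \<kappa>] by metis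
  obtain N2 where N2: "\<And>N::nat. N2 \<le> N \<Longrightarrow> \<theta> \<le> \<kappa> * real N"
    using eventually_large[OF \<kappa>] by metis
  have main: "\<bar>r n - phi lam \<Delta> n\<bar> \<le> \<epsilon> * (6 * My * A) * exp (- \<theta> * \<Delta>)"
    if N: "max N1 N2 \<le> N" and \<Delta>: "\<Delta>s \<le> \<Delta>" and r: "prony_outcome lam l My \<tau> \<epsilon>s N \<Delta> \<epsilon> r"
      and ni: "(n, N) \<in> index_set 1" for N \<Delta> \<epsilon> r n
  proof -
    have n: "n \<in> {1..N}" using index_set_bounds[OF ni] by auto
    have \<Delta>0: "0 < \<Delta>" and N': "1 \<le> N" using \<Delta> \<Delta>s n by auto
    have "phi lam \<Delta> n * node_quotient lam \<Delta> N n \<le> A * exp (- (\<Delta> * lam N))"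
      by (rule phi_node_quotient_le[OF \<Delta>0 _ n])
        (use A node_quotient_le_fixed_step[OF \<Delta>s \<Delta> n] in \<open>auto simp: A_def\<close>)
    also have "\<dots> \<le> A * exp (- \<theta> * \<Delta>)"
    proof -
      have "\<theta> \<le> lam N" using lam_ge[OF N'] N1[of N] N by (simp add: algebra_simps)
      then have "\<Delta> * \<theta> \<le> \<Delta> * lam N" using \<Delta>0 by (intro mult_left_mono) auto
      then show ?thesis using A by (intro mult_left_mono) (auto simp: mult_ac)
    qed
    finally show ?thesis using outcome_error(1)[OF eb[rule_format, OF N' \<Delta>] r n _ _ \<Delta>0] My by simp
  qed
  have main2: "\<bar>lam_est \<Delta> r n - lam n\<bar> \<le> \<epsilon> * (12 * My * A / \<Delta>) * exp (- \<theta> * \<Delta>) \<and>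
      (0 < \<epsilon> \<longrightarrow> prony_cond lam \<Delta> \<epsilon> r n \<le> 12 * My * A * (1 / \<Delta>) * exp (- \<theta> * \<Delta>))"
    if \<eta>: "0 < \<eta>" "\<eta> < 1" and N: "max N1 N2 \<le> N" and \<Delta>: "\<Delta>s \<le> \<Delta>"
      and r: "prony_outcome lam l My \<tau> \<epsilon>s N \<Delta> \<epsilon> r" and ni: "(n, N) \<in> index_set \<eta>" for \<eta> N \<Delta> \<epsilon> r n
  proof -
    have n: "n \<in> {1..N}" "real n \<le> \<eta> * real N" using index_set_bounds[OF ni] \<eta> by auto
    have \<Delta>0: "0 < \<Delta>" and N': "1 \<le> N" using \<Delta> \<Delta>s n by auto
    have "\<eta> * real N < 1 * real N" using \<eta> N' by (intro mult_strict_right_mono) auto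
    then have "n < N" using n(2) by simp
    then have "1 \<le> real (N - n)" by simp
    then have "\<kappa> * (1 * real N) \<le> \<kappa> * (real (N - n) * real N)"
      using \<kappa> by (intro mult_left_mono mult_right_mono) auto
    then have "\<theta> \<le> gap_sum N n"
      using N2[of N] N gap_last_ge[OF n(1)] gap_sum_ge_last[OF n(1)] by simp
    then have "\<Delta> * \<theta> \<le> \<Delta> * gap_sum N n" "0 \<le> \<Delta> * \<theta>"
      using \<Delta>0 \<theta> by (auto intro!: mult_left_mono)
    then have e: "exp (- (2 * \<Delta> * gap_sum N n)) \<le> exp (- \<theta> * \<Delta>)" by (simp add: mult_ac)
    have "node_quotient lam \<Delta> N n \<le> A * exp (- (2 * \<Delta> * gap_sum N n))"
      unfolding A_def by (rule node_quotient_le_fixed_step[OF \<Delta>s \<Delta> n(1)])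
    also have "\<dots> \<le> A * exp (- \<theta> * \<Delta>)" using e A by (intro mult_left_mono) auto
    finally have Q: "node_quotient lam \<Delta> N n \<le> A * exp (- \<theta> * \<Delta>)" .
    note oe = outcome_error[OF eb[rule_format, OF N' \<Delta>] r n(1) _ _ \<Delta>0]
    show ?thesis using oe(2,3)[OF _ _ Q] My by auto
  qed
  show ?thesis
  proof (rule exI[of _ "max N1 N2"], intro allI impI)
    fix \<eta> :: real assume \<eta>: "0 < \<eta> \<and> \<eta> < 1"
    show "\<exists>Dphi3>0. \<exists>Dlam1>0. \<exists>C>0. \<exists>\<Delta>0.
            \<forall>\<Delta>. \<Delta>s \<le> \<Delta> \<and> \<Delta>0 \<le> \<Delta> \<longrightarrow>
              (\<forall>N\<ge>max N1 N2. \<forall>\<epsilon> r. prony_outcome lam l My \<tau> \<epsilon>s N \<Delta> \<epsilon> r \<longrightarrow>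
                (\<forall>n. (n, N) \<in> index_set 1 \<longrightarrow>
                  \<bar>r n - phi lam \<Delta> n\<bar> \<le> \<epsilon> * Dphi3 * exp (- \<theta> * \<Delta>)) \<and>
                (\<forall>n. (n, N) \<in> index_set \<eta> \<longrightarrow>
                  \<bar>lam_est \<Delta> r n - lam n\<bar> \<le> \<epsilon> * (Dlam1 / \<Delta>) * exp (- \<theta> * \<Delta>)) \<and>
                (\<forall>n. (n, N) \<in> index_set \<eta> \<and> 0 < \<epsilon> \<longrightarrow>
                  prony_cond lam \<Delta> \<epsilon> r n \<le> C * (1 / \<Delta>) * exp (- \<theta> * \<Delta>)))"
      by (rule exI[of _ "6 * My * A"], rule conjI, use My A in simp,
        rule exI[of _ "12 * My * A"], rule conjI, use My A in simp,
        rule exI[of _ "12 * My * A"], rule conjI, use My A in simp,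
        rule exI[of _ 0]) (use main main2 \<eta> in blast)
  qed
qed

text \<open>Here \<open>\<phi>\<^sub>n \<le> exp (\<bar>\<lambda>\<^sub>1\<bar> T)\<close> for all \<open>n \<le> N\<close>, and \<open>1/\<Delta> = N/T\<close> in the condition number costs half of the exponent.\<close>

lemma regime_shrinking_step:
  assumes T: "0 < T" and My: "0 < My"
    and eb: "\<forall>N\<ge>1. prony_error_bounds lam l My \<tau> \<epsilon>s (6 * My) (12 * My) N (T / real N)"
    and \<eta>: "0 < \<eta>" "\<eta> < 1"
  shows "\<exists>\<Gamma>2>0. \<exists>\<Gamma>3>0. \<exists>Dphi4>0. \<exists>Dphi5>0. \<exists>Dlam2>0. \<exists>c>0. \<exists>C>0. \<exists>N0.
            \<forall>N\<ge>N0. \<forall>\<Delta>. \<Delta> * real N = T \<longrightarrow>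
              (\<forall>\<epsilon> r. prony_outcome lam l My \<tau> \<epsilon>s N \<Delta> \<epsilon> r \<longrightarrow>
                (\<forall>n. (n, N) \<in> index_set \<eta> \<longrightarrow>
                  \<bar>r n - phi lam \<Delta> n\<bar> \<le> \<epsilon> * Dphi4 * exp (- \<Gamma>2 * real N ^ 2)) \<and>
                (\<forall>n. (n, N) \<in> index_set 1 - index_set \<eta> \<longrightarrow>
                  \<bar>r n - phi lam \<Delta> n\<bar> \<le> \<epsilon> * Dphi5 * exp (- \<Gamma>3 * real N)) \<and>
                (\<forall>n. (n, N) \<in> index_set \<eta> \<longrightarrow>
                  \<bar>lam_est \<Delta> r n - lam n\<bar> \<le> \<epsilon> * (Dlam2 / \<Delta>) * exp (- \<Gamma>2 * real N ^ 2)) \<and>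
                (\<forall>n. (n, N) \<in> index_set \<eta> \<and> 0 < \<epsilon> \<longrightarrow>
                  prony_cond lam \<Delta> \<epsilon> r n \<le> C * exp (- c * real N ^ 2)))"
proof -
  define L where "L = exp (\<bar>lam 1\<bar> * T)"
  have L: "1 \<le> L" using T by (simp add: L_def)
  have phiL: "phi lam (T / real N) n \<le> L" if "1 \<le> n" "n \<le> N" for n N
  proof -
    have "- lam n \<le> \<bar>lam 1\<bar>" using lam_mono[of 1 n] that by auto
    moreover have "T / real N \<le> T / 1" using T that by (intro divide_left_mono) auto
    ultimately have "- lam n * (T / real N) \<le> \<bar>lam 1\<bar> * T"
      using T by (intro order_trans[OF mult_right_mono mult_left_mono]) auto
    then show ?thesis by (simp add: phi_def L_def)
  qed
  have \<eta>': "0 < 1 - \<eta>" using \<eta> by simp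
  obtain C b where Cb: "0 < C" "0 < b" and away:
    "\<forall>N. \<forall>k\<in>{1..N}. (1 - \<eta>) * real N \<le> real N - real k \<longrightarrow>
       node_quotient lam (T / real N) N k \<le> C * exp (- (b * (real N)\<^sup>2)) \<and>
       (\<forall>n\<in>{1..N} - {k}. node_quotient lam (T / real N) N k * node_sep lam (T / real N) n k
          \<le> C * exp (- (b * (real N)\<^sup>2)))"
    using node_quotient_le_away[OF T \<eta>'] .
  have half: "0 < (1 / 2 :: real)" by simp
  obtain C' b' where Cb': "0 < C'" "0 < b'" and away':
    "\<forall>N. \<forall>k\<in>{1..N}. 1 / 2 * real N \<le> real N - real k \<longrightarrow>
       node_quotient lam (T / real N) N k \<le> C' * exp (- (b' * (real N)\<^sup>2)) \<and>
       (\<forall>n\<in>{1..N} - {k}. node_quotient lam (T / real N) N k * node_sep lam (T / real N) n k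
          \<le> C' * exp (- (b' * (real N)\<^sup>2)))"
    using node_quotient_le_away[OF T half] .
  define A where "A = exp (4 / (1 - exp (- (\<kappa> * T / 2)))\<^sup>2)"
  have A: "0 < A" by (simp add: A_def)
  have k2: "0 < \<kappa> / 2" using \<kappa> by simp
  obtain N2 where N2: "1 \<le> N2" "\<And>N::nat. N2 \<le> N \<Longrightarrow> \<kappa> - lam 1 \<le> \<kappa> / 2 * (real N)\<^sup>2"
    using eventually_large[OF k2] by metis
  define \<Gamma>3 where "\<Gamma>3 = min b' (T * \<kappa> / 2)"
  have \<Gamma>3: "0 < \<Gamma>3" using Cb' T \<kappa> by (simp add: \<Gamma>3_def)
  have main: "\<bar>r n - phi lam \<Delta> n\<bar> \<le> \<epsilon> * (6 * My * (L * C)) * exp (- b * real N ^ 2) \<and>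
      \<bar>lam_est \<Delta> r n - lam n\<bar> \<le> \<epsilon> * (12 * My * C / \<Delta>) * exp (- b * real N ^ 2) \<and>
      (0 < \<epsilon> \<longrightarrow> prony_cond lam \<Delta> \<epsilon> r n \<le> 24 * My * C / (T * b) * exp (- (b / 2) * real N ^ 2))"
    if N: "N2 \<le> N" and \<Delta>: "\<Delta> * real N = T" and r: "prony_outcome lam l My \<tau> \<epsilon>s N \<Delta> \<epsilon> r"
      and ni: "(n, N) \<in> index_set \<eta>" for N \<Delta> \<epsilon> r n
  proof -
    have n: "n \<in> {1..N}" "real n \<le> \<eta> * real N" using index_set_bounds[OF ni] \<eta> by auto
    have N': "1 \<le> N" using n by auto
    have \<Delta>eq: "\<Delta> = T / real N" using \<Delta> N' by (simp add: field_simps)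
    have \<Delta>0: "0 < T / real N" using T N' by simp
    have Q: "node_quotient lam (T / real N) N n \<le> C * exp (- b * real N ^ 2)"
    proof -
      have "(1 - \<eta>) * real N \<le> real N - real n" using n(2) by (simp add: algebra_simps)
      then have "node_quotient lam (T / real N) N n \<le> C * exp (- (b * (real N)\<^sup>2))"
        using away n(1) by blast
      then show ?thesis by simp
    qed
    have "phi lam (T / real N) n * node_quotient lam (T / real N) N n \<le> L * (C * exp (- b * real N ^ 2))"
      using phiL[of n N] n Q L node_quotient_pos[OF \<Delta>0 n(1)]
      by (intro mult_mono) auto
    then have P: "phi lam (T / real N) n * node_quotient lam (T / real N) N n \<le> (L * C) * exp (- b * real N ^ 2)"
      by simp
    note oe = outcome_error[OF eb[rule_format, OF N'] r[unfolded \<Delta>eq] n(1) _ _ \<Delta>0]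
    have "prony_cond lam \<Delta> \<epsilon> r n \<le> 24 * My * C / (T * b) * exp (- (b / 2) * real N ^ 2)" if e: "0 < \<epsilon>"
    proof -
      have "real N \<le> 2 / b * exp (b / 2 * real N ^ 2)"
      proof -
        have "b / 2 * real N \<le> b / 2 * (real N)\<^sup>2"
          using Cb N' by (intro mult_left_mono) (auto simp: power2_eq_square mult_le_cancel_left1)
        also have "\<dots> \<le> exp (b / 2 * (real N)\<^sup>2)"
          using exp_ge_add_one_self[of "b / 2 * (real N)\<^sup>2"] by linarith
        finally show ?thesis using Cb by (simp add: field_simps)
      qed
      then have NN: "real N * exp (- b * real N ^ 2) \<le> 2 / b * exp (b / 2 * real N ^ 2) * exp (- b * real N ^ 2)"
        by (intro mult_right_mono) auto
      also have "\<dots> = 2 / b * exp (- (b / 2) * real N ^ 2)"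
        by (simp add: mult.assoc flip: exp_add)
      finally have NN: "real N * exp (- b * real N ^ 2) \<le> 2 / b * exp (- (b / 2) * real N ^ 2)" .
      have "prony_cond lam \<Delta> \<epsilon> r n \<le> 12 * My * C * (1 / (T / real N)) * exp (- b * real N ^ 2)"
        unfolding \<Delta>eq by (rule oe(3)[OF _ _ Q e]) (use My in auto)
      also have "\<dots> = 12 * My * C / T * (real N * exp (- b * real N ^ 2))" by simp
      also have "\<dots> \<le> 12 * My * C / T * (2 / b * exp (- (b / 2) * real N ^ 2))"
        using NN My Cb T by (intro mult_left_mono) auto
      finally show ?thesis by (simp add: mult_ac)
    qed
    then show ?thesis using oe(1)[OF _ _ P] oe(2)[OF _ _ Q] My unfolding \<Delta>eq by auto
  qed
  have main2: "\<bar>r n - phi lam \<Delta> n\<bar> \<le> \<epsilon> * (6 * My * (A + L * C')) * exp (- \<Gamma>3 * real N)"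
    if N: "N2 \<le> N" and \<Delta>: "\<Delta> * real N = T" and r: "prony_outcome lam l My \<tau> \<epsilon>s N \<Delta> \<epsilon> r"
      and ni: "(n, N) \<in> index_set 1" for N \<Delta> \<epsilon> r n
  proof -
    have n: "n \<in> {1..N}" using index_set_bounds[OF ni] by auto
    have N': "1 \<le> N" using n by auto
    have \<Delta>eq: "\<Delta> = T / real N" using \<Delta> N' by (simp add: field_simps)
    have \<Delta>0: "0 < T / real N" using T N' by simp
    have "phi lam (T / real N) n * node_quotient lam (T / real N) N n \<le> (A + L * C') * exp (- \<Gamma>3 * real N)"
    proof (cases "N \<le> 2 * n")
      case True
      have "phi lam (T / real N) n * node_quotient lam (T / real N) N n \<le> A * exp (- (T / real N * lam N))"
        by (rule phi_node_quotient_le[OF \<Delta>0 _ n])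
          (use A node_quotient_le_upper_half[OF T N' n True] in \<open>auto simp: A_def\<close>)
      also have "\<dots> \<le> (A + L * C') * exp (- \<Gamma>3 * real N)"
      proof (rule mult_mono)
        have "\<kappa> / 2 * (real N)\<^sup>2 \<le> lam N" using lam_ge[OF N'] N2(2)[of N] N by (simp add: algebra_simps)
        then have "T / real N * (\<kappa> / 2 * (real N)\<^sup>2) \<le> T / real N * lam N"
          using \<Delta>0 by (intro mult_left_mono) auto
        moreover have "T / real N * (\<kappa> / 2 * (real N)\<^sup>2) = T * \<kappa> / 2 * real N"
          using N' by (simp add: power2_eq_square)
        moreover have "\<Gamma>3 * real N \<le> T * \<kappa> / 2 * real N"
          by (rule mult_right_mono) (auto simp: \<Gamma>3_def)
        ultimately show "exp (- (T / real N * lam N)) \<le> exp (- \<Gamma>3 * real N)" by simp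
      qed (use A L Cb' in auto)
      finally show ?thesis .
    next
      case False
      then have "1 / 2 * real N \<le> real N - real n" by linarith
      then have Q: "node_quotient lam (T / real N) N n \<le> C' * exp (- (b' * (real N)\<^sup>2))"
        using away' n by blast
      have "phi lam (T / real N) n * node_quotient lam (T / real N) N n \<le> L * (C' * exp (- (b' * (real N)\<^sup>2)))"
        using phiL[of n N] n Q L node_quotient_pos[OF \<Delta>0 n]
        by (intro mult_mono) auto
      also have "\<dots> = L * C' * exp (- (b' * (real N)\<^sup>2))" by simp
      also have "\<dots> \<le> (A + L * C') * exp (- \<Gamma>3 * real N)"
      proof (rule mult_mono)
        have "\<Gamma>3 * real N \<le> b' * (real N)\<^sup>2"
          using Cb' \<Gamma>3 N' by (intro mult_mono) (auto simp: \<Gamma>3_def power2_eq_square mult_le_cancel_left1)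
        then show "exp (- (b' * (real N)\<^sup>2)) \<le> exp (- \<Gamma>3 * real N)" by simp
      qed (use A L Cb' in auto)
      finally show ?thesis .
    qed
    then show ?thesis using outcome_error(1)[OF eb[rule_format, OF N'] r[unfolded \<Delta>eq] n _ _ \<Delta>0] My
      unfolding \<Delta>eq by simp
  qed
  show ?thesis
    by (rule exI[of _ b], rule conjI[OF Cb(2)], rule exI[of _ \<Gamma>3], rule conjI[OF \<Gamma>3],
      rule exI[of _ "6 * My * (L * C)"], rule conjI, use My L Cb in simp,
      rule exI[of _ "6 * My * (A + L * C')"], rule conjI, use My A L Cb' in \<open>simp add: add_pos_nonneg\<close>,
      rule exI[of _ "12 * My * C"], rule conjI, use My Cb in simp,
      rule exI[of _ "b / 2"], rule conjI, use Cb in simp,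
      rule exI[of _ "24 * My * C / (T * b)"], rule conjI, use My Cb T in simp,
      rule exI[of _ N2]) (use main main2 in blast)
qed

end

theorem theorem4:
  fixes p q :: "real \<Rightarrow> real" and lam :: "nat \<Rightarrow> real" and l My \<Delta>s \<tau> T :: real
  assumes "smooth_near_unit p" and "smooth_near_unit q"
    and "\<forall>x\<in>{0..1}. 0 < p x"
    and "SL_eigenvalue_seq p q lam"
    and "1 < l" and "0 < My"
    and "0 < \<Delta>s" and "0 < T"
    and "0 < \<tau>" and "\<tau> < 1 / 2"
    and "\<forall>\<Delta>\<ge>\<Delta>s. \<forall>n\<ge>1. \<forall>j\<ge>1. j \<noteq> n \<longrightarrow>
           2 * \<tau> \<le> \<bar>phi lam \<Delta> j - phi lam \<Delta> n\<bar> / phi lam \<Delta> n"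
  shows
    "(\<exists>\<epsilon>s>0. \<exists>Dphi>0. \<exists>Dlam>0.
        (\<forall>N\<ge>1. \<forall>\<Delta>\<ge>\<Delta>s. prony_error_bounds lam l My \<tau> \<epsilon>s Dphi Dlam N \<Delta>) \<and>
        (\<forall>\<eta>. 0 < \<eta> \<and> \<eta> < 1 \<longrightarrow>
          (\<exists>\<Gamma>>0. \<exists>\<Gamma>1>0. \<exists>Dphi1>0. \<exists>Dphi2>0. \<exists>Dlam1>0. \<exists>c>0. \<exists>C>0. \<exists>N0.
            \<forall>N\<ge>N0. \<forall>\<Delta>\<ge>\<Delta>s. \<forall>\<epsilon> r. prony_outcome lam l My \<tau> \<epsilon>s N \<Delta> \<epsilon> r \<longrightarrow>
              (\<forall>n. (n, N) \<in> index_set \<eta> \<longrightarrow>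
                \<bar>r n - phi lam \<Delta> n\<bar> \<le> \<epsilon> * Dphi1 * exp (- \<Delta> * \<Gamma> * real N ^ 3)) \<and>
              (\<forall>n. (n, N) \<in> index_set 1 - index_set \<eta> \<longrightarrow>
                \<bar>r n - phi lam \<Delta> n\<bar> \<le> \<epsilon> * Dphi2 * exp (- \<Delta> * \<Gamma>1 * real N ^ 2)) \<and>
              (\<forall>n. (n, N) \<in> index_set \<eta> \<longrightarrow>
                \<bar>lam_est \<Delta> r n - lam n\<bar> \<le> \<epsilon> * (Dlam1 / \<Delta>) * exp (- \<Delta> * \<Gamma> * real N ^ 3)) \<and>
              (\<forall>n. (n, N) \<in> index_set \<eta> \<and> 0 < \<epsilon> \<longrightarrow>
                prony_cond lam \<Delta> \<epsilon> r n \<le> C * exp (- c * \<Delta> * real N ^ 3)))))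
     \<and>
     (\<exists>\<epsilon>s>0. \<exists>Dphi>0. \<exists>Dlam>0.
        (\<forall>N\<ge>1. \<forall>\<Delta>\<ge>\<Delta>s. prony_error_bounds lam l My \<tau> \<epsilon>s Dphi Dlam N \<Delta>) \<and>
        (\<forall>\<theta>>0. \<exists>N\<theta>. \<forall>\<eta>. 0 < \<eta> \<and> \<eta> < 1 \<longrightarrow>
          (\<exists>Dphi3>0. \<exists>Dlam1>0. \<exists>C>0. \<exists>\<Delta>0.
            \<forall>\<Delta>. \<Delta>s \<le> \<Delta> \<and> \<Delta>0 \<le> \<Delta> \<longrightarrow>
              (\<forall>N\<ge>N\<theta>. \<forall>\<epsilon> r. prony_outcome lam l My \<tau> \<epsilon>s N \<Delta> \<epsilon> r \<longrightarrow>
                (\<forall>n. (n, N) \<in> index_set 1 \<longrightarrow>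
                  \<bar>r n - phi lam \<Delta> n\<bar> \<le> \<epsilon> * Dphi3 * exp (- \<theta> * \<Delta>)) \<and>
                (\<forall>n. (n, N) \<in> index_set \<eta> \<longrightarrow>
                  \<bar>lam_est \<Delta> r n - lam n\<bar> \<le> \<epsilon> * (Dlam1 / \<Delta>) * exp (- \<theta> * \<Delta>)) \<and>
                (\<forall>n. (n, N) \<in> index_set \<eta> \<and> 0 < \<epsilon> \<longrightarrow>
                  prony_cond lam \<Delta> \<epsilon> r n \<le> C * (1 / \<Delta>) * exp (- \<theta> * \<Delta>))))))
     \<and>
     (\<exists>\<epsilon>s>0. \<exists>Dphi>0. \<exists>Dlam>0.
        (\<forall>N\<ge>1. prony_error_bounds lam l My \<tau> \<epsilon>s Dphi Dlam N (T / real N)) \<and>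
        (\<forall>\<eta>. 0 < \<eta> \<and> \<eta> < 1 \<longrightarrow>
          (\<exists>\<Gamma>2>0. \<exists>\<Gamma>3>0. \<exists>Dphi4>0. \<exists>Dphi5>0. \<exists>Dlam2>0. \<exists>c>0. \<exists>C>0. \<exists>N0.
            \<forall>N\<ge>N0. \<forall>\<Delta>. \<Delta> * real N = T \<longrightarrow>
              (\<forall>\<epsilon> r. prony_outcome lam l My \<tau> \<epsilon>s N \<Delta> \<epsilon> r \<longrightarrow>
                (\<forall>n. (n, N) \<in> index_set \<eta> \<longrightarrow>
                  \<bar>r n - phi lam \<Delta> n\<bar> \<le> \<epsilon> * Dphi4 * exp (- \<Gamma>2 * real N ^ 2)) \<and>
                (\<forall>n. (n, N) \<in> index_set 1 - index_set \<eta> \<longrightarrow>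
                  \<bar>r n - phi lam \<Delta> n\<bar> \<le> \<epsilon> * Dphi5 * exp (- \<Gamma>3 * real N)) \<and>
                (\<forall>n. (n, N) \<in> index_set \<eta> \<longrightarrow>
                  \<bar>lam_est \<Delta> r n - lam n\<bar> \<le> \<epsilon> * (Dlam2 / \<Delta>) * exp (- \<Gamma>2 * real N ^ 2)) \<and>
                (\<forall>n. (n, N) \<in> index_set \<eta> \<and> 0 < \<epsilon> \<longrightarrow>
                  prony_cond lam \<Delta> \<epsilon> r n \<le> C * exp (- c * real N ^ 2))))))"
proof -
  obtain \<kappa> where "quadratic_gap lam \<kappa>" using SL_eigenvalue_gap[OF assms(1-4)] .
  then interpret quadratic_gap lam \<kappa> .
  have D: "0 < 6 * My" "0 < 12 * My" using assms(6) by simp_all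
  obtain \<epsilon>1 where \<epsilon>1: "0 < \<epsilon>1"
    "\<forall>N\<ge>1. \<forall>\<Delta>\<ge>\<Delta>s. prony_error_bounds lam l My \<tau> \<epsilon>1 (6 * My) (12 * My) N \<Delta>"
    using error_bounds_fixed_step[OF assms(7,5,6,9,10)] .
  obtain \<epsilon>3 where \<epsilon>3: "0 < \<epsilon>3"
    "\<forall>N\<ge>1. prony_error_bounds lam l My \<tau> \<epsilon>3 (6 * My) (12 * My) N (T / real N)"
    using error_bounds_shrinking_step[OF assms(8,5,6,9,10)] .
  (* A lower bound on the step size is common to the first two regimes, so they share the
     threshold and the constants. *)
  show ?thesis
    apply (intro conjI)
      apply (rule exI[of _ \<epsilon>1], rule conjI[OF \<epsilon>1(1)], rule exI[of _ "6 * My"], rule conjI[OF D(1)],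
        rule exI[of _ "12 * My"], rule conjI[OF D(2)], rule conjI[OF \<epsilon>1(2)])
      apply (intro allI impI, elim conjE, rule regime_fixed_step[OF assms(7,6) \<epsilon>1(2)]; assumption)
     apply (rule exI[of _ \<epsilon>1], rule conjI[OF \<epsilon>1(1)], rule exI[of _ "6 * My"], rule conjI[OF D(1)],
        rule exI[of _ "12 * My"], rule conjI[OF D(2)], rule conjI[OF \<epsilon>1(2)])
     apply (rule allI, rule impI, rule regime_large_step[OF assms(7,6) _ \<epsilon>1(2)]; assumption)
    apply (rule exI[of _ \<epsilon>3], rule conjI[OF \<epsilon>3(1)], rule exI[of _ "6 * My"], rule conjI[OF D(1)],
        rule exI[of _ "12 * My"], rule conjI[OF D(2)], rule conjI[OF \<epsilon>3(2)])
    apply (intro allI impI, elim conjE, rule regime_shrinking_step[OF assms(8,6) \<epsilon>3(2)]; assumption)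
    done
qed

end
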